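(* Let $1<\gamma<2$ and let $\rho,u$ be a solution in the sense of distributions on $(0,T)\times\mathbb{T}^d$ of the isentropic compressible Euler system $$\partial_t(\rho u)+\operatorname{div}(\rho u\otimes u)+\nabla p(\rho)=0,\qquad \partial_t\rho+\operatorname{div}(\rho u)=0.$$ Assume $$u\in B_r^{\alpha,\infty}((0,T)\times\mathbb{T}^d),\qquad \rho,\ \rho u\in B_q^{\beta,\infty}((0,T)\times\mathbb{T}^d),\qquad 0\le\underline{\rho}\le\rho\le\overline{\rho}\ \text{ a.e. in }(0,T)\times\mathbb{T}^d,$$ for some constants $\underline{\rho},\overline{\rho}$, exponents $r,q$ and $0\le\alpha,\beta\le1$ such that $$\frac1r+\frac2q\le1,\qquad\frac2r+\frac1q\le1,\qquad r,q\ge2,\qquad\alpha+\gamma\beta>1\qquad\text{and}\qquad2\alpha+\beta>1.$$ Assume that $\rho\in QNS(\mathcal{B}_\delta)$ for some $\delta>0$, i.e. $\rho$ is quasi-nearly subharmonic on $\mathcal{B}_\delta$, and that $p\in C^{1,\gamma-1}([\underline{\rho},\overline{\rho}])$ with $p'(0)=0$ as soon as $\underline{\rho}=0$. Then the energy is locally conserved, i.e. $$\partial_t\left(\tfrac12\rho|u|^2+P(\rho)\right)+\operatorname{div}\left[\left(\tfrac12\rho|u|^2+p(\rho)+P(\rho)\right)u\right]=0$$ in the sense of distributions on $(0,T)\times\mathbb{T}^d$.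
   Context: $\mathbb{T}^d$ is the $d$-dimensional torus; $u$ is the velocity, $\rho\ge0$ the density, $p=p(\rho)$ the pressure law. $\operatorname{div}$ and $\nabla$ act in the space variable. The pressure potential is $P(\rho)=\rho\int_1^\rho\frac{p(s)}{s^2}\,ds$, with the value at $\rho=0$ understood as the limit $\rho\to0^+$; the pressure is understood to be given on an interval for which this integral makes sense. For $\Omega=(0,T)\times\mathbb{T}^d$, the Besov space $B_q^{\alpha,\infty}(\Omega)$ consists of those $w$ for which $$\|w\|_{B_q^{\alpha,\infty}(\Omega)}:=\|w\|_{L^q(\Omega)}+\sup_{\xi\in\Omega}\frac{\|w(\cdot+\xi)-w\|_{L^q(\Omega\cap(\Omega-\xi))}}{|\xi|^\alpha}<\infty,$$ where $\xi$ ranges over (nonzero) space-time shifts. Mollification: with $N=1+d$, $\eta\in C_c^\infty(\mathbb{R}^N)$ is a fixed nonnegative radial function of integral $1$ with $\eta(x)=1$ for $|x|\le\frac13$ and $\eta(x)=0$ for $|x|\ge1$; $\eta^\varepsilon(x)=\varepsilon^{-N}\eta(x/\varepsilon)$ and $w^\varepsilon:=\eta^\varepsilon*w$, defined on $\Omega^\varepsilon=\{x\in\Omega:\operatorname{dist}(x,\partial\Omega)>\varepsilon\}$. The near-vacuum sets are $\mathcal{B}_{\varepsilon^\beta}:=\{y:\ 0<\rho^\varepsilon(y)<\varepsilon^\beta\ \text{and}\ \rho(y)\ne0\}$, so that $\mathcal{B}_\delta$ is this set with $\varepsilon=\delta^{1/\beta}$ (the assumptions force $\beta>0$). Quasi-nearly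 subharmonic functions: let $X$ be a subset of Euclidean space (here of space-time, of dimension $N$) and $v:X\to[0,+\infty)$ Borel measurable. Then $v\in QNS(X)$ if there are constants $\varepsilon_0=\varepsilon_0(v)$, $0<\varepsilon_0<1$, and $C\ge1$ such that for each open set $O\subset X$, $O\ne X$, each $x\in O$ and each $s$ with $0<s\le\varepsilon_0\,\delta^O(x)$, one has $v\in L^1(B_s(x))$ and $$v(x)\le\frac{C}{|B_s(x)|}\int_{B_s(x)}v(y)\,dy,$$ where $B_s(x)$ is the ball of radius $s$ centred at $x$ and $\delta^O(x)=\operatorname{dist}(x,O^c)$, with $O^c$ the complement of $O$ in $X$. *)

theory Defs
  imports "HOL-Probability.Essential_Supremum"
begin

text \<open>
  Conventions. A point of space-time is a pair \<open>(t, x)\<close> of type \<open>real \<times> (real ^ 'd)\<close>, whose norm is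
  the Euclidean norm of dimension \<open>N = 1 + d\<close>. The torus is \<open>\<real>\<^sup>d / \<int>\<^sup>d\<close>; a function (set) on
  \<open>(0,T) \<times> \<T>\<^sup>d\<close> is represented by its lift, a function (set) that is 1-periodic in each space
  variable, and integrals over the torus are integrals over the unit cell. Values of a lift at
  times outside \<open>(0,T)\<close> are never used.
\<close>

definition lattice :: "(real ^ 'd) set" where
  "lattice = {k. \<forall>i. k $ i \<in> \<int>}"

definition unit_cell :: "(real ^ 'd) set" where
  "unit_cell = {x. \<forall>i. 0 \<le> x $ i \<and> x $ i < 1}"

definition space_periodic :: "(real \<times> (real ^ 'd) \<Rightarrow> 'b) \<Rightarrow> bool" where
  "space_periodic f \<longleftrightarrow> (\<forall>t x. \<forall>k\<in>lattice. f (t, x + k) = f (t, x))"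

definition slab :: "real \<Rightarrow> (real \<times> (real ^ 'd)) set" where
  "slab T = {0<..<T} \<times> UNIV"

definition slab_cell :: "real \<Rightarrow> (real \<times> (real ^ 'd)) set" where
  "slab_cell T = {0<..<T} \<times> unit_cell"


section \<open>Besov spaces\<close>

definition Lq_norm ::
  "ennreal \<Rightarrow> 'a measure \<Rightarrow> ('a \<Rightarrow> 'b::{real_normed_vector, second_countable_topology}) \<Rightarrow> ennreal" where
  "Lq_norm q M w =
    (if q = \<infinity> then esssup M (\<lambda>z. ennreal (norm (w z)))
     else let I = (\<integral>\<^sup>+ z. ennreal (norm (w z) powr enn2real q) \<partial>M)
          in if I = \<infinity> then \<infinity> else ennreal (enn2real I powr (1 / enn2real q)))"

text \<open>
  Shifts range over the covering space. This changes nothing in the supremum: two shifts that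
  agree on the torus have the same numerator, and the shortest of them has the smallest
  denominator. The set under the norm of the difference is \<open>\<Omega> \<inter> (\<Omega> - \<xi>)\<close> (in the unit cell).
\<close>

definition besov_norm ::
  "real \<Rightarrow> real \<Rightarrow> ennreal \<Rightarrow> (real \<times> (real ^ 'd) \<Rightarrow> 'b::{real_normed_vector, second_countable_topology}) \<Rightarrow> ennreal"
  where
  "besov_norm T \<alpha> q w =
    Lq_norm q (lebesgue_on (slab_cell T)) w +
    (SUP \<xi>\<in>{\<xi>. \<xi> \<noteq> 0}.
       Lq_norm q (lebesgue_on {z \<in> slab_cell T. z + \<xi> \<in> slab T}) (\<lambda>z. w (z + \<xi>) - w z)
       / ennreal (norm \<xi> powr \<alpha>))"

definition besov ::
  "real \<Rightarrow> real \<Rightarrow> ennreal \<Rightarrow> (real \<times> (real ^ 'd) \<Rightarrow> 'b::{real_normed_vector, second_countable_topology}) set"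
  where
  "besov T \<alpha> q = {w. space_periodic w \<and> w \<in> borel_measurable (lebesgue_on (slab_cell T)) \<and>
                     besov_norm T \<alpha> q w < \<infinity>}"


section \<open>Test functions and balance laws in the sense of distributions\<close>

primrec Ck :: "nat \<Rightarrow> ('a::euclidean_space \<Rightarrow> real) \<Rightarrow> bool" where
  "Ck 0 f \<longleftrightarrow> continuous_on UNIV f"
| "Ck (Suc k) f \<longleftrightarrow> (\<forall>x. f differentiable (at x)) \<and>
     (\<forall>b\<in>Basis. Ck k (\<lambda>x. frechet_derivative f (at x) b))"

definition smooth :: "('a::euclidean_space \<Rightarrow> real) \<Rightarrow> bool" where
  "smooth f \<longleftrightarrow> (\<forall>k. Ck k f)"

text \<open>The torus is compact, so compact support in \<open>(0,T) \<times> \<T>\<^sup>d\<close> only restricts time.\<close>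

definition test_function :: "real \<Rightarrow> (real \<times> (real ^ 'd) \<Rightarrow> real) \<Rightarrow> bool" where
  "test_function T \<phi> \<longleftrightarrow> smooth \<phi> \<and> space_periodic \<phi> \<and>
     (\<exists>a b. 0 < a \<and> b < T \<and> (\<forall>t x. t \<notin> {a..b} \<longrightarrow> \<phi> (t, x) = 0))"

definition dt :: "(real \<times> (real ^ 'd) \<Rightarrow> real) \<Rightarrow> real \<times> (real ^ 'd) \<Rightarrow> real" where
  "dt \<phi> z = frechet_derivative \<phi> (at z) (1, 0)"

definition grad :: "(real \<times> (real ^ 'd) \<Rightarrow> real) \<Rightarrow> real \<times> (real ^ 'd) \<Rightarrow> real ^ 'd" where
  "grad \<phi> z = (\<chi> i. frechet_derivative \<phi> (at z) (0, axis i 1))"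

definition locally_integrable ::
  "real \<Rightarrow> (real \<times> (real ^ 'd) \<Rightarrow> 'b::{banach, second_countable_topology}) \<Rightarrow> bool" where
  "locally_integrable T f \<longleftrightarrow>
     (\<forall>a b. 0 < a \<and> b < T \<longrightarrow> set_integrable lebesgue ({a..b} \<times> unit_cell) f)"

text \<open>
  \<open>\<partial>\<^sub>t w + div F = 0\<close> in the sense of distributions on \<open>(0,T) \<times> \<T>\<^sup>d\<close>. Local integrability is part
  of the notion: it is what makes \<open>w\<close> and \<open>F\<close> distributions (and rules out that the integral
  below vanishes by convention).
\<close>

definition weak_balance ::
  "real \<Rightarrow> (real \<times> (real ^ 'd) \<Rightarrow> real) \<Rightarrow> (real \<times> (real ^ 'd) \<Rightarrow> real ^ 'd) \<Rightarrow> bool" where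
  "weak_balance T w F \<longleftrightarrow> locally_integrable T w \<and> locally_integrable T F \<and>
     (\<forall>\<phi>. test_function T \<phi> \<longrightarrow>
        (LINT z|lebesgue_on (slab_cell T). w z * dt \<phi> z + F z \<bullet> grad \<phi> z) = 0)"

text \<open>
  The i-th component of \<open>div (\<rho> u \<otimes> u) + \<nabla> p(\<rho>)\<close> is the divergence of the i-th row of
  \<open>\<rho> u \<otimes> u + p(\<rho>) Id\<close>.
\<close>

definition euler_solution ::
  "real \<Rightarrow> (real \<Rightarrow> real) \<Rightarrow> (real \<times> (real ^ 'd) \<Rightarrow> real) \<Rightarrow> (real \<times> (real ^ 'd) \<Rightarrow> real ^ 'd) \<Rightarrow> bool" where
  "euler_solution T p \<rho> u \<longleftrightarrow>
     (\<forall>i. weak_balance T (\<lambda>z. \<rho> z * u z $ i)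
            (\<lambda>z. (\<rho> z * u z $ i) *\<^sub>R u z + p (\<rho> z) *\<^sub>R axis i 1)) \<and>
     weak_balance T \<rho> (\<lambda>z. \<rho> z *\<^sub>R u z)"


section \<open>The pressure\<close>

definition pressure_potential :: "(real \<Rightarrow> real) \<Rightarrow> real \<Rightarrow> real" where
  "pressure_potential p \<rho> =
    (let P = (\<lambda>\<rho>. \<rho> * (LBINT s = ereal 1..ereal \<rho>. p s / s\<^sup>2))
     in if \<rho> = 0 then Lim (at_right 0) P else P \<rho>)"

text \<open>
  \<open>p(s) / s\<^sup>2\<close> is integrable between 1 and every positive density in the smallest interval
  containing 1 and \<open>[lo, hi]\<close>; nothing else is required of the pressure outside \<open>[lo, hi]\<close>.
\<close>

definition potential_defined :: "real \<Rightarrow> real \<Rightarrow> (real \<Rightarrow> real) \<Rightarrow> bool" where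
  "potential_defined lo hi p \<longleftrightarrow>
     (\<forall>\<rho>\<in>{min 1 lo..max 1 hi}. 0 < \<rho> \<longrightarrow>
        interval_lebesgue_integrable lborel (ereal 1) (ereal \<rho>) (\<lambda>s. p s / s\<^sup>2))"

definition C1_holder :: "real \<Rightarrow> real set \<Rightarrow> (real \<Rightarrow> real) \<Rightarrow> bool" where
  "C1_holder \<theta> S p \<longleftrightarrow>
     (\<exists>p'. (\<forall>s\<in>S. (p has_real_derivative p' s) (at s within S)) \<and>
           (\<exists>C. \<forall>s\<in>S. \<forall>t\<in>S. \<bar>p' s - p' t\<bar> \<le> C * \<bar>s - t\<bar> powr \<theta>))"


section \<open>Mollification and near-vacuum sets\<close>

definition mollifier :: "(real \<times> (real ^ 'd) \<Rightarrow> real) \<Rightarrow> bool" where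
  "mollifier \<eta> \<longleftrightarrow> smooth \<eta> \<and> (\<forall>z. 0 \<le> \<eta> z) \<and> (\<forall>z y. norm z = norm y \<longrightarrow> \<eta> z = \<eta> y) \<and>
     (LINT z|lborel. \<eta> z) = 1 \<and>
     (\<forall>z. norm z \<le> 1 / 3 \<longrightarrow> \<eta> z = 1) \<and> (\<forall>z. 1 \<le> norm z \<longrightarrow> \<eta> z = 0)"

definition mollify ::
  "(real \<times> (real ^ 'd) \<Rightarrow> real) \<Rightarrow> real \<Rightarrow> (real \<times> (real ^ 'd) \<Rightarrow> real) \<Rightarrow> real \<times> (real ^ 'd) \<Rightarrow> real"
  where
  "mollify \<eta> \<epsilon> w y =
     (LINT z|lebesgue. \<eta> ((1 / \<epsilon>) *\<^sub>R (y - z)) / \<epsilon> ^ (1 + CARD('d)) * w z)"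

definition slab_interior :: "real \<Rightarrow> real \<Rightarrow> (real \<times> (real ^ 'd)) set" where
  "slab_interior T \<epsilon> = {y \<in> slab T. \<epsilon> < infdist y (frontier (slab T))}"

text \<open>
  The near-vacuum set with index \<open>\<delta> = \<epsilon>\<^sup>\<beta>\<close>. It lies in the part of the slab where the mollified
  density is defined, so it is empty when \<open>\<epsilon> \<ge> T / 2\<close>.
\<close>

definition near_vacuum ::
  "(real \<times> (real ^ 'd) \<Rightarrow> real) \<Rightarrow> real \<Rightarrow> real \<Rightarrow> real \<Rightarrow> (real \<times> (real ^ 'd) \<Rightarrow> real) \<Rightarrow> (real \<times> (real ^ 'd)) set"
  where
  "near_vacuum \<eta> T \<beta> \<delta> \<rho> =
     (let \<epsilon> = \<delta> powr (1 / \<beta>)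
      in {y \<in> slab_interior T \<epsilon>. 0 < mollify \<eta> \<epsilon> \<rho> y \<and> mollify \<eta> \<epsilon> \<rho> y < \<delta> \<and> \<rho> y \<noteq> 0})"


section \<open>Quasi-nearly subharmonic functions\<close>

text \<open>The ball around \<open>x\<close> in \<open>\<real> \<times> \<T>\<^sup>d\<close>, represented by points of the unit cell.\<close>

definition torus_ball :: "real \<times> (real ^ 'd) \<Rightarrow> real \<Rightarrow> (real \<times> (real ^ 'd)) set" where
  "torus_ball x s = {y \<in> UNIV \<times> unit_cell. \<exists>k\<in>lattice. dist x (y + (0, k)) < s}"

text \<open>
  \<open>X\<close> and \<open>U\<close> are lifts of subsets of \<open>\<real> \<times> \<T>\<^sup>d\<close>, whence the periodicity of \<open>U\<close>. As \<open>v\<close> is a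
  function on \<open>X\<close> only, the definition is read in the metric measure space \<open>X\<close> (with the distance
  and Lebesgue measure of space-time): open sets, complements and balls are those of \<open>X\<close>, and \<open>v\<close>
  is integrated over a ball of \<open>X\<close>.
\<close>

definition QNS :: "(real \<times> (real ^ 'd)) set \<Rightarrow> (real \<times> (real ^ 'd) \<Rightarrow> real) \<Rightarrow> bool" where
  "QNS X v \<longleftrightarrow>
     v \<in> borel_measurable (restrict_space borel X) \<and> (\<forall>x\<in>X. 0 \<le> v x) \<and>
     (\<exists>\<epsilon>\<^sub>0 C. 0 < \<epsilon>\<^sub>0 \<and> \<epsilon>\<^sub>0 < 1 \<and> 1 \<le> C \<and>
       (\<forall>U x s. openin (top_of_set X) U \<and> space_periodic (\<lambda>z. z \<in> U) \<and> U \<noteq> X \<and> x \<in> U \<and>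
          0 < s \<and> s \<le> \<epsilon>\<^sub>0 * infdist x (X - U) \<longrightarrow>
          (let B = torus_ball x s \<inter> X
           in set_integrable lebesgue B v \<and>
              v x \<le> C / measure lebesgue B * (LINT y:B|lebesgue. v y))))"

end

theory Submission
  imports Defs "HOL-Real_Asymp.Real_Asymp"
begin

text \<open>
The energy balance is obtained by mollification. Write \<open>w\<^sup>\<epsilon>\<close> for the mollification of \<open>w\<close> at scale
\<open>\<epsilon>\<close> and \<open>m = \<rho> u\<close>. The mollified momentum equation is tested with \<open>\<phi> u\<^sup>\<epsilon>\<close>, the mollified mass
equation with \<open>\<phi> |u\<^sup>\<epsilon>|\<^sup>2 / 2\<close> and with \<open>\<phi> Q(\<rho>\<^sup>\<epsilon>)\<close>, where \<open>Q\<close> plays the part of the derivative of the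
pressure potential \<open>P\<close>, that is \<open>s Q'(s) = p'(s)\<close> and \<open>P(s) = s Q(s) - p(s)\<close>. What results
(\<open>mollified_energy_identity\<close>) is the energy balance of the mollified fields up to four errors:
the commutators \<open>m\<^sup>\<epsilon> - \<rho>\<^sup>\<epsilon> u\<^sup>\<epsilon>\<close> and \<open>(m \<otimes> u)\<^sup>\<epsilon> - m\<^sup>\<epsilon> \<otimes> u\<^sup>\<epsilon>\<close> paired with first derivatives of
\<open>u\<^sup>\<epsilon>\<close>, the pressure commutator \<open>p(\<rho>)\<^sup>\<epsilon> - p(\<rho>\<^sup>\<epsilon>)\<close> paired with \<open>div u\<^sup>\<epsilon>\<close>, and \<open>m\<^sup>\<epsilon> - \<rho>\<^sup>\<epsilon> u\<^sup>\<epsilon>\<close>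
paired with \<open>Q'(\<rho>\<^sup>\<epsilon>) \<nabla>\<rho>\<^sup>\<epsilon>\<close>.

Besov regularity says that increments at distance \<open>\<epsilon>\<close> are of size \<open>\<epsilon>\<^sup>\<alpha>\<close> for \<open>u\<close> and \<open>\<epsilon>\<^sup>\<beta>\<close> for \<open>\<rho>\<close>
and \<open>m\<close>. A commutator is bilinear in increments (\<open>Lp_order_commutator\<close>), and a derivative of a
mollification is an increment divided by \<open>\<epsilon>\<close> (\<open>Lp_order_pd_mollification\<close>), so the first two
errors have size \<open>\<epsilon>\<close> to the power \<open>2 \<alpha> + \<beta> - 1\<close>. By Taylor's formula the pressure commutator has
size \<open>\<epsilon>\<close> to the power \<open>\<gamma> \<beta>\<close>, and the third error is of order \<open>\<alpha> + \<gamma> \<beta> - 1\<close>.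

The last error is the delicate one, because \<open>Q'(s) = p'(s) / s\<close> may grow like \<open>s\<close> to the power
\<open>\<gamma> - 2\<close> at vacuum. The remedy is to let \<open>Q\<close> depend on \<open>\<epsilon>\<close>: with \<open>h = \<epsilon>\<^sup>\<beta>\<close> take
\<open>Q'(s) = p'(s) / max s h\<close>. Then \<open>|Q'|\<close> is at most a multiple of \<open>h\<close> to the power \<open>\<gamma> - 2\<close> on the whole range,
so the last error has order \<open>\<alpha> + \<beta> + (\<beta> - 1) + \<beta> (\<gamma> - 2) = \<alpha> + \<gamma> \<beta> - 1\<close> uniformly down to vacuum.
The price is that \<open>Q\<close> belongs to a pressure that differs from \<open>p\<close> by \<open>O(h\<^sup>\<gamma>)\<close>, which is again the
size of the pressure commutator, and to a potential that differs from \<open>P\<close> by \<open>O(h)\<close>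
(\<open>pressure_approximation\<close>). Since all exponents are positive, the errors vanish in the limit
(\<open>borel_energy_balance\<close>).

The integrability exponents enter through products of two or three of these factors. The
relation \<open>Lp_order\<close> keeps track of size and integrability at once: both are additive under
products, and averaging over shifts preserves them. The remaining work is to transfer the
equations, which concern periodic Lebesgue measurable functions and smooth test functions, to
mollified Borel representatives and test functions of class \<open>C\<^sup>1\<close> (\<open>mollified_balance\<close>,
\<open>borel_version\<close>).
\<close>

section \<open>Families of functions with a given order in an \<open>L\<^sup>p\<close> space\<close>

text \<open>
The family \<open>D e\<close> has size \<open>e\<^sup>s\<close> in \<open>L\<^sup>r\<close>, where \<open>\<theta> = 1 / r\<close>, uniformly in \<open>0 < e < e0\<close>. Instead of a
norm there is a weight \<open>\<Phi>\<close> bounded in \<open>L\<^sup>1\<close>. In this form \<open>\<theta> = 0\<close> covers bounded functions,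
Hoelder's inequality becomes the addition of exponents, and on a finite measure space an exponent
\<open>\<theta> \<le> 1\<close> suffices for integrability.
\<close>

definition Lp_order :: "'z measure \<Rightarrow> real \<Rightarrow> real \<Rightarrow> real \<Rightarrow> (real \<Rightarrow> 'z \<Rightarrow> real) \<Rightarrow> bool" where
  "Lp_order M e0 \<theta> s D \<longleftrightarrow> (\<exists>K \<Phi>. 0 \<le> K \<and> (\<forall>e. 0 < e \<and> e < e0 \<longrightarrow>
     \<Phi> e \<in> borel_measurable M \<and> (\<forall>z. 0 \<le> \<Phi> e z) \<and> (\<integral>\<^sup>+z. ennreal (\<Phi> e z) \<partial>M) \<le> ennreal K \<and>
     (AE z in M. \<bar>D e z\<bar> \<le> K * e powr s * (1 + \<Phi> e z) powr \<theta>)))"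

lemma Lp_orderI:
  assumes "0 \<le> K"
    and "\<And>e. 0 < e \<Longrightarrow> e < e0 \<Longrightarrow> \<Phi> e \<in> borel_measurable M"
    and "\<And>e z. 0 < e \<Longrightarrow> e < e0 \<Longrightarrow> 0 \<le> \<Phi> e z"
    and "\<And>e. 0 < e \<Longrightarrow> e < e0 \<Longrightarrow> (\<integral>\<^sup>+z. ennreal (\<Phi> e z) \<partial>M) \<le> ennreal K"
    and "\<And>e. 0 < e \<Longrightarrow> e < e0 \<Longrightarrow> AE z in M. \<bar>D e z\<bar> \<le> K * e powr s * (1 + \<Phi> e z) powr \<theta>"
  shows "Lp_order M e0 \<theta> s D"
  unfolding Lp_order_def using assms by (intro exI[of _ K] exI[of _ \<Phi>]) auto

lemma Lp_orderE:
  assumes "Lp_order M e0 \<theta> s D"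
  obtains K \<Phi> where "0 \<le> K"
    and "\<And>e. 0 < e \<Longrightarrow> e < e0 \<Longrightarrow> \<Phi> e \<in> borel_measurable M"
    and "\<And>e z. 0 < e \<Longrightarrow> e < e0 \<Longrightarrow> 0 \<le> \<Phi> e z"
    and "\<And>e. 0 < e \<Longrightarrow> e < e0 \<Longrightarrow> (\<integral>\<^sup>+z. ennreal (\<Phi> e z) \<partial>M) \<le> ennreal K"
    and "\<And>e. 0 < e \<Longrightarrow> e < e0 \<Longrightarrow> AE z in M. \<bar>D e z\<bar> \<le> K * e powr s * (1 + \<Phi> e z) powr \<theta>"
proof -
  from assms obtain K \<Phi> where "0 \<le> K" and *: "\<forall>e. 0 < e \<and> e < e0 \<longrightarrow>
     \<Phi> e \<in> borel_measurable M \<and> (\<forall>z. 0 \<le> \<Phi> e z) \<and> (\<integral>\<^sup>+z. ennreal (\<Phi> e z) \<partial>M) \<le> ennreal K \<and>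
     (AE z in M. \<bar>D e z\<bar> \<le> K * e powr s * (1 + \<Phi> e z) powr \<theta>)"
    unfolding Lp_order_def by blast
  show ?thesis by (rule that[OF \<open>0 \<le> K\<close>, of \<Phi>]) (use * in blast)+
qed

lemma Lp_order_mono:
  assumes D: "Lp_order M e0 \<theta> s D" and "0 \<le> C" and e0: "e0 \<le> 1"
    and "\<theta> \<le> \<theta>'" and "s' \<le> s"
    and le: "\<And>e. 0 < e \<Longrightarrow> e < e0 \<Longrightarrow> AE z in M. \<bar>D' e z\<bar> \<le> C * \<bar>D e z\<bar>"
  shows "Lp_order M e0 \<theta>' s' D'"
proof -
  from D obtain K \<Phi> where K: "0 \<le> K"
    and 1: "\<And>e. 0 < e \<Longrightarrow> e < e0 \<Longrightarrow> \<Phi> e \<in> borel_measurable M"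
    and 2: "\<And>e z. 0 < e \<Longrightarrow> e < e0 \<Longrightarrow> 0 \<le> \<Phi> e z"
    and 3: "\<And>e. 0 < e \<Longrightarrow> e < e0 \<Longrightarrow> (\<integral>\<^sup>+z. ennreal (\<Phi> e z) \<partial>M) \<le> ennreal K"
    and 4: "\<And>e. 0 < e \<Longrightarrow> e < e0 \<Longrightarrow> AE z in M. \<bar>D e z\<bar> \<le> K * e powr s * (1 + \<Phi> e z) powr \<theta>"
    by (rule Lp_orderE) blast
  show ?thesis
  proof (rule Lp_orderI[of "(1 + C) * K" _ \<Phi>])
    fix e assume e: "0 < e" "e < e0"
    have "ennreal K \<le> ennreal ((1 + C) * K)"
      using K \<open>0 \<le> C\<close> by (intro ennreal_leI) (simp add: distrib_right)
    then show "(\<integral>\<^sup>+z. ennreal (\<Phi> e z) \<partial>M) \<le> ennreal ((1 + C) * K)"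
      using 3[OF e] by order
    show "AE z in M. \<bar>D' e z\<bar> \<le> (1 + C) * K * e powr s' * (1 + \<Phi> e z) powr \<theta>'"
      using 4[OF e] le[OF e]
    proof eventually_elim
      case (elim z)
      have "\<bar>D' e z\<bar> \<le> (1 + C) * \<bar>D e z\<bar>" using elim(2) by (simp add: distrib_right)
      also have "\<dots> \<le> (1 + C) * (K * e powr s * (1 + \<Phi> e z) powr \<theta>)"
        using elim(1) \<open>0 \<le> C\<close> by (intro mult_left_mono) auto
      also have "\<dots> \<le> (1 + C) * (K * e powr s' * (1 + \<Phi> e z) powr \<theta>')"
        using K \<open>0 \<le> C\<close> e e0 2[OF e, of z] \<open>s' \<le> s\<close> \<open>\<theta> \<le> \<theta>'\<close>
        by (intro mult_left_mono mult_mono powr_mono powr_mono') auto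
      finally show ?case by (simp add: mult.assoc)
    qed
  qed (use K \<open>0 \<le> C\<close> 1 2 in auto)
qed

lemma Lp_order_bounded:
  assumes "\<And>e. 0 < e \<Longrightarrow> e < e0 \<Longrightarrow> AE z in M. \<bar>D e z\<bar> \<le> C * e powr s"
  shows "Lp_order M e0 0 s D"
proof (rule Lp_orderI[of "\<bar>C\<bar>" _ "\<lambda>_ _. 0"])
  fix e assume "0 < e" "e < e0"
  from assms[OF this] show "AE z in M. \<bar>D e z\<bar> \<le> \<bar>C\<bar> * e powr s * (1 + 0) powr 0"
  proof eventually_elim
    case (elim z)
    also have "C * e powr s \<le> \<bar>C\<bar> * e powr s" by (intro mult_right_mono) auto
    finally show ?case by simp
  qed
qed auto

text \<open>
Hoelder's inequality: both weights are below their sum, whose powers multiply.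
\<close>

lemma Lp_order_mult:
  assumes D: "Lp_order M e0 \<theta> s D" and E: "Lp_order M e0 \<kappa> t E" and "0 \<le> \<theta>" "0 \<le> \<kappa>"
  shows "Lp_order M e0 (\<theta> + \<kappa>) (s + t) (\<lambda>e z. D e z * E e z)"
proof -
  from D obtain K \<Phi> where K: "0 \<le> K"
    and 1: "\<And>e. 0 < e \<Longrightarrow> e < e0 \<Longrightarrow> \<Phi> e \<in> borel_measurable M"
    and 2: "\<And>e z. 0 < e \<Longrightarrow> e < e0 \<Longrightarrow> 0 \<le> \<Phi> e z"
    and 3: "\<And>e. 0 < e \<Longrightarrow> e < e0 \<Longrightarrow> (\<integral>\<^sup>+z. ennreal (\<Phi> e z) \<partial>M) \<le> ennreal K"
    and 4: "\<And>e. 0 < e \<Longrightarrow> e < e0 \<Longrightarrow> AE z in M. \<bar>D e z\<bar> \<le> K * e powr s * (1 + \<Phi> e z) powr \<theta>"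
    by (rule Lp_orderE) blast
  from E obtain L \<Psi> where L: "0 \<le> L"
    and b1: "\<And>e. 0 < e \<Longrightarrow> e < e0 \<Longrightarrow> \<Psi> e \<in> borel_measurable M"
    and b2: "\<And>e z. 0 < e \<Longrightarrow> e < e0 \<Longrightarrow> 0 \<le> \<Psi> e z"
    and b3: "\<And>e. 0 < e \<Longrightarrow> e < e0 \<Longrightarrow> (\<integral>\<^sup>+z. ennreal (\<Psi> e z) \<partial>M) \<le> ennreal L"
    and b4: "\<And>e. 0 < e \<Longrightarrow> e < e0 \<Longrightarrow> AE z in M. \<bar>E e z\<bar> \<le> L * e powr t * (1 + \<Psi> e z) powr \<kappa>"
    by (rule Lp_orderE) blast
  show ?thesis
  proof (rule Lp_orderI[of "K + L + K * L" _ "\<lambda>e z. \<Phi> e z + \<Psi> e z"])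
    fix e assume e: "0 < e" "e < e0"
    have "(\<integral>\<^sup>+z. ennreal (\<Phi> e z + \<Psi> e z) \<partial>M) = (\<integral>\<^sup>+z. ennreal (\<Phi> e z) \<partial>M) + (\<integral>\<^sup>+z. ennreal (\<Psi> e z) \<partial>M)"
      using 1[OF e] b1[OF e] 2[OF e] b2[OF e] by (subst nn_integral_add[symmetric]) auto
    also have "\<dots> \<le> ennreal K + ennreal L" using 3[OF e] b3[OF e] by (rule add_mono)
    also have "\<dots> \<le> ennreal (K + L + K * L)"
      using K L by (simp add: ennreal_plus[symmetric] del: ennreal_plus)
    finally show "(\<integral>\<^sup>+z. ennreal (\<Phi> e z + \<Psi> e z) \<partial>M) \<le> ennreal (K + L + K * L)" .
    show "AE z in M. \<bar>D e z * E e z\<bar> \<le> (K + L + K * L) * e powr (s + t) * (1 + (\<Phi> e z + \<Psi> e z)) powr (\<theta> + \<kappa>)"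
      using 4[OF e] b4[OF e]
    proof eventually_elim
      case (elim z)
      note nn = 2[OF e, of z] b2[OF e, of z]
      have "\<bar>D e z * E e z\<bar> \<le> (K * e powr s * (1 + \<Phi> e z) powr \<theta>) * (L * e powr t * (1 + \<Psi> e z) powr \<kappa>)"
        unfolding abs_mult using elim K L by (intro mult_mono) auto
      also have "\<dots> = (K * L) * e powr (s + t) * ((1 + \<Phi> e z) powr \<theta> * (1 + \<Psi> e z) powr \<kappa>)"
        by (simp add: powr_add)
      also have "\<dots> \<le> (K + L + K * L) * e powr (s + t) *
          ((1 + (\<Phi> e z + \<Psi> e z)) powr \<theta> * (1 + (\<Phi> e z + \<Psi> e z)) powr \<kappa>)"
        using K L nn e \<open>0 \<le> \<theta>\<close> \<open>0 \<le> \<kappa>\<close>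
        by (intro mult_mono[of "K * L * e powr (s + t)"] mult_right_mono mult_mono[of "(1 + \<Phi> e z) powr \<theta>"] powr_mono2) auto
      finally show ?case by (simp add: powr_add)
    qed
  qed (use K L 1 2 b1 b2 in auto)
qed

lemma Lp_order_add:
  assumes D: "Lp_order M e0 \<theta> s D" and E: "Lp_order M e0 \<theta> s E" and "0 \<le> \<theta>"
  shows "Lp_order M e0 \<theta> s (\<lambda>e z. D e z + E e z)"
proof -
  from D obtain K \<Phi> where K: "0 \<le> K"
    and 1: "\<And>e. 0 < e \<Longrightarrow> e < e0 \<Longrightarrow> \<Phi> e \<in> borel_measurable M"
    and 2: "\<And>e z. 0 < e \<Longrightarrow> e < e0 \<Longrightarrow> 0 \<le> \<Phi> e z"
    and 3: "\<And>e. 0 < e \<Longrightarrow> e < e0 \<Longrightarrow> (\<integral>\<^sup>+z. ennreal (\<Phi> e z) \<partial>M) \<le> ennreal K"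
    and 4: "\<And>e. 0 < e \<Longrightarrow> e < e0 \<Longrightarrow> AE z in M. \<bar>D e z\<bar> \<le> K * e powr s * (1 + \<Phi> e z) powr \<theta>"
    by (rule Lp_orderE) blast
  from E obtain L \<Psi> where L: "0 \<le> L"
    and b1: "\<And>e. 0 < e \<Longrightarrow> e < e0 \<Longrightarrow> \<Psi> e \<in> borel_measurable M"
    and b2: "\<And>e z. 0 < e \<Longrightarrow> e < e0 \<Longrightarrow> 0 \<le> \<Psi> e z"
    and b3: "\<And>e. 0 < e \<Longrightarrow> e < e0 \<Longrightarrow> (\<integral>\<^sup>+z. ennreal (\<Psi> e z) \<partial>M) \<le> ennreal L"
    and b4: "\<And>e. 0 < e \<Longrightarrow> e < e0 \<Longrightarrow> AE z in M. \<bar>E e z\<bar> \<le> L * e powr s * (1 + \<Psi> e z) powr \<theta>"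
    by (rule Lp_orderE) blast
  show ?thesis
  proof (rule Lp_orderI[of "K + L" _ "\<lambda>e z. \<Phi> e z + \<Psi> e z"])
    fix e assume e: "0 < e" "e < e0"
    have "(\<integral>\<^sup>+z. ennreal (\<Phi> e z + \<Psi> e z) \<partial>M) = (\<integral>\<^sup>+z. ennreal (\<Phi> e z) \<partial>M) + (\<integral>\<^sup>+z. ennreal (\<Psi> e z) \<partial>M)"
      using 1[OF e] b1[OF e] 2[OF e] b2[OF e] by (subst nn_integral_add[symmetric]) auto
    also have "\<dots> \<le> ennreal K + ennreal L" using 3[OF e] b3[OF e] by (rule add_mono)
    also have "\<dots> = ennreal (K + L)" using K L by simp
    finally show "(\<integral>\<^sup>+z. ennreal (\<Phi> e z + \<Psi> e z) \<partial>M) \<le> ennreal (K + L)" .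
    show "AE z in M. \<bar>D e z + E e z\<bar> \<le> (K + L) * e powr s * (1 + (\<Phi> e z + \<Psi> e z)) powr \<theta>"
      using 4[OF e] b4[OF e]
    proof eventually_elim
      case (elim z)
      note nn = 2[OF e, of z] b2[OF e, of z]
      have "K * e powr s * (1 + \<Phi> e z) powr \<theta> \<le> K * e powr s * (1 + (\<Phi> e z + \<Psi> e z)) powr \<theta>"
        using K nn \<open>0 \<le> \<theta>\<close> by (intro mult_left_mono powr_mono2) auto
      moreover have "L * e powr s * (1 + \<Psi> e z) powr \<theta> \<le> L * e powr s * (1 + (\<Phi> e z + \<Psi> e z)) powr \<theta>"
        using L nn \<open>0 \<le> \<theta>\<close> by (intro mult_left_mono powr_mono2) auto
      ultimately show ?case using elim by (simp add: distrib_right)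
    qed
  qed (use K L 1 2 b1 b2 in auto)
qed

lemma Lp_order_cong:
  assumes "Lp_order M e0 \<theta> s D" "e0 \<le> 1"
    and "\<And>e. 0 < e \<Longrightarrow> e < e0 \<Longrightarrow> AE z in M. D' e z = D e z"
  shows "Lp_order M e0 \<theta> s D'"
proof (rule Lp_order_mono[OF assms(1), of 1])
  fix e assume "0 < e" "e < e0"
  from assms(3)[OF this] show "AE z in M. \<bar>D' e z\<bar> \<le> 1 * \<bar>D e z\<bar>" by eventually_elim simp
qed (use assms in auto)

lemma Lp_order_zero: "Lp_order M e0 \<theta> s (\<lambda>e z. 0)"
  by (rule Lp_orderI[of 0 _ "\<lambda>_ _. 0"]) auto

lemma Lp_order_cmult: "Lp_order M e0 \<theta> s D \<Longrightarrow> e0 \<le> 1 \<Longrightarrow> Lp_order M e0 \<theta> s (\<lambda>e z. c * D e z)"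
  by (rule Lp_order_mono[of M e0 \<theta> s D "\<bar>c\<bar>"]) (auto simp: abs_mult)

lemma Lp_order_diff:
  assumes "Lp_order M e0 \<theta> s D" "Lp_order M e0 \<theta> s E" "0 \<le> \<theta>" "e0 \<le> 1"
  shows "Lp_order M e0 \<theta> s (\<lambda>e z. D e z - E e z)"
  using Lp_order_add[OF assms(1) Lp_order_cmult[OF assms(2,4), of "-1"] assms(3)] by simp

lemma Lp_order_sum:
  assumes "finite I" "\<And>i. i \<in> I \<Longrightarrow> Lp_order M e0 \<theta> s (D i)" "0 \<le> \<theta>" "e0 \<le> 1"
  shows "Lp_order M e0 \<theta> s (\<lambda>e z. \<Sum>i\<in>I. D i e z)"
  using assms(1,2) by (induction rule: finite_induct) (auto intro!: Lp_order_add Lp_order_zero assms(3,4))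

lemma Lp_order_powr:
  assumes D: "Lp_order M e0 \<theta> s D" and "0 \<le> g"
  shows "Lp_order M e0 (g * \<theta>) (g * s) (\<lambda>e z. \<bar>D e z\<bar> powr g)"
proof -
  from D obtain K \<Phi> where K: "0 \<le> K"
    and 1: "\<And>e. 0 < e \<Longrightarrow> e < e0 \<Longrightarrow> \<Phi> e \<in> borel_measurable M"
    and 2: "\<And>e z. 0 < e \<Longrightarrow> e < e0 \<Longrightarrow> 0 \<le> \<Phi> e z"
    and 3: "\<And>e. 0 < e \<Longrightarrow> e < e0 \<Longrightarrow> (\<integral>\<^sup>+z. ennreal (\<Phi> e z) \<partial>M) \<le> ennreal K"
    and 4: "\<And>e. 0 < e \<Longrightarrow> e < e0 \<Longrightarrow> AE z in M. \<bar>D e z\<bar> \<le> K * e powr s * (1 + \<Phi> e z) powr \<theta>"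
    by (rule Lp_orderE) blast
  show ?thesis
  proof (rule Lp_orderI[of "K + K powr g" _ \<Phi>])
    fix e assume e: "0 < e" "e < e0"
    show "(\<integral>\<^sup>+z. ennreal (\<Phi> e z) \<partial>M) \<le> ennreal (K + K powr g)"
      using 3[OF e] K by (rule_tac order_trans[OF 3[OF e]]) (intro ennreal_leI, simp)
    show "AE z in M. \<bar>\<bar>D e z\<bar> powr g\<bar> \<le> (K + K powr g) * e powr (g * s) * (1 + \<Phi> e z) powr (g * \<theta>)"
      using 4[OF e]
    proof eventually_elim
      case (elim z)
      have "\<bar>D e z\<bar> powr g \<le> (K * e powr s * (1 + \<Phi> e z) powr \<theta>) powr g"
        using elim \<open>0 \<le> g\<close> by (intro powr_mono2) auto
      also have "\<dots> = K powr g * e powr (g * s) * (1 + \<Phi> e z) powr (g * \<theta>)"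
        using K e 2[OF e, of z] by (simp add: powr_mult powr_powr mult.commute)
      also have "\<dots> \<le> (K + K powr g) * e powr (g * s) * (1 + \<Phi> e z) powr (g * \<theta>)"
        using K by (intro mult_right_mono) auto
      finally show ?case by simp
    qed
  qed (use K 1 2 in auto)
qed

lemma powr_le_one_plus:
  assumes "0 \<le> \<theta>" "\<theta> \<le> 1" "0 \<le> (x::real)"
  shows "x powr \<theta> \<le> 1 + x"
proof (cases "x \<le> 1")
  case True
  then have "x powr \<theta> \<le> 1 powr \<theta>" using assms by (intro powr_mono2) auto
  then show ?thesis using assms by simp
next
  case False
  then have "x powr \<theta> \<le> x powr 1" using assms by (intro powr_mono) auto
  then show ?thesis using assms by simp
qed

text \<open>
For \<open>\<theta> \<le> 1\<close> the bound is at most linear in the weight.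
\<close>

lemma Lp_order_integral:
  assumes D: "Lp_order M e0 \<theta> s D" and M: "finite_measure M" and "0 \<le> \<theta>" "\<theta> \<le> 1"
  shows "\<exists>C\<ge>0. \<forall>e. 0 < e \<and> e < e0 \<longrightarrow> (\<integral>\<^sup>+z. ennreal \<bar>D e z\<bar> \<partial>M) \<le> ennreal (C * e powr s)"
proof -
  interpret finite_measure M by fact
  from D obtain K \<Phi> where K: "0 \<le> K"
    and 1: "\<And>e. 0 < e \<Longrightarrow> e < e0 \<Longrightarrow> \<Phi> e \<in> borel_measurable M"
    and 2: "\<And>e z. 0 < e \<Longrightarrow> e < e0 \<Longrightarrow> 0 \<le> \<Phi> e z"
    and 3: "\<And>e. 0 < e \<Longrightarrow> e < e0 \<Longrightarrow> (\<integral>\<^sup>+z. ennreal (\<Phi> e z) \<partial>M) \<le> ennreal K"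
    and 4: "\<And>e. 0 < e \<Longrightarrow> e < e0 \<Longrightarrow> AE z in M. \<bar>D e z\<bar> \<le> K * e powr s * (1 + \<Phi> e z) powr \<theta>"
    by (rule Lp_orderE) blast
  let ?m = "measure M (space M)"
  show ?thesis
  proof (intro exI[of _ "K * (2 * ?m + K)"] conjI allI impI)
    fix e assume "0 < e \<and> e < e0"
    then have e: "0 < e" "e < e0" by auto
    have "(\<integral>\<^sup>+z. ennreal \<bar>D e z\<bar> \<partial>M) \<le> (\<integral>\<^sup>+z. ennreal (K * e powr s) * (2 + ennreal (\<Phi> e z)) \<partial>M)"
    proof (rule nn_integral_mono_AE)
      show "AE z in M. ennreal \<bar>D e z\<bar> \<le> ennreal (K * e powr s) * (2 + ennreal (\<Phi> e z))"
        using 4[OF e]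
      proof eventually_elim
        case (elim z)
        note elim
        also have "K * e powr s * (1 + \<Phi> e z) powr \<theta> \<le> K * e powr s * (1 + (1 + \<Phi> e z))"
          using K 2[OF e, of z] assms by (intro mult_left_mono powr_le_one_plus) auto
        finally have "ennreal \<bar>D e z\<bar> \<le> ennreal (K * e powr s * (1 + (1 + \<Phi> e z)))" by (rule ennreal_leI)
        also have "\<dots> = ennreal (K * e powr s) * (2 + ennreal (\<Phi> e z))"
          using K 2[OF e, of z] by (subst ennreal_mult) auto
        finally show ?case .
      qed
    qed
    also have "\<dots> = ennreal (K * e powr s) * (2 * emeasure M (space M) + (\<integral>\<^sup>+z. ennreal (\<Phi> e z) \<partial>M))"
      using 1[OF e] by (subst nn_integral_cmult) (auto simp: nn_integral_add)
    also have "\<dots> \<le> ennreal (K * e powr s) * (2 * ennreal ?m + ennreal K)"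
      using 3[OF e] by (intro mult_left_mono add_mono) (auto simp: emeasure_eq_measure)
    also have "\<dots> = ennreal (K * (2 * ?m + K) * e powr s)"
      using K by (simp add: ennreal_mult[symmetric] ennreal_plus[symmetric] mult_ac
          ennreal_numeral[symmetric] del: ennreal_plus ennreal_numeral)
    finally show "(\<integral>\<^sup>+z. ennreal \<bar>D e z\<bar> \<partial>M) \<le> ennreal (K * (2 * ?m + K) * e powr s)" .
  qed (use K in auto)
qed

lemma Lp_order_pull:
  assumes D: "Lp_order M e0 \<theta> s D" and M: "sigma_finite_measure M" and N: "finite_measure N"
  shows "Lp_order (M \<Otimes>\<^sub>M N) e0 \<theta> s (\<lambda>e (z, y). D e z)"
proof -
  interpret M: sigma_finite_measure M by fact
  interpret N: finite_measure N by fact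
  interpret P: pair_sigma_finite M N ..
  from D obtain K \<Phi> where K: "0 \<le> K"
    and 1: "\<And>e. 0 < e \<Longrightarrow> e < e0 \<Longrightarrow> \<Phi> e \<in> borel_measurable M"
    and 2: "\<And>e z. 0 < e \<Longrightarrow> e < e0 \<Longrightarrow> 0 \<le> \<Phi> e z"
    and 3: "\<And>e. 0 < e \<Longrightarrow> e < e0 \<Longrightarrow> (\<integral>\<^sup>+z. ennreal (\<Phi> e z) \<partial>M) \<le> ennreal K"
    and 4: "\<And>e. 0 < e \<Longrightarrow> e < e0 \<Longrightarrow> AE z in M. \<bar>D e z\<bar> \<le> K * e powr s * (1 + \<Phi> e z) powr \<theta>"
    by (rule Lp_orderE) blast
  let ?n = "measure N (space N)"
  show ?thesis
  proof (rule Lp_orderI[of "K + K * ?n" _ "\<lambda>e p. \<Phi> e (fst p)"])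
    fix e assume e: "0 < e" "e < e0"
    have [measurable]: "\<Phi> e \<in> borel_measurable M" by (rule 1[OF e])
    show "(\<lambda>p. \<Phi> e (fst p)) \<in> borel_measurable (M \<Otimes>\<^sub>M N)" by measurable
    have "(\<integral>\<^sup>+p. ennreal (\<Phi> e (fst p)) \<partial>(M \<Otimes>\<^sub>M N)) = (\<integral>\<^sup>+z. \<integral>\<^sup>+y. ennreal (\<Phi> e z) \<partial>N \<partial>M)"
      by (subst N.nn_integral_fst[symmetric]) auto
    also have "\<dots> = (\<integral>\<^sup>+z. ennreal (\<Phi> e z) \<partial>M) * ennreal ?n"
      by (simp add: nn_integral_multc N.emeasure_eq_measure)
    also have "\<dots> \<le> ennreal K * ennreal ?n" using 3[OF e] by (intro mult_right_mono) auto
    also have "\<dots> \<le> ennreal (K + K * ?n)" using K by (subst ennreal_mult[symmetric]) (auto intro!: ennreal_leI)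
    finally show "(\<integral>\<^sup>+p. ennreal (\<Phi> e (fst p)) \<partial>(M \<Otimes>\<^sub>M N)) \<le> ennreal (K + K * ?n)" .
    from 4[OF e] obtain A where A: "{z \<in> space M. \<not> \<bar>D e z\<bar> \<le> K * e powr s * (1 + \<Phi> e z) powr \<theta>} \<subseteq> A"
      "emeasure M A = 0" "A \<in> sets M" by (rule AE_E)
    show "AE p in M \<Otimes>\<^sub>M N. \<bar>case p of (z, y) \<Rightarrow> D e z\<bar> \<le> (K + K * ?n) * e powr s * (1 + \<Phi> e (fst p)) powr \<theta>"
    proof (rule AE_I[of _ _ "A \<times> space N"])
      show "{p \<in> space (M \<Otimes>\<^sub>M N). \<not> \<bar>case p of (z, y) \<Rightarrow> D e z\<bar> \<le> (K + K * ?n) * e powr s * (1 + \<Phi> e (fst p)) powr \<theta>}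
          \<subseteq> A \<times> space N"
      proof
        fix p assume p: "p \<in> {p \<in> space (M \<Otimes>\<^sub>M N). \<not> \<bar>case p of (z, y) \<Rightarrow> D e z\<bar> \<le> (K + K * ?n) * e powr s * (1 + \<Phi> e (fst p)) powr \<theta>}"
        obtain z y where zy: "p = (z, y)" by fastforce
        have "K * e powr s * (1 + \<Phi> e z) powr \<theta> \<le> (K + K * ?n) * e powr s * (1 + \<Phi> e z) powr \<theta>"
          using K by (intro mult_right_mono) auto
        then show "p \<in> A \<times> space N" using p A(1) unfolding zy by (auto simp: space_pair_measure)
      qed
      show "emeasure (M \<Otimes>\<^sub>M N) (A \<times> space N) = 0"
        using A by (subst N.emeasure_pair_measure_Times) auto
    qed (use A in auto)
  qed (use K 2 in auto)
qed

text \<open>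
This takes the place of Minkowski's integral inequality. With \<open>A\<close> one plus the integral of \<open>\<Phi>\<close>
over \<open>y\<close>, the estimate \<open>x\<^sup>\<theta> \<le> 1 + x\<close> at \<open>x = (1 + \<Phi>) / A\<close> bounds \<open>(1 + \<Phi>)\<^sup>\<theta>\<close> by \<open>A\<^sup>\<theta>\<close> times a
function of \<open>y\<close> whose integral is bounded, so \<open>A - 1\<close> serves as the new weight.
\<close>

lemma Lp_order_average:
  assumes D: "Lp_order (M \<Otimes>\<^sub>M N) e0 \<theta> s D" and M: "sigma_finite_measure M" and N: "finite_measure N"
    and \<theta>: "0 \<le> \<theta>" "\<theta> \<le> 1" and k: "\<And>y. \<bar>k y\<bar> \<le> B"
  shows "Lp_order M e0 \<theta> s (\<lambda>e z. \<integral>y. k y * D e (z, y) \<partial>N)"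
proof -
  interpret M: sigma_finite_measure M by fact
  interpret N: finite_measure N by fact
  interpret P: pair_sigma_finite M N ..
  from D obtain K \<Phi> where K: "0 \<le> K"
    and 1: "\<And>e. 0 < e \<Longrightarrow> e < e0 \<Longrightarrow> \<Phi> e \<in> borel_measurable (M \<Otimes>\<^sub>M N)"
    and 2: "\<And>e z. 0 < e \<Longrightarrow> e < e0 \<Longrightarrow> 0 \<le> \<Phi> e z"
    and 3: "\<And>e. 0 < e \<Longrightarrow> e < e0 \<Longrightarrow> (\<integral>\<^sup>+z. ennreal (\<Phi> e z) \<partial>(M \<Otimes>\<^sub>M N)) \<le> ennreal K"
    and 4: "\<And>e. 0 < e \<Longrightarrow> e < e0 \<Longrightarrow> AE z in (M \<Otimes>\<^sub>M N). \<bar>D e z\<bar> \<le> K * e powr s * (1 + \<Phi> e z) powr \<theta>"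
    by (rule Lp_orderE) blast
  have B: "0 \<le> B" using k[of undefined] by linarith
  define n where "n = measure N (space N)"
  have n: "0 \<le> n" by (simp add: n_def)
  define I where "I e z = (\<integral>\<^sup>+y. ennreal (\<Phi> e (z, y)) \<partial>N)" for e z
  show ?thesis
  proof (rule Lp_orderI[of "K + B * K * (2 * n + 1)" _ "\<lambda>e z. enn2real (I e z)"])
    fix e assume e: "0 < e" "e < e0"
    have m[measurable]: "\<Phi> e \<in> borel_measurable (M \<Otimes>\<^sub>M N)" by (rule 1[OF e])
    show "(\<lambda>z. enn2real (I e z)) \<in> borel_measurable M" unfolding I_def by measurable
    have mI[measurable]: "I e \<in> borel_measurable M" unfolding I_def by measurable
    have I3: "(\<integral>\<^sup>+z. I e z \<partial>M) \<le> ennreal K"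
      using 3[OF e] unfolding I_def by (subst N.nn_integral_fst) auto
    then have fin: "AE z in M. I e z \<noteq> \<infinity>"
      by (intro nn_integral_noteq_infinite) (auto simp: top_unique)
    have "(\<integral>\<^sup>+z. ennreal (enn2real (I e z)) \<partial>M) = (\<integral>\<^sup>+z. I e z \<partial>M)"
      using fin by (intro nn_integral_cong_AE) (auto simp: ennreal_enn2real_if elim: eventually_mono)
    also have "\<dots> \<le> ennreal (K + B * K * (2 * n + 1))"
      using I3 K B n by (rule_tac order_trans[OF I3]) (intro ennreal_leI, simp)
    finally show "(\<integral>\<^sup>+z. ennreal (enn2real (I e z)) \<partial>M) \<le> ennreal (K + B * K * (2 * n + 1))" .
    show "AE z in M. \<bar>\<integral>y. k y * D e (z, y) \<partial>N\<bar> \<le> (K + B * K * (2 * n + 1)) * e powr s * (1 + enn2real (I e z)) powr \<theta>"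
      using fin P.AE_pair[OF 4[OF e]] AE_space
    proof eventually_elim
      case (elim z)
      define A where "A = 1 + enn2real (I e z)"
      have A: "1 \<le> A" by (simp add: A_def)
      have mz[measurable]: "(\<lambda>y. \<Phi> e (z, y)) \<in> borel_measurable N"
        using m elim(3) by measurable
      have int: "integrable N (\<lambda>y. \<Phi> e (z, y))"
        using elim(1) 2[OF e] unfolding I_def by (intro integrableI_nonneg) (auto simp: top.not_eq_extremum)
      have Iint: "(\<integral>y. \<Phi> e (z, y) \<partial>N) = A - 1"
        unfolding A_def I_def using 2[OF e] by (subst integral_eq_nn_integral) auto
      show ?case
      proof (cases "integrable N (\<lambda>y. k y * D e (z, y))")
        case True
        have "\<bar>\<integral>y. k y * D e (z, y) \<partial>N\<bar> \<le> (\<integral>y. \<bar>k y * D e (z, y)\<bar> \<partial>N)"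
          by (rule integral_abs_bound)
        also have "\<dots> \<le> (\<integral>y. B * (K * e powr s * (A powr \<theta> * (1 + (1 + \<Phi> e (z, y)) / A))) \<partial>N)"
        proof (rule integral_mono_AE)
          show "AE y in N. \<bar>k y * D e (z, y)\<bar> \<le> B * (K * e powr s * (A powr \<theta> * (1 + (1 + \<Phi> e (z, y)) / A)))"
            using elim(2)
          proof eventually_elim
            case (elim y)
            have nn: "0 \<le> \<Phi> e (z, y)" by (rule 2[OF e])
            have "(1 + \<Phi> e (z, y)) powr \<theta> = (A * ((1 + \<Phi> e (z, y)) / A)) powr \<theta>" using A by simp
            also have "\<dots> = A powr \<theta> * ((1 + \<Phi> e (z, y)) / A) powr \<theta>"
              by (simp only: powr_mult)
            also have "\<dots> \<le> A powr \<theta> * (1 + (1 + \<Phi> e (z, y)) / A)"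
              using A nn \<theta> by (intro mult_left_mono powr_le_one_plus) auto
            finally have *: "(1 + \<Phi> e (z, y)) powr \<theta> \<le> \<dots>" .
            have "\<bar>k y * D e (z, y)\<bar> \<le> B * (K * e powr s * (1 + \<Phi> e (z, y)) powr \<theta>)"
              unfolding abs_mult using k[of y] elim by (intro mult_mono) auto
            also have "\<dots> \<le> B * (K * e powr s * (A powr \<theta> * (1 + (1 + \<Phi> e (z, y)) / A)))"
              using B K * by (intro mult_left_mono) auto
            finally show ?case .
          qed
        qed (use True int in auto)
        also have "\<dots> = B * (K * e powr s * (A powr \<theta> * (n + (n + (A - 1)) / A)))"
          using int by (simp add: Iint n_def)
        also have "\<dots> \<le> B * (K * e powr s * (A powr \<theta> * (2 * n + 1)))"
        proof -
          have "n * 1 \<le> n * A" using A n by (intro mult_left_mono) auto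
          then have "(n + (A - 1)) / A \<le> n + 1" using A by (simp add: divide_le_eq distrib_right)
          then show ?thesis using B K by (intro mult_left_mono) auto
        qed
        also have "\<dots> = (B * K * (2 * n + 1)) * e powr s * A powr \<theta>" by simp
        also have "\<dots> \<le> (K + B * K * (2 * n + 1)) * e powr s * A powr \<theta>"
          using K by (intro mult_right_mono) auto
        finally show ?thesis unfolding A_def .
      next
        case False
        then show ?thesis using K B n A by (simp add: not_integrable_integral_eq)
      qed
    qed
  qed (use K B n in auto)
qed

section \<open>The pressure potential and its regularisation near vacuum\<close>

lemma derivative_bound_imp_lipschitz:
  fixes f f' :: "real \<Rightarrow> real"
  assumes "\<And>x. x \<in> {a..b} \<Longrightarrow> (f has_real_derivative f' x) (at x within {a..b})"
    and "\<And>x. x \<in> {a..b} \<Longrightarrow> \<bar>f' x\<bar> \<le> C"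
    and "s \<in> {a..b}" "t \<in> {a..b}"
  shows "\<bar>f s - f t\<bar> \<le> C * \<bar>s - t\<bar>"
  using field_differentiable_bound[of "{a..b}" f f' C s t] assms by auto

lemma continuous_antiderivative:
  fixes f :: "real \<Rightarrow> real"
  assumes "continuous_on UNIV f"
  shows "\<exists>F. (\<forall>x. (F has_real_derivative f x) (at x)) \<and> F a = c"
proof -
  have "\<exists>F. \<forall>x::real. - \<infinity> < ereal x \<longrightarrow> ereal x < \<infinity> \<longrightarrow> (F has_vector_derivative f x) (at x)"
    using assms by (intro einterval_antiderivative) (auto simp: continuous_on_eq_continuous_at)
  then obtain G where G: "\<And>x. (G has_real_derivative f x) (at x)"
    by (auto simp: has_real_derivative_iff_has_vector_derivative)
  show ?thesis
    by (rule exI[of _ "\<lambda>x. G x - G a + c"]) (auto intro!: derivative_eq_intros G)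
qed

text \<open>
The growth bound on \<open>p'\<close> is the place where \<open>p'(0) = 0\<close> enters: near vacuum it is the Hoelder
continuity of \<open>p'\<close> at \<open>0\<close>, and away from vacuum \<open>s\<close> to the power \<open>\<gamma> - 1\<close> is bounded below. The
derivative is extended to the real line by clamping the argument, so that its primitives are
defined everywhere.
\<close>

lemma pressure_derivative:
  fixes p :: "real \<Rightarrow> real"
  assumes lohi: "0 \<le> lo" "lo \<le> hi" and g: "1 < \<gamma>"
    and C1: "C1_holder (\<gamma> - 1) {lo..hi} p"
    and p0: "lo = 0 \<Longrightarrow> (p has_real_derivative 0) (at_right 0)"
  obtains p' C where "0 \<le> C" "continuous_on UNIV p'"
    "\<And>s. s \<in> {lo..hi} \<Longrightarrow> (p has_real_derivative p' s) (at s within {lo..hi})"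
    "\<And>s. s \<in> {lo..hi} \<Longrightarrow> \<bar>p' s\<bar> \<le> C * s powr (\<gamma> - 1)"
    "\<And>s t. s \<in> {lo..hi} \<Longrightarrow> t \<in> {lo..hi} \<Longrightarrow> \<bar>p s - p t - p' t * (s - t)\<bar> \<le> C * \<bar>s - t\<bar> powr \<gamma>"
proof -
  from C1 obtain q C0 where q: "\<And>s. s \<in> {lo..hi} \<Longrightarrow> (p has_real_derivative q s) (at s within {lo..hi})"
    and C0: "\<And>s t. s \<in> {lo..hi} \<Longrightarrow> t \<in> {lo..hi} \<Longrightarrow> \<bar>q s - q t\<bar> \<le> C0 * \<bar>s - t\<bar> powr (\<gamma> - 1)"
    unfolding C1_holder_def by blast
  define q' where "q' s = (if hi = 0 then 0 else q s)" for s
  define L where "L = \<bar>C0\<bar>"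
  have L: "0 \<le> L" by (simp add: L_def)
  have q': "(p has_real_derivative q' s) (at s within {lo..hi})" if "s \<in> {lo..hi}" for s
  proof (cases "hi = 0")
    case True
    then have "{lo..hi} = {s}" using that lohi by auto
    moreover have "at s within {s} = bot" by (simp add: at_within_eq_bot_iff)
    ultimately show ?thesis by (simp add: has_field_derivative_iff)
  qed (use that q[OF that] in \<open>auto simp: q'_def\<close>)
  have L': "\<bar>q' s - q' t\<bar> \<le> L * \<bar>s - t\<bar> powr (\<gamma> - 1)" if "s \<in> {lo..hi}" "t \<in> {lo..hi}" for s t
  proof (cases "hi = 0")
    case False
    have "\<bar>q s - q t\<bar> \<le> C0 * \<bar>s - t\<bar> powr (\<gamma> - 1)" by (rule C0[OF that])
    also have "\<dots> \<le> L * \<bar>s - t\<bar> powr (\<gamma> - 1)" unfolding L_def by (intro mult_right_mono) auto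
    finally show ?thesis using False by (simp add: q'_def)
  qed (auto simp: q'_def L)
  have q0: "q' 0 = 0" if "lo = 0"
  proof (cases "hi = 0")
    case False
    then have "at 0 within {lo..hi} = at_right 0" using lohi that by (simp add: at_within_Icc_at_right)
    then have "(p has_real_derivative q' 0) (at_right 0)" using q'[of 0] lohi that by simp
    with p0[OF that] have "((\<lambda>y. (p y - p 0) / (y - 0)) \<longlongrightarrow> q' 0) (at_right 0)"
      "((\<lambda>y. (p y - p 0) / (y - 0)) \<longlongrightarrow> 0) (at_right 0)"
      by (simp_all add: has_field_derivative_iff)
    then show ?thesis by (rule tendsto_unique[OF trivial_limit_at_right_real])
  qed (simp add: q'_def)
  define cl where "cl s = max lo (min hi s)" for s
  have cl: "cl s \<in> {lo..hi}" and cl_id: "s \<in> {lo..hi} \<Longrightarrow> cl s = s" for s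
    using lohi by (auto simp: cl_def)
  define p' where "p' s = q' (cl s)" for s
  have p'_eq: "p' s = q' s" if "s \<in> {lo..hi}" for s using cl_id[OF that] by (simp add: p'_def)
  have cont: "continuous_on UNIV p'"
    unfolding continuous_on_def
  proof
    fix t :: real
    have "((\<lambda>s. L * \<bar>s - t\<bar> powr (\<gamma> - 1)) \<longlongrightarrow> L * \<bar>t - t\<bar> powr (\<gamma> - 1)) (at t within UNIV)"
      using g by (intro tendsto_intros) auto
    then have 0: "((\<lambda>s. L * \<bar>s - t\<bar> powr (\<gamma> - 1)) \<longlongrightarrow> 0) (at t within UNIV)" using g by simp
    have "((\<lambda>s. p' s - p' t) \<longlongrightarrow> 0) (at t within UNIV)"
    proof (rule Lim_null_comparison[OF _ 0], rule always_eventually, rule allI)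
      fix s
      have "\<bar>p' s - p' t\<bar> \<le> L * \<bar>cl s - cl t\<bar> powr (\<gamma> - 1)"
        unfolding p'_def by (rule L'[OF cl cl])
      also have "\<dots> \<le> L * \<bar>s - t\<bar> powr (\<gamma> - 1)"
        using L g by (intro mult_left_mono powr_mono2) (auto simp: cl_def max_def min_def)
      finally show "norm (p' s - p' t) \<le> L * \<bar>s - t\<bar> powr (\<gamma> - 1)" by simp
    qed
    then show "(p' \<longlongrightarrow> p' t) (at t within UNIV)" by (simp add: LIM_zero_iff)
  qed
  define B where "B = \<bar>q' lo\<bar> + L * (hi - lo) powr (\<gamma> - 1)"
  have B: "0 \<le> B" using L by (simp add: B_def)
  define C where "C = L + B / lo powr (\<gamma> - 1)"
  have C: "0 \<le> C" "L \<le> C" using L B by (auto simp: C_def)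
  have bd: "\<bar>q' s\<bar> \<le> C * s powr (\<gamma> - 1)" if s: "s \<in> {lo..hi}" for s
  proof (cases "lo = 0")
    case True
    have "\<bar>q' s - q' 0\<bar> \<le> L * \<bar>s - 0\<bar> powr (\<gamma> - 1)" using s True by (intro L') auto
    also have "\<dots> \<le> C * s powr (\<gamma> - 1)" using s lohi C by (auto intro!: mult_right_mono)
    finally show ?thesis using q0[OF True] by simp
  next
    case False
    then have lo: "0 < lo" using lohi by simp
    have "\<bar>q' s\<bar> \<le> \<bar>q' lo\<bar> + \<bar>q' s - q' lo\<bar>" by simp
    also have "\<bar>q' s - q' lo\<bar> \<le> L * \<bar>s - lo\<bar> powr (\<gamma> - 1)" using s by (intro L') auto
    also have "\<dots> \<le> L * (hi - lo) powr (\<gamma> - 1)" using s L g by (intro mult_left_mono powr_mono2) auto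
    finally have "\<bar>q' s\<bar> \<le> B" by (simp add: B_def)
    also have "B = B / lo powr (\<gamma> - 1) * lo powr (\<gamma> - 1)" using lo by simp
    also have "\<dots> \<le> C * s powr (\<gamma> - 1)"
      using L B lo s g C by (intro mult_mono powr_mono2) (auto simp: C_def)
    finally show ?thesis .
  qed
  have taylor: "\<bar>p s - p t - q' t * (s - t)\<bar> \<le> C * \<bar>s - t\<bar> powr \<gamma>"
    if st: "s \<in> {lo..hi}" "t \<in> {lo..hi}" for s t
  proof -
    let ?I = "{min s t..max s t}"
    have sub: "?I \<subseteq> {lo..hi}" using st by auto
    have "\<bar>(p s - q' t * s) - (p t - q' t * t)\<bar> \<le> (L * \<bar>s - t\<bar> powr (\<gamma> - 1)) * \<bar>s - t\<bar>"
    proof (rule derivative_bound_imp_lipschitz[of "min s t" "max s t" _ "\<lambda>x. q' x - q' t"])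
      fix x assume x: "x \<in> ?I"
      then have xl: "x \<in> {lo..hi}" using sub by auto
      show "((\<lambda>x. p x - q' t * x) has_real_derivative q' x - q' t) (at x within ?I)"
        by (auto intro!: derivative_eq_intros DERIV_subset[OF q'[OF xl] sub])
      have "\<bar>q' x - q' t\<bar> \<le> L * \<bar>x - t\<bar> powr (\<gamma> - 1)" by (rule L'[OF xl st(2)])
      also have "\<dots> \<le> L * \<bar>s - t\<bar> powr (\<gamma> - 1)"
        using L g x by (intro mult_left_mono powr_mono2) auto
      finally show "\<bar>q' x - q' t\<bar> \<le> L * \<bar>s - t\<bar> powr (\<gamma> - 1)" .
    qed auto
    also have "\<dots> = L * \<bar>s - t\<bar> powr \<gamma>"
      by (cases "s = t") (auto simp: powr_diff)
    also have "\<dots> \<le> C * \<bar>s - t\<bar> powr \<gamma>" using C by (intro mult_right_mono) auto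
    finally show ?thesis by (simp add: algebra_simps)
  qed
  show thesis
    by (rule that[of C p']) (use C cont q' bd taylor p'_eq in auto)
qed

text \<open>
The base point \<open>1\<close> of the potential may lie on either side of \<open>[s, t]\<close> or inside; additivity of the
interval integral needs integrability over the hull of the three points.
\<close>

lemma potential_integrable_between:
  assumes pd: "potential_defined lo hi p" and s: "0 < s" "min 1 lo \<le> s" "s \<le> t" "t \<le> max 1 hi"
  shows "interval_lebesgue_integrable lborel (ereal 1) (ereal s) (\<lambda>y. p y / y\<^sup>2)"
    "(LBINT y=ereal 1..ereal t. p y / y\<^sup>2) - (LBINT y=ereal 1..ereal s. p y / y\<^sup>2) = (LBINT y=ereal s..ereal t. p y / y\<^sup>2)"
    "interval_lebesgue_integrable lborel (ereal s) (ereal t) (\<lambda>y. p y / y\<^sup>2)"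
proof -
  let ?f = "\<lambda>y. p y / y\<^sup>2"
  have i: "interval_lebesgue_integrable lborel (ereal 1) (ereal x) ?f" if "s \<le> x" "x \<le> t" for x
    using pd that s unfolding potential_defined_def by auto
  show i1: "interval_lebesgue_integrable lborel (ereal 1) (ereal s) ?f" using i[of s] s by auto
  have it: "interval_lebesgue_integrable lborel (ereal 1) (ereal t) ?f" using i[of t] s by auto
  have hull: "interval_lebesgue_integrable lborel (min (ereal 1) (min (ereal s) (ereal t))) (max (ereal 1) (max (ereal s) (ereal t))) ?f"
  proof -
    consider "1 \<le> s" | "t \<le> 1" | "s < 1" "1 < t" by linarith
    then show ?thesis
    proof cases
      case 1 then show ?thesis using it s by (simp add: min_def max_def one_ereal_def[symmetric])
    next
      case 2
      then have eq: "min (ereal 1) (min (ereal s) (ereal t)) = ereal s" "max (ereal 1) (max (ereal s) (ereal t)) = ereal 1"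
        using s by (auto simp: min_def max_def)
      show ?thesis unfolding eq using i1 interval_integrable_endpoints_reverse by blast
    next
      case 3
      then have eq: "min (ereal 1) (min (ereal s) (ereal t)) = ereal s" "max (ereal 1) (max (ereal s) (ereal t)) = ereal t"
        by (auto simp: min_def max_def)
      have a: "set_integrable lborel {s<..<1} ?f"
        using i1 3 by (auto simp: interval_lebesgue_integrable_def einterval_eq)
      have b: "set_integrable lborel {1<..<t} ?f"
        using it 3 by (auto simp: interval_lebesgue_integrable_def einterval_eq)
      have c: "set_integrable lborel {1} ?f"
      proof -
        have eq: "(\<lambda>x. indicator {1} x *\<^sub>R ?f x) = (\<lambda>x. indicator {1} x *\<^sub>R p 1)"
          by (auto simp: indicator_def)
        show ?thesis unfolding set_integrable_def eq by simp
      qed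
      have "set_integrable lborel (({s<..<1} \<union> {1}) \<union> {1<..<t}) ?f"
        by (intro set_integrable_Un a b c) auto
      also have "({s<..<1} \<union> {1}) \<union> {1<..<t} = {s<..<t}" using 3 by auto
      finally show ?thesis unfolding eq using 3 by (auto simp: interval_lebesgue_integrable_def einterval_eq)
    qed
  qed
  show "(LBINT y=ereal 1..ereal t. ?f y) - (LBINT y=ereal 1..ereal s. ?f y) = (LBINT y=ereal s..ereal t. ?f y)"
    using interval_integral_sum[OF hull] by (simp add: algebra_simps)
  have "einterval (ereal s) (ereal t) \<subseteq> einterval (min (ereal 1) (min (ereal s) (ereal t))) (max (ereal 1) (max (ereal s) (ereal t)))"
    by (auto simp: einterval_def min_def max_def)
  then show "interval_lebesgue_integrable lborel (ereal s) (ereal t) ?f"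
    using hull s unfolding interval_lebesgue_integrable_def
    by (auto simp: min_le_iff_disj le_max_iff_disj intro: set_integrable_subset split: if_splits)
qed

text \<open>
For small \<open>y > 0\<close> the pressure \<open>p y\<close> differs from \<open>p 0\<close> by at most \<open>y\<close>. The constant contributes
\<open>- p 0\<close> to the limit, and the difference contributes at most \<open>\<rho>\<close> times a logarithm of \<open>\<rho>\<close>, up to \<open>O(\<rho>)\<close>.
\<close>

lemma potential_at_zero:
  assumes pd: "potential_defined 0 hi p" and p0: "(p has_real_derivative 0) (at_right 0)"
  shows "((\<lambda>\<rho>. \<rho> * (LBINT s = ereal 1..ereal \<rho>. p s / s\<^sup>2)) \<longlongrightarrow> - p 0) (at_right 0)"
    "pressure_potential p 0 = - p 0"
proof -
  let ?A = "\<lambda>\<rho>. LBINT s = ereal 1..ereal \<rho>. p s / s\<^sup>2"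
  have "((\<lambda>y. (p y - p 0) / (y - 0)) \<longlongrightarrow> 0) (at_right 0)"
    using p0 by (simp add: has_field_derivative_iff)
  then have "\<forall>\<^sub>F y in at_right 0. dist ((p y - p 0) / (y - 0)) 0 < 1" by (rule tendstoD) simp
  then obtain d0 where d0: "0 < d0" "\<And>y. 0 < y \<Longrightarrow> y < d0 \<Longrightarrow> \<bar>(p y - p 0) / y\<bar> < 1"
    by (auto simp: eventually_at_right_field dist_real_def)
  define d where "d = min (d0 / 2) 1"
  have d: "0 < d" "d \<le> 1" "d < d0" using d0 by (auto simp: d_def min_def)
  have pb: "\<bar>p y - p 0\<bar> \<le> y" if "0 < y" "y \<le> d" for y
    using d0(2)[of y] that d by (auto simp: abs_less_iff abs_le_iff field_simps)
  have FTC1: "(LBINT y=ereal r..ereal d. c / y\<^sup>2 + k / y) = (k * ln d - c / d) - (k * ln r - c / r)" if "0 < r" "r < d" for r c k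
  proof -
    have "(LBINT y=ereal r..ereal d. c / y\<^sup>2 + k / y) = (\<lambda>y. k * ln y - c / y) d - (\<lambda>y. k * ln y - c / y) r"
    proof (rule interval_integral_FTC_finite)
      show "continuous_on {min r d..max r d} (\<lambda>y. c / y\<^sup>2 + k / y)"
        using that by (intro continuous_intros) auto
      fix x assume x: "min r d \<le> x" "x \<le> max r d"
      then have "0 < x" using that by auto
      then have "((\<lambda>y. k * ln y - c / y) has_real_derivative c / x\<^sup>2 + k / x) (at x within {min r d..max r d})"
        by (auto intro!: derivative_eq_intros simp: power2_eq_square field_simps)
      then show "((\<lambda>y. k * ln y - c / y) has_vector_derivative c / x\<^sup>2 + k / x) (at x within {min r d..max r d})"
        by (simp add: has_real_derivative_iff_has_vector_derivative)
    qed
    then show ?thesis by simp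
  qed
  have ex: "interval_lebesgue_integrable lborel (ereal r) (ereal d) (\<lambda>y. c / y\<^sup>2 + k / y)" if "0 < r" "r < d" for r c k
    using that by (intro interval_integrable_continuous_on continuous_intros) auto
  have est: "\<bar>r * ?A r + p 0\<bar> \<le> r * (\<bar>?A d\<bar> + \<bar>p 0\<bar> / d + \<bar>ln d\<bar>) + (- r * ln r)" if r: "0 < r" "r < d" for r
  proof -
    have A: "?A d - ?A r = (LBINT y=ereal r..ereal d. p y / y\<^sup>2)"
      and ip: "interval_lebesgue_integrable lborel (ereal r) (ereal d) (\<lambda>y. p y / y\<^sup>2)"
      using potential_integrable_between[OF pd, of r d] r d by auto
    have le: "p 0 / y\<^sup>2 + (-1) / y \<le> p y / y\<^sup>2" "p y / y\<^sup>2 \<le> p 0 / y\<^sup>2 + 1 / y" if "r < y" "y < d" for y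
    proof -
      have "0 < y" using that r by simp
      then have "\<bar>p y - p 0\<bar> / y\<^sup>2 \<le> y / y\<^sup>2" using pb[of y] that by (intro divide_right_mono) auto
      also have "y / y\<^sup>2 = 1 / y" by (simp add: power2_eq_square)
      finally have "\<bar>p y / y\<^sup>2 - p 0 / y\<^sup>2\<bar> \<le> 1 / y" by (simp add: diff_divide_distrib[symmetric])
      then show "p 0 / y\<^sup>2 + (-1) / y \<le> p y / y\<^sup>2" "p y / y\<^sup>2 \<le> p 0 / y\<^sup>2 + 1 / y"
        unfolding abs_le_iff by simp_all
    qed
    have "(LBINT y=ereal r..ereal d. p 0 / y\<^sup>2 + (-1) / y) \<le> (LBINT y=ereal r..ereal d. p y / y\<^sup>2)"
      using ex[OF r, of "p 0" "-1"] ip r le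
      unfolding interval_lebesgue_integral_def interval_lebesgue_integrable_def
      by (auto simp: einterval_eq intro!: set_integral_mono)
    moreover have "(LBINT y=ereal r..ereal d. p y / y\<^sup>2) \<le> (LBINT y=ereal r..ereal d. p 0 / y\<^sup>2 + 1 / y)"
      using ex[OF r, of "p 0" 1] ip r le
      unfolding interval_lebesgue_integral_def interval_lebesgue_integrable_def
      by (auto simp: einterval_eq intro!: set_integral_mono)
    ultimately have "?A d - ?A r \<le> (ln d - p 0 / d) - (ln r - p 0 / r)"
      "?A d - ?A r \<ge> (- ln d - p 0 / d) - (- ln r - p 0 / r)"
      unfolding A[symmetric] FTC1[OF r] by auto
    then have "\<bar>(?A r + p 0 / r) - (?A d + p 0 / d)\<bar> \<le> ln d - ln r" by (simp add: abs_le_iff)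
    then have "\<bar>?A r + p 0 / r\<bar> \<le> \<bar>?A d\<bar> + \<bar>p 0 / d\<bar> + \<bar>ln d\<bar> - ln r" by linarith
    then have "r * \<bar>?A r + p 0 / r\<bar> \<le> r * (\<bar>?A d\<bar> + \<bar>p 0 / d\<bar> + \<bar>ln d\<bar> - ln r)"
      using r by (intro mult_left_mono) auto
    moreover have "r * \<bar>?A r + p 0 / r\<bar> = \<bar>r * ?A r + p 0\<bar>"
    proof -
      have "r * (?A r + p 0 / r) = r * ?A r + p 0" using r by (simp add: distrib_left)
      then show ?thesis using r by (metis abs_mult abs_of_pos)
    qed
    ultimately show ?thesis using d by (simp add: algebra_simps)
  qed
  let ?c = "\<bar>?A d\<bar> + \<bar>p 0\<bar> / d + \<bar>ln d\<bar>"
  have "((\<lambda>r. r * c + (- r * ln r)) \<longlongrightarrow> 0) (at_right 0)" for c :: real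
    by real_asymp
  note lim = this[of ?c]
  have "((\<lambda>r. r * ?A r - (- p 0)) \<longlongrightarrow> 0) (at_right 0)"
  proof (rule Lim_null_comparison[OF _ lim])
    show "\<forall>\<^sub>F r in at_right 0. norm (r * ?A r - - p 0) \<le> r * ?c + (- r * ln r)"
      unfolding eventually_at_right_field using est d by (intro exI[of _ d]) auto
  qed
  then show *: "((\<lambda>\<rho>. \<rho> * ?A \<rho>) \<longlongrightarrow> - p 0) (at_right 0)" by (simp only: LIM_zero_iff)
  show "pressure_potential p 0 = - p 0"
    unfolding pressure_potential_def Let_def using tendsto_Lim[OF trivial_limit_at_right_real *] by simp
qed

text \<open>
The regularisation of \<open>P'\<close>: \<open>Q\<close> is the primitive of \<open>p'(s) / max s h\<close>, and \<open>pe\<close> the primitive of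
\<open>s p'(s) / max s h\<close>, both normalised at the upper end \<open>hi\<close> of the range. For \<open>s \<ge> h\<close> nothing is
changed, hence \<open>pe = p\<close> and \<open>s Q(s) - pe s = P s\<close> there. The bound on \<open>Q\<close> compares it with a multiple
of \<open>s\<close> to the power \<open>\<gamma> - 1\<close>, whose derivative dominates \<open>Q'\<close> and is integrable at \<open>0\<close>.
\<close>

lemma approximate_potentials:
  fixes p p' :: "real \<Rightarrow> real"
  assumes lo: "0 \<le> lo" and h: "0 < h" "h < hi" and g: "1 < \<gamma>" "\<gamma> < 2" and lohi: "lo \<le> hi" and C: "0 \<le> C"
    and cont: "continuous_on UNIV p'"
    and p': "\<And>s. s \<in> {lo..hi} \<Longrightarrow> (p has_real_derivative p' s) (at s within {lo..hi})"
    and bd: "\<And>s. s \<in> {lo..hi} \<Longrightarrow> \<bar>p' s\<bar> \<le> C * s powr (\<gamma> - 1)"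
    and pd: "potential_defined lo hi p"
  defines "P \<equiv> pressure_potential p"
  defines "C2 \<equiv> \<bar>(P hi + p hi) / hi\<bar> + C / (\<gamma> - 1) * hi powr (\<gamma> - 1)"
  obtains Q Q' pe where
    "continuous_on UNIV Q'" "\<And>s. (Q has_real_derivative Q' s) (at s)" "\<And>s. (pe has_real_derivative s * Q' s) (at s)"
    "\<And>s. s \<in> {lo..hi} \<Longrightarrow> \<bar>Q s\<bar> \<le> C2"
    "\<And>s. s \<in> {lo..hi} \<Longrightarrow> \<bar>Q' s\<bar> \<le> C * h powr (\<gamma> - 2)"
    "\<And>s. s \<in> {lo..hi} \<Longrightarrow> \<bar>pe s - p s\<bar> \<le> C * h powr \<gamma>"
    "\<And>s t. s \<in> {lo..hi} \<Longrightarrow> t \<in> {lo..hi} \<Longrightarrow> \<bar>pe s - pe t\<bar> \<le> C * hi powr (\<gamma> - 1) * \<bar>s - t\<bar>"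
    "\<And>s t. s \<in> {lo..hi} \<Longrightarrow> t \<in> {lo..hi} \<Longrightarrow> \<bar>(s * Q s - pe s) - (t * Q t - pe t)\<bar> \<le> C2 * \<bar>s - t\<bar>"
    "\<And>s. s \<in> {lo..hi} \<Longrightarrow> h \<le> s \<Longrightarrow> s * Q s - pe s = P s"
proof -
  have hi: "0 < hi" using h by simp
  define Q' where "Q' s = p' s / max s h" for s
  have contQ': "continuous_on UNIV Q'"
    unfolding Q'_def using h by (intro continuous_intros cont) (auto simp: max_def)
  obtain Q where Q: "\<And>s. (Q has_real_derivative Q' s) (at s)" and Qhi: "Q hi = (P hi + p hi) / hi"
    using continuous_antiderivative[OF contQ', of hi "(P hi + p hi) / hi"] by blast
  have "continuous_on UNIV (\<lambda>s. s * Q' s)" by (intro continuous_intros contQ')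
  then obtain pe where pe: "\<And>s. (pe has_real_derivative s * Q' s) (at s)" and pehi: "pe hi = p hi"
    using continuous_antiderivative[of "\<lambda>s. s * Q' s" hi "p hi"] by blast
  have mx: "0 < max s h" for s using h by simp
  have Q'1: "\<bar>Q' s\<bar> \<le> C * s powr (\<gamma> - 2)" if "s \<in> {lo..hi}" "0 < s" for s
  proof -
    \<comment> \<open>for positive densities the regularisation only makes the quotient smaller\<close>
    have "\<bar>Q' s\<bar> = \<bar>p' s\<bar> / max s h" using mx[of s] by (simp add: Q'_def)
    also have "\<dots> \<le> C * s powr (\<gamma> - 1) / s"
      using bd[OF that(1)] that C by (intro frac_le) auto
    also have "s powr (\<gamma> - 1) = s powr (\<gamma> - 2) * s"
      using that powr_add[of s "\<gamma> - 2" 1] by simp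
    finally show ?thesis using that by simp
  qed
  have Q'2: "\<bar>Q' s\<bar> \<le> C * h powr (\<gamma> - 2)" if s: "s \<in> {lo..hi}" for s
  proof (cases "h \<le> s")
    case True
    have "\<bar>Q' s\<bar> \<le> C * s powr (\<gamma> - 2)" using Q'1 s h True by auto
    also have "\<dots> \<le> C * h powr (\<gamma> - 2)" using C h True g by (intro mult_left_mono powr_mono2') auto
    finally show ?thesis .
  next
    case False
    have "\<bar>Q' s\<bar> = \<bar>p' s\<bar> / max s h" using mx[of s] by (simp add: Q'_def)
    also have "\<dots> \<le> C * h powr (\<gamma> - 1) / h"
    proof (rule frac_le)
      have "C * s powr (\<gamma> - 1) \<le> C * h powr (\<gamma> - 1)" using C False s lo g by (intro mult_left_mono powr_mono2) auto
      then show "\<bar>p' s\<bar> \<le> C * h powr (\<gamma> - 1)" using bd[OF s] by simp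
    qed (use h C in auto)
    also have "h powr (\<gamma> - 1) = h powr (\<gamma> - 2) * h"
      using h powr_add[of h "\<gamma> - 2" 1] by simp
    finally show ?thesis using h by simp
  qed
  define psi where "psi s = C / (\<gamma> - 1) * s powr (\<gamma> - 1)" for s
  have psi': "(psi has_real_derivative C * s powr (\<gamma> - 2)) (at s)" if "0 < s" for s
  proof -
    have "(psi has_real_derivative C / (\<gamma> - 1) * ((\<gamma> - 1) * s powr (\<gamma> - 1 - 1))) (at s)"
      unfolding psi_def by (intro DERIV_cmult has_real_derivative_powr that)
    then show ?thesis using g by simp
  qed
  have psic: "continuous_on {s..hi} psi" if "0 \<le> s" for s
    unfolding psi_def using that g by (intro continuous_intros continuous_on_powr') auto
  have Qc: "continuous_on A Q" for A using Q by (meson DERIV_isCont continuous_at_imp_continuous_on)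
  have Qb: "\<bar>Q s\<bar> \<le> C2" if s: "s \<in> {lo..hi}" for s
  proof -
    have s0: "0 \<le> s" using s lo by simp
    have "psi s + Q s \<le> psi hi + Q hi"
    proof (rule DERIV_nonneg_imp_increasing_open[of s hi "\<lambda>s. psi s + Q s"])
      fix x assume x: "s < x" "x < hi"
      then show "\<exists>y. ((\<lambda>s. psi s + Q s) has_real_derivative y) (at x) \<and> 0 \<le> y"
        using Q'1[of x] s s0 by (intro exI[of _ "C * x powr (\<gamma> - 2) + Q' x"]) (auto intro!: derivative_intros psi' Q simp: abs_le_iff)
    qed (use s s0 in \<open>auto intro!: continuous_intros psic Qc\<close>)
    moreover have "psi s - Q s \<le> psi hi - Q hi"
    proof (rule DERIV_nonneg_imp_increasing_open[of s hi "\<lambda>s. psi s - Q s"])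
      fix x assume x: "s < x" "x < hi"
      then show "\<exists>y. ((\<lambda>s. psi s - Q s) has_real_derivative y) (at x) \<and> 0 \<le> y"
        using Q'1[of x] s s0 by (intro exI[of _ "C * x powr (\<gamma> - 2) - Q' x"]) (auto intro!: derivative_intros psi' Q simp: abs_le_iff)
    qed (use s s0 in \<open>auto intro!: continuous_intros psic Qc\<close>)
    moreover have "0 \<le> psi s" using C g by (simp add: psi_def)
    ultimately have "\<bar>Q s\<bar> \<le> \<bar>Q hi\<bar> + psi hi" by linarith
    then show ?thesis by (simp add: C2_def Qhi psi_def)
  qed
  have peL: "\<bar>pe s - pe t\<bar> \<le> C * hi powr (\<gamma> - 1) * \<bar>s - t\<bar>" if "s \<in> {lo..hi}" "t \<in> {lo..hi}" for s t
  proof (rule derivative_bound_imp_lipschitz[OF has_field_derivative_at_within[OF pe] _ that])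
    fix x assume x: "x \<in> {lo..hi}"
    have "\<bar>x * Q' x\<bar> = \<bar>p' x\<bar> * (x / max x h)" using mx[of x] x lo by (simp add: Q'_def abs_mult)
    also have "\<dots> \<le> \<bar>p' x\<bar> * 1" using mx[of x] by (intro mult_left_mono) auto
    also have "\<dots> \<le> C * x powr (\<gamma> - 1)" using bd[OF x] by simp
    also have "\<dots> \<le> C * hi powr (\<gamma> - 1)" using C x lo g by (intro mult_left_mono powr_mono2) auto
    finally show "\<bar>x * Q' x\<bar> \<le> C * hi powr (\<gamma> - 1)" .
  qed
  have Pd: "((\<lambda>s. s * Q s - pe s) has_real_derivative Q s) (at s)" for s
    by (auto intro!: derivative_eq_intros Q pe)
  have PL: "\<bar>(s * Q s - pe s) - (t * Q t - pe t)\<bar> \<le> C2 * \<bar>s - t\<bar>" if "s \<in> {lo..hi}" "t \<in> {lo..hi}" for s t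
    by (rule derivative_bound_imp_lipschitz[OF has_field_derivative_at_within[OF Pd] Qb that])
  have pe_eq: "pe s = p s" if s: "s \<in> {lo..hi}" "h \<le> s" for s
  proof -
    have "\<bar>(pe s - p s) - (pe hi - p hi)\<bar> \<le> 0 * \<bar>s - hi\<bar>"
    proof (rule derivative_bound_imp_lipschitz[of s hi "\<lambda>s. pe s - p s" "\<lambda>x. x * Q' x - p' x"])
      fix x assume x: "x \<in> {s..hi}"
      show "((\<lambda>s. pe s - p s) has_real_derivative x * Q' x - p' x) (at x within {s..hi})"
        using s x by (intro derivative_intros has_field_derivative_at_within[OF pe] DERIV_subset[OF p']) auto
      have "max x h = x" "x \<noteq> 0" using x s h by auto
      then show "\<bar>x * Q' x - p' x\<bar> \<le> 0" by (simp add: Q'_def)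
    qed (use s in auto)
    then show ?thesis by (simp add: pehi)
  qed
  have pe_p: "\<bar>pe s - p s\<bar> \<le> C * h powr \<gamma>" if s: "s \<in> {lo..hi}" for s
  proof (cases "h \<le> s")
    case True then show ?thesis using pe_eq[OF s] C by simp
  next
    case False
    then have hl: "h \<in> {lo..hi}" using s h by auto
    have "\<bar>(pe s - p s) - (pe h - p h)\<bar> \<le> (C * h powr (\<gamma> - 1)) * \<bar>s - h\<bar>"
    proof (rule derivative_bound_imp_lipschitz[of s h "\<lambda>s. pe s - p s" "\<lambda>x. x * Q' x - p' x"])
      fix x assume x: "x \<in> {s..h}"
      then have xl: "x \<in> {lo..hi}" using s h by auto
      show "((\<lambda>s. pe s - p s) has_real_derivative x * Q' x - p' x) (at x within {s..h})"
        using xl s hl by (intro derivative_intros has_field_derivative_at_within[OF pe] DERIV_subset[OF p']) auto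
      have "x * Q' x - p' x = - (p' x * (1 - x / h))" using x h by (simp add: Q'_def max_def field_simps)
      then have "\<bar>x * Q' x - p' x\<bar> = \<bar>p' x\<bar> * \<bar>1 - x / h\<bar>" by (simp add: abs_mult)
      also have "\<dots> \<le> \<bar>p' x\<bar> * 1" using x h s lo by (intro mult_left_mono) (auto simp: abs_le_iff)
      also have "\<dots> \<le> C * x powr (\<gamma> - 1)" using bd[OF xl] by simp
      also have "\<dots> \<le> C * h powr (\<gamma> - 1)" using C x xl lo g by (intro mult_left_mono powr_mono2) auto
      finally show "\<bar>x * Q' x - p' x\<bar> \<le> C * h powr (\<gamma> - 1)" .
    qed (use False in auto)
    also have "\<dots> \<le> (C * h powr (\<gamma> - 1)) * h" using False s lo C by (intro mult_left_mono) auto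
    also have "\<dots> = C * h powr \<gamma>" using h by (simp add: powr_diff)
    finally show ?thesis using pe_eq[OF hl] by simp
  qed
  have Peq: "s * Q s - pe s = P s" if s: "s \<in> {lo..hi}" "h \<le> s" for s
  proof -
    let ?A = "\<lambda>\<rho>. LBINT s = ereal 1..ereal \<rho>. p s / s\<^sup>2"
    have s0: "0 < s" using s h by simp
    have "?A hi - ?A s = (LBINT y=ereal s..ereal hi. p y / y\<^sup>2)"
      by (rule potential_integrable_between[OF pd]) (use s s0 in auto)
    also have "\<dots> = (Q hi - pe hi / hi) - (Q s - pe s / s)"
    proof (rule interval_integral_FTC_finite)
      have sh: "min s hi = s" "max s hi = hi" using s by auto
      have "continuous_on {lo..hi} p"
        using p' by (meson DERIV_continuous continuous_on_eq_continuous_within)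
      then show "continuous_on {min s hi..max s hi} (\<lambda>y. p y / y\<^sup>2)"
        unfolding sh using s s0 by (intro continuous_intros) (auto elim: continuous_on_subset)
      fix x assume "min s hi \<le> x" "x \<le> max s hi"
      then have x: "s \<le> x" "x \<le> hi" unfolding sh by auto
      have x0: "0 < x" using x s0 by simp
      have "((\<lambda>x. Q x - pe x / x) has_real_derivative Q' x - (x * Q' x * x - pe x * 1) / (x * x)) (at x)"
        by (intro derivative_intros Q pe) (use x0 in auto)
      also have "Q' x - (x * Q' x * x - pe x * 1) / (x * x) = p x / x\<^sup>2"
        using pe_eq[of x] x s h x0 by (simp add: diff_divide_distrib power2_eq_square)
      finally show "((\<lambda>x. Q x - pe x / x) has_vector_derivative p x / x\<^sup>2) (at x within {min s hi..max s hi})"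
        by (simp add: has_real_derivative_iff_has_vector_derivative has_vector_derivative_at_within)
    qed
    finally have A: "?A hi - ?A s = (Q hi - p hi / hi) - (Q s - p s / s)" using pe_eq[of s] s pehi by simp
    have P1: "P hi = hi * ?A hi" "P s = s * ?A s"
      unfolding P_def pressure_potential_def Let_def using hi s0 by auto
    have "?A hi = Q hi - p hi / hi"
      unfolding Qhi using hi P1(1) by (simp add: field_simps)
    with A have "?A s = Q s - p s / s" by simp
    then show ?thesis using P1(2) pe_eq[OF s] s0 by (simp add: field_simps)
  qed
  show thesis
    by (rule that[of Q' Q pe]) (use contQ' Q pe Qb Q'2 pe_p peL PL Peq in auto)
qed

text \<open>
\<open>Q\<close> stands for \<open>P'\<close>, \<open>pe\<close> for the pressure and \<open>s Q(s) - pe s\<close> for the potential that correspond to it.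
The bounds concern the range \<open>[lo, hi]\<close> of the density. The constant \<open>C\<close> is a separate argument
because it has to be the same for all \<open>h\<close>.
\<close>

definition regularised_potential :: "real \<Rightarrow> real \<Rightarrow> (real \<Rightarrow> real) \<Rightarrow> (real \<Rightarrow> real) \<Rightarrow> real \<Rightarrow> real \<Rightarrow> real \<Rightarrow>
    (real \<Rightarrow> real) \<Rightarrow> (real \<Rightarrow> real) \<Rightarrow> (real \<Rightarrow> real) \<Rightarrow> bool" where
  "regularised_potential lo hi p P \<gamma> C h Q Q' pe \<longleftrightarrow> continuous_on UNIV Q' \<and>
      (\<forall>s. (Q has_real_derivative Q' s) (at s)) \<and> (\<forall>s. (pe has_real_derivative s * Q' s) (at s)) \<and>
      (\<forall>s\<in>{lo..hi}. \<bar>Q s\<bar> \<le> C \<and> \<bar>Q' s\<bar> \<le> C * h powr (\<gamma> - 2) \<and> \<bar>pe s - p s\<bar> \<le> C * h powr \<gamma> \<and>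
         \<bar>s * Q s - pe s - P s\<bar> \<le> C * h) \<and>
      (\<forall>s\<in>{lo..hi}. \<forall>t\<in>{lo..hi}. \<bar>pe s - pe t\<bar> \<le> C * \<bar>s - t\<bar> \<and>
         \<bar>(s * Q s - pe s) - (t * Q t - pe t)\<bar> \<le> C * \<bar>s - t\<bar>)"

text \<open>
The potential \<open>P\<close> coincides on \<open>[s, hi]\<close> with the approximation at scale \<open>h = s\<close>, so it inherits
the common Lipschitz constant, first away from \<open>0\<close> and then up to \<open>0\<close> by continuity. This gives the
error \<open>O(h)\<close> of the approximate potential below \<open>h\<close>. If the range is the single point \<open>0\<close>, constants
will do, because \<open>P 0 = - p 0\<close>.
\<close>

lemma pressure_approximation:
  fixes p :: "real \<Rightarrow> real"
  assumes lohi: "0 \<le> lo" "lo \<le> hi" and g: "1 < \<gamma>" "\<gamma> < 2"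
    and C1: "C1_holder (\<gamma> - 1) {lo..hi} p"
    and p0: "lo = 0 \<Longrightarrow> (p has_real_derivative 0) (at_right 0)"
    and pd: "potential_defined lo hi p"
  defines "P \<equiv> pressure_potential p"
  obtains p' C h0 where "0 \<le> C" "0 < h0"
    "\<And>s t. s \<in> {lo..hi} \<Longrightarrow> t \<in> {lo..hi} \<Longrightarrow> \<bar>p s - p t - p' t * (s - t)\<bar> \<le> C * \<bar>s - t\<bar> powr \<gamma>"
    "\<And>s t. s \<in> {lo..hi} \<Longrightarrow> t \<in> {lo..hi} \<Longrightarrow> \<bar>p s - p t\<bar> \<le> C * \<bar>s - t\<bar>"
    "\<And>s t. s \<in> {lo..hi} \<Longrightarrow> t \<in> {lo..hi} \<Longrightarrow> \<bar>P s - P t\<bar> \<le> C * \<bar>s - t\<bar>"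
    "\<And>h. 0 < h \<Longrightarrow> h < h0 \<Longrightarrow> \<exists>Q Q' pe. regularised_potential lo hi p P \<gamma> C h Q Q' pe"
proof (cases "hi = 0")
  case True
  then have lo: "lo = 0" using lohi by simp
  have P0: "P 0 = - p 0"
    unfolding P_def using potential_at_zero(2)[of hi p] pd p0 lo by simp
  show thesis
  proof (rule that[of 0 1])
    fix h :: real assume "0 < h"
    show "\<exists>Q Q' pe. regularised_potential lo hi p P \<gamma> 0 h Q Q' pe"
      unfolding regularised_potential_def
      by (rule exI[of _ "\<lambda>_. 0"], rule exI[of _ "\<lambda>_. 0"], rule exI[of _ "\<lambda>_. p 0"])
        (use True lo P0 in auto)
  qed (use True lo in auto)
next
  case False
  then have hi: "0 < hi" using lohi by simp
  obtain p' C where C: "0 \<le> C" and cont: "continuous_on UNIV p'"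
    and p': "\<And>s. s \<in> {lo..hi} \<Longrightarrow> (p has_real_derivative p' s) (at s within {lo..hi})"
    and bd: "\<And>s. s \<in> {lo..hi} \<Longrightarrow> \<bar>p' s\<bar> \<le> C * s powr (\<gamma> - 1)"
    and taylor: "\<And>s t. s \<in> {lo..hi} \<Longrightarrow> t \<in> {lo..hi} \<Longrightarrow> \<bar>p s - p t - p' t * (s - t)\<bar> \<le> C * \<bar>s - t\<bar> powr \<gamma>"
    using pressure_derivative[OF lohi g(1) C1 p0] by metis
  define C2 where "C2 = \<bar>(P hi + p hi) / hi\<bar> + C / (\<gamma> - 1) * hi powr (\<gamma> - 1)"
  define C3 where "C3 = C * hi powr (\<gamma> - 1)"
  have C23: "0 \<le> C2" "0 \<le> C3" using C g by (auto simp: C2_def C3_def)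
  note ap = approximate_potentials[OF lohi(1) _ _ g lohi(2) C cont p' bd pd, folded P_def, folded C2_def, folded C3_def]
  have PLpos: "\<bar>P s - P t\<bar> \<le> C2 * \<bar>s - t\<bar>" if st: "s \<in> {lo..hi}" "t \<in> {lo..hi}" "0 < s" "s \<le> t" for s t
  proof (cases "s < hi")
    case True
    obtain Q pe where L: "\<And>s t. s \<in> {lo..hi} \<Longrightarrow> t \<in> {lo..hi} \<Longrightarrow> \<bar>(s * Q s - pe s) - (t * Q t - pe t)\<bar> \<le> C2 * \<bar>s - t\<bar>"
      and E: "\<And>x. x \<in> {lo..hi} \<Longrightarrow> s \<le> x \<Longrightarrow> x * Q x - pe x = P x"
      by (rule ap[of s]) (use st True in auto)
    show ?thesis using L[of s t] E[of s] E[of t] st by simp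
  next
    case False
    then show ?thesis using st by auto
  qed
  have PL0: "\<bar>P s - P t\<bar> \<le> C2 * \<bar>s - t\<bar>" if st: "s \<in> {lo..hi}" "t \<in> {lo..hi}" "s \<le> t" for s t
  proof (cases "0 < s")
    case True then show ?thesis using PLpos st by auto
  next
    case False
    then have s: "s = 0" and lo: "lo = 0" using st lohi by auto
    show ?thesis
    proof (cases "t = 0")
      case False
      then have t: "0 < t" using st s by auto
      have lim: "((\<lambda>\<rho>. \<rho> * (LBINT s = ereal 1..ereal \<rho>. p s / s\<^sup>2)) \<longlongrightarrow> P 0) (at_right 0)"
        using potential_at_zero[of hi p] pd p0 lo by (simp add: P_def)
      have "((\<lambda>x. \<bar>x * (LBINT s = ereal 1..ereal x. p s / s\<^sup>2) - P t\<bar>) \<longlongrightarrow> \<bar>P 0 - P t\<bar>) (at_right 0)"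
        by (intro tendsto_intros lim)
      moreover have "((\<lambda>x. C2 * \<bar>x - t\<bar>) \<longlongrightarrow> C2 * \<bar>0 - t\<bar>) (at_right 0)"
        by (intro tendsto_intros)
      moreover have "\<forall>\<^sub>F x in at_right 0. \<bar>x * (LBINT s = ereal 1..ereal x. p s / s\<^sup>2) - P t\<bar> \<le> C2 * \<bar>x - t\<bar>"
        unfolding eventually_at_right_field
      proof (intro exI[of _ t] conjI allI impI)
        fix x assume x: "0 < x" "x < t"
        then have "P x = x * (LBINT s = ereal 1..ereal x. p s / s\<^sup>2)"
          by (simp add: P_def pressure_potential_def Let_def)
        then show "\<bar>x * (LBINT s = ereal 1..ereal x. p s / s\<^sup>2) - P t\<bar> \<le> C2 * \<bar>x - t\<bar>"
          using PLpos[of x t] x st lo by auto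
      qed (use t in auto)
      ultimately show ?thesis unfolding s
        by (intro tendsto_le[OF trivial_limit_at_right_real]) auto
    qed (simp add: s)
  qed
  have PL: "\<bar>P s - P t\<bar> \<le> C2 * \<bar>s - t\<bar>" if st: "s \<in> {lo..hi}" "t \<in> {lo..hi}" for s t
    using PL0[OF st] PL0[OF st(2,1)] by (cases "s \<le> t") (auto simp: abs_minus_commute)
  have pL: "\<bar>p s - p t\<bar> \<le> C3 * \<bar>s - t\<bar>" if st: "s \<in> {lo..hi}" "t \<in> {lo..hi}" for s t
  proof (rule derivative_bound_imp_lipschitz[OF p' _ st])
    fix x assume x: "x \<in> {lo..hi}"
    have "C * x powr (\<gamma> - 1) \<le> C3" unfolding C3_def using C x lohi g by (intro mult_left_mono powr_mono2) auto
    then show "\<bar>p' x\<bar> \<le> C3" using bd[OF x] by simp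
  qed
  define D where "D = C + 2 * C2 + C3"
  have D: "0 \<le> D" "C \<le> D" "C2 \<le> D" "C3 \<le> D" "2 * C2 \<le> D" using C C23 by (auto simp: D_def)
  have up: "x \<le> D * y" if "x \<le> c * y" "c \<le> D" "0 \<le> y" for x y c
    using that mult_right_mono[of c D y] by linarith
  show thesis
  proof (rule that[of D hi p'])
    fix h :: real assume h: "0 < h" "h < hi"
    show "\<exists>Q Q' pe. regularised_potential lo hi p P \<gamma> D h Q Q' pe"
    proof (rule ap[OF h], goal_cases)
    case (3 Q Q' pe)
    have 5: "\<bar>s * Q s - pe s - P s\<bar> \<le> D * h" if s: "s \<in> {lo..hi}" for s
    proof (cases "h \<le> s")
      case True then show ?thesis using 3(9)[OF s] D h by simp
    next
      case False
      then have hl: "h \<in> {lo..hi}" using s h by auto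
      have "\<bar>s * Q s - pe s - P s\<bar> \<le> C2 * \<bar>s - h\<bar> + C2 * \<bar>s - h\<bar>"
        using 3(8)[OF s hl] PL[OF s hl] 3(9)[OF hl] by linarith
      also have "\<dots> = 2 * C2 * \<bar>s - h\<bar>" by simp
      also have "\<dots> \<le> 2 * C2 * h" using False s lohi C23 by (intro mult_left_mono) auto
      also have "\<dots> \<le> D * h" using D h by (intro mult_right_mono) auto
      finally show ?thesis .
    qed
    show ?case unfolding regularised_potential_def
      by (intro exI[of _ Q] exI[of _ Q'] exI[of _ pe] conjI allI ballI 3(1-3) 5 order_trans[OF 3(4) D(3)]
          up[OF 3(5) D(2)] up[OF 3(6) D(2)] up[OF 3(7) D(4)] up[OF 3(8) D(3)]) auto
    qed auto
  next
    fix s t assume st: "s \<in> {lo..hi}" "t \<in> {lo..hi}"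
    show "\<bar>p s - p t - p' t * (s - t)\<bar> \<le> D * \<bar>s - t\<bar> powr \<gamma>" by (rule up[OF taylor[OF st] D(2)]) auto
    show "\<bar>p s - p t\<bar> \<le> D * \<bar>s - t\<bar>" by (rule up[OF pL[OF st] D(4)]) auto
    show "\<bar>P s - P t\<bar> \<le> D * \<bar>s - t\<bar>" by (rule up[OF PL[OF st] D(3)]) auto
  qed (use D hi in auto)
qed

section \<open>Calculus of test functions and convolutions\<close>

abbreviation pd :: "'a::euclidean_space \<Rightarrow> ('a \<Rightarrow> real) \<Rightarrow> 'a \<Rightarrow> real" where
  "pd b f z \<equiv> frechet_derivative f (at z) b"

lemma pd_eq: "(f has_derivative f') (at z) \<Longrightarrow> pd b f z = f' b"
  by (metis frechet_derivative_at)

lemma Ck_SucD: "Ck (Suc k) f \<Longrightarrow> Ck k f"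
proof (induction k arbitrary: f)
  case 0
  then show ?case
    by (auto intro!: continuous_at_imp_continuous_on differentiable_imp_continuous_within)
next
  case (Suc k)
  from Suc.prems have "\<forall>x. f differentiable (at x)" "\<forall>b\<in>Basis. Ck (Suc k) (pd b f)" by (simp_all del: Ck.simps(1) add: Ck.simps(2)[of "Suc k" f])
  then show ?case using Suc.IH by auto
qed

lemma C1_differentiable: "Ck (Suc 0) f \<Longrightarrow> f differentiable (at x)"
  by simp

lemma C1_derivative: "Ck (Suc 0) f \<Longrightarrow> (f has_derivative frechet_derivative f (at x)) (at x)"
  by (rule iffD1[OF frechet_derivative_works C1_differentiable])

lemma C1_continuous: "Ck (Suc 0) f \<Longrightarrow> continuous_on UNIV f"
  using Ck_SucD[of 0 f] by simp

lemma C1_continuous_pd: "Ck (Suc 0) f \<Longrightarrow> b \<in> Basis \<Longrightarrow> continuous_on UNIV (pd b f)"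
  by simp

lemma smooth_C1: "smooth f \<Longrightarrow> Ck (Suc 0) f"
  unfolding smooth_def by blast

lemma smooth_pd: "smooth f \<Longrightarrow> b \<in> Basis \<Longrightarrow> smooth (pd b f)"
  unfolding smooth_def by (metis Ck.simps(2))

lemma C1I:
  assumes "\<And>x. (f has_derivative D x) (at x)" "\<And>b. b \<in> Basis \<Longrightarrow> continuous_on UNIV (\<lambda>x. D x b)"
  shows "Ck (Suc 0) f"
proof -
  have "pd b f = (\<lambda>x. D x b)" for b using pd_eq[OF assms(1)] by auto
  then show ?thesis using assms by (auto simp: differentiable_def)
qed

lemma
  assumes f: "Ck (Suc 0) f" and g: "Ck (Suc 0) g"
  shows C1_mult: "Ck (Suc 0) (\<lambda>z. f z * g z)"
    and pd_mult: "pd b (\<lambda>z. f z * g z) z = f z * pd b g z + pd b f z * g z"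
proof -
  have D: "((\<lambda>z. f z * g z) has_derivative (\<lambda>h. f x * frechet_derivative g (at x) h + frechet_derivative f (at x) h * g x)) (at x)" for x
    by (rule has_derivative_mult[OF C1_derivative[OF f] C1_derivative[OF g]])
  show "pd b (\<lambda>z. f z * g z) z = f z * pd b g z + pd b f z * g z" by (rule pd_eq[OF D])
  show "Ck (Suc 0) (\<lambda>z. f z * g z)"
    using C1_continuous[OF f] C1_continuous[OF g] C1_continuous_pd[OF f] C1_continuous_pd[OF g]
    by (intro C1I[OF D] continuous_intros) auto
qed

lemma
  assumes f: "Ck (Suc 0) f" and Q: "\<And>s. (Q has_real_derivative Q' s) (at s)" and c: "continuous_on UNIV Q'"
  shows C1_compose: "Ck (Suc 0) (\<lambda>z. Q (f z))"
    and pd_compose: "pd b (\<lambda>z. Q (f z)) z = Q' (f z) * pd b f z"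
proof -
  have D: "((\<lambda>z. Q (f z)) has_derivative (\<lambda>h. Q' (f x) * frechet_derivative f (at x) h)) (at x)" for x
    using has_derivative_compose[OF C1_derivative[OF f], of Q "(*) (Q' (f x))" x] Q[of "f x"]
    by (simp add: has_field_derivative_def)
  show "pd b (\<lambda>z. Q (f z)) z = Q' (f z) * pd b f z" by (rule pd_eq[OF D])
  show "Ck (Suc 0) (\<lambda>z. Q (f z))"
    using C1_continuous[OF f] C1_continuous_pd[OF f]
    by (intro C1I[OF D] continuous_intros continuous_on_compose2[OF c]) auto
qed

lemma
  assumes f: "Ck (Suc 0) f"
  shows C1_cmult: "Ck (Suc 0) (\<lambda>z. c * f z)" and pd_cmult: "pd b (\<lambda>z. c * f z) z = c * pd b f z"
proof -
  have "((*) c has_real_derivative c) (at s)" for s by (auto intro!: derivative_eq_intros)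
  from C1_compose[OF f this] pd_compose[OF f this] show "Ck (Suc 0) (\<lambda>z. c * f z)" "pd b (\<lambda>z. c * f z) z = c * pd b f z"
    by (auto simp: continuous_on_const)
qed

lemma pd_scale:
  assumes "f differentiable (at (c *\<^sub>R z))"
  shows "((\<lambda>z. a * f (c *\<^sub>R z)) has_derivative (\<lambda>h. a * (c * frechet_derivative f (at (c *\<^sub>R z)) h))) (at z)"
proof -
  have d: "(f has_derivative frechet_derivative f (at (c *\<^sub>R z))) (at (c *\<^sub>R z))" using assms frechet_derivative_works by blast
  have "((\<lambda>z. f (c *\<^sub>R z)) has_derivative (\<lambda>h. frechet_derivative f (at (c *\<^sub>R z)) (c *\<^sub>R h))) (at z)"
    by (rule has_derivative_compose[where f = "\<lambda>z. c *\<^sub>R z" and g = f, OF _ d]) (auto intro!: derivative_eq_intros)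
  moreover have "frechet_derivative f (at (c *\<^sub>R z)) (c *\<^sub>R h) = c * frechet_derivative f (at (c *\<^sub>R z)) h" for h
    using linear_cmul[OF linear_frechet_derivative[OF assms]] by simp
  ultimately show ?thesis by (intro has_derivative_mult_right) simp
qed

lemma Ck_scale: "Ck k f \<Longrightarrow> Ck k (\<lambda>z. a * f (c *\<^sub>R z))"
proof (induction k arbitrary: f a)
  case 0
  then show ?case by (auto intro!: continuous_intros intro: continuous_on_compose2)
next
  case (Suc k)
  have D: "((\<lambda>z. a * f (c *\<^sub>R z)) has_derivative (\<lambda>h. a * (c * frechet_derivative f (at (c *\<^sub>R z)) h))) (at z)" for z
    using Suc.prems by (intro pd_scale) auto
  have "pd b (\<lambda>z. a * f (c *\<^sub>R z)) = (\<lambda>z. (a * c) * pd b f (c *\<^sub>R z))" for b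
    using pd_eq[OF D] by (auto simp: mult.assoc)
  moreover have "Ck k (\<lambda>z. (a * c) * pd b f (c *\<^sub>R z))" if "b \<in> Basis" for b
    by (rule Suc.IH) (use Suc.prems that in simp)
  ultimately show ?case using D by (auto simp: differentiable_def)
qed

lemma smooth_scale: "smooth f \<Longrightarrow> smooth (\<lambda>z. a * f (c *\<^sub>R z))"
  unfolding smooth_def using Ck_scale by blast

definition gradient :: "('a::euclidean_space \<Rightarrow> real) \<Rightarrow> 'a \<Rightarrow> 'a" where
  "gradient f z = (\<Sum>b\<in>Basis. pd b f z *\<^sub>R b)"

lemma gradient:
  assumes "Ck (Suc 0) f"
  shows "(f has_derivative (\<lambda>v. v \<bullet> gradient f z)) (at z)"
    and "frechet_derivative f (at z) v = v \<bullet> gradient f z"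
    and "continuous_on UNIV (gradient f)"
proof -
  have lin: "linear (frechet_derivative f (at z))" using assms by (intro linear_frechet_derivative) auto
  show eq: "frechet_derivative f (at z) v = v \<bullet> gradient f z" for v
  proof -
    have "frechet_derivative f (at z) v = frechet_derivative f (at z) (\<Sum>b\<in>Basis. (v \<bullet> b) *\<^sub>R b)"
      by (simp add: euclidean_representation)
    also have "\<dots> = (\<Sum>b\<in>Basis. (v \<bullet> b) * pd b f z)"
      by (simp add: linear_sum[OF lin] linear_cmul[OF lin])
    finally show ?thesis by (simp add: gradient_def inner_sum_right mult.commute)
  qed
  show "(f has_derivative (\<lambda>v. v \<bullet> gradient f z)) (at z)"
    using C1_derivative[OF assms, of z] by (simp add: eq[abs_def])
  show "continuous_on UNIV (gradient f)"
    unfolding gradient_def using C1_continuous_pd[OF assms] by (intro continuous_intros) auto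
qed

lemma continuous_bounded_on_cball:
  fixes h :: "'a::euclidean_space \<Rightarrow> 'b::real_normed_vector"
  assumes "continuous_on UNIV h"
  obtains B where "0 \<le> B" "\<And>x. x \<in> cball 0 r \<Longrightarrow> norm (h x) \<le> B"
proof -
  have "bounded (h ` cball 0 r)"
    by (intro compact_imp_bounded compact_continuous_image continuous_on_subset[OF assms]) auto
  then obtain B where B: "\<forall>y\<in>h ` cball 0 r. norm y \<le> B" unfolding bounded_iff by blast
  have "norm (h x) \<le> \<bar>B\<bar>" if "x \<in> cball 0 r" for x
    using bspec[OF B imageI[OF that]] abs_ge_self[of B] by linarith
  then show ?thesis using that[of "\<bar>B\<bar>"] by simp
qed

lemma integrable_compact_mult:
  fixes k h :: "'a::euclidean_space \<Rightarrow> real"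
  assumes k: "integrable lborel k" "\<And>y. norm y > R \<Longrightarrow> k y = 0" and h: "continuous_on UNIV h"
  shows "integrable lborel (\<lambda>y. k y * h y)"
proof -
  obtain B where B: "0 \<le> B" "\<And>x. x \<in> cball 0 R \<Longrightarrow> norm (h x) \<le> B"
    by (rule continuous_bounded_on_cball[OF h, of R]) blast
  have [measurable]: "h \<in> borel_measurable borel" using h by (rule borel_measurable_continuous_onI)
  show ?thesis
  proof (rule Bochner_Integration.integrable_bound[where f = "\<lambda>y. B * k y"])
    show "AE y in lborel. norm (k y * h y) \<le> norm (B * k y)"
    proof (rule AE_I2)
      fix y show "norm (k y * h y) \<le> norm (B * k y)"
      proof (cases "norm y > R")
        case False
        then have "\<bar>h y\<bar> \<le> B" using B(2)[of y] by simp
        then have "\<bar>k y\<bar> * \<bar>h y\<bar> \<le> \<bar>k y\<bar> * B" by (intro mult_left_mono) auto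
        then show ?thesis using B(1) by (simp add: abs_mult mult.commute)
      qed (simp add: k)
    qed
  qed (use k in auto)
qed

text \<open>
Differentiation under the integral sign. The support of \<open>k\<close> is bounded, so the gradient of \<open>h\<close> is
uniformly continuous on the relevant set, and by the mean value theorem the remainder of \<open>h\<close> is
\<open>o(|v|)\<close> uniformly in \<open>y\<close>.
\<close>

lemma has_derivative_integral_shift:
  fixes k h :: "'a::euclidean_space \<Rightarrow> real"
  assumes k: "integrable lborel k" "\<And>y. norm y > R \<Longrightarrow> k y = 0" and h: "Ck (Suc 0) h"
  shows "((\<lambda>z. \<integral>y. k y * h (z - y) \<partial>lborel) has_derivative
           (\<lambda>v. \<integral>y. k y * frechet_derivative h (at (z - y)) v \<partial>lborel)) (at z)"
proof -
  let ?G = "gradient h"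
  have hc: "continuous_on UNIV (\<lambda>y. h (x - y))" for x
    by (intro continuous_on_compose2[OF C1_continuous[OF h]] continuous_intros) auto
  have Gc: "continuous_on UNIV (\<lambda>y. v \<bullet> ?G (x - y))" for x v
    by (intro continuous_intros continuous_on_compose2[OF gradient(3)[OF h]]) auto
  note ih = integrable_compact_mult[OF k hc]
  note iG = integrable_compact_mult[OF k Gc]
  define D where "D v = (\<integral>y. k y * (v \<bullet> ?G (z - y)) \<partial>lborel)" for v
  have Dsum: "D v = (\<Sum>b\<in>Basis. (v \<bullet> b) * D b)" for v
  proof -
    have "D v = (\<integral>y. (\<Sum>b\<in>Basis. (v \<bullet> b) * (k y * (b \<bullet> ?G (z - y)))) \<partial>lborel)"
      unfolding D_def
    proof (rule Bochner_Integration.integral_cong[OF refl])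
      fix y
      have "v \<bullet> ?G (z - y) = (\<Sum>b\<in>Basis. (v \<bullet> b) * (b \<bullet> ?G (z - y)))"
        by (subst euclidean_inner) (rule sum.cong[OF refl], simp only: inner_commute)
      then show "k y * (v \<bullet> ?G (z - y)) = (\<Sum>b\<in>Basis. (v \<bullet> b) * (k y * (b \<bullet> ?G (z - y))))"
        by (simp only: sum_distrib_left mult.left_commute)
    qed
    also have "\<dots> = (\<Sum>b\<in>Basis. (v \<bullet> b) * D b)"
      unfolding D_def by (subst Bochner_Integration.integral_sum) (use iG in auto)
    finally show ?thesis .
  qed
  have lin: "bounded_linear D"
  proof -
    have eq: "D = (\<lambda>v. \<Sum>b\<in>Basis. (v \<bullet> b) * D b)" by (rule ext) (rule Dsum)
    have "bounded_linear (\<lambda>v. \<Sum>b\<in>Basis. (v \<bullet> b) * D b)"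
      by (intro bounded_linear_sum bounded_linear_mult_const bounded_linear_inner_left)
    then show ?thesis by (rule eq[THEN ssubst])
  qed
  have "((\<lambda>z. \<integral>y. k y * h (z - y) \<partial>lborel) has_derivative D) (at z)"
    unfolding has_derivative_at_alt
  proof (intro conjI lin allI impI)
    fix e :: real assume e: "0 < e"
    define K where "K = (\<integral>y. \<bar>k y\<bar> \<partial>lborel)"
    have K: "0 \<le> K" by (simp add: K_def)
    define e' where "e' = e / (K + 1)"
    have e': "0 < e'" "e' * K \<le> e" using e K by (auto simp: e'_def field_simps)
    define r where "r = norm z + \<bar>R\<bar> + 1"
    have "uniformly_continuous_on (cball 0 r) ?G"
      by (intro compact_uniformly_continuous continuous_on_subset[OF gradient(3)[OF h]]) auto
    then obtain d where d: "0 < d" "\<And>x x'. x \<in> cball 0 r \<Longrightarrow> x' \<in> cball 0 r \<Longrightarrow> dist x' x < d \<Longrightarrow> dist (?G x') (?G x) < e'"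
      unfolding uniformly_continuous_on_def using e' by blast
    have est: "\<bar>h (x + v) - h x - v \<bullet> ?G x\<bar> \<le> e' * norm v" if x: "norm x \<le> r - 1" and v: "norm v < min d 1" for x v
    proof -
      have "\<bar>(h (x + 1 *\<^sub>R v) - 1 * (v \<bullet> ?G x)) - (h (x + 0 *\<^sub>R v) - 0 * (v \<bullet> ?G x))\<bar> \<le> (e' * norm v) * norm (1 - 0 :: real)"
        unfolding real_norm_def[symmetric]
      proof (rule field_differentiable_bound[of "{0..1}" _ "\<lambda>s. v \<bullet> ?G (x + s *\<^sub>R v) - v \<bullet> ?G x"])
        fix s :: real assume s: "s \<in> {0..1}"
        have "((\<lambda>s. h (x + s *\<^sub>R v)) has_derivative (\<lambda>t. (t *\<^sub>R v) \<bullet> ?G (x + s *\<^sub>R v))) (at s)"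
          by (rule has_derivative_compose[where f = "\<lambda>s. x + s *\<^sub>R v" and g = h, OF _ gradient(1)[OF h]]) (auto intro!: derivative_eq_intros)
        then have "((\<lambda>s. h (x + s *\<^sub>R v)) has_real_derivative v \<bullet> ?G (x + s *\<^sub>R v)) (at s)"
          by (rule has_derivative_imp_has_field_derivative) (simp add: mult.commute)
        then have "((\<lambda>s. h (x + s *\<^sub>R v) - s * (v \<bullet> ?G x)) has_real_derivative v \<bullet> ?G (x + s *\<^sub>R v) - v \<bullet> ?G x) (at s)"
          by (auto intro!: derivative_eq_intros)
        then show "((\<lambda>s. h (x + s *\<^sub>R v) - s * (v \<bullet> ?G x)) has_real_derivative v \<bullet> ?G (x + s *\<^sub>R v) - v \<bullet> ?G x) (at s within {0..1})"
          by (rule has_field_derivative_at_within)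
        have sv: "norm (s *\<^sub>R v) \<le> norm v" using s by (simp add: mult_left_le_one_le)
        have "norm (x + s *\<^sub>R v) \<le> norm x + norm (s *\<^sub>R v)" by (rule norm_triangle_ineq)
        then have "dist (?G (x + s *\<^sub>R v)) (?G x) < e'"
        proof (intro d)
          show "dist (x + s *\<^sub>R v) x < d" using sv v by (simp add: dist_norm)
        qed (use \<open>norm (x + s *\<^sub>R v) \<le> norm x + norm (s *\<^sub>R v)\<close> x v sv in auto)
        then have "norm v * norm (?G (x + s *\<^sub>R v) - ?G x) \<le> norm v * e'"
          by (intro mult_left_mono) (auto simp: dist_norm)
        then show "norm (v \<bullet> ?G (x + s *\<^sub>R v) - v \<bullet> ?G x) \<le> e' * norm v"
          using Cauchy_Schwarz_ineq2[of v "?G (x + s *\<^sub>R v) - ?G x"] by (simp add: inner_diff_right mult.commute)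
      qed auto
      then show ?thesis by simp
    qed
    show "\<exists>d>0. \<forall>x. norm (x - z) < d \<longrightarrow>
        norm ((\<integral>y. k y * h (x - y) \<partial>lborel) - (\<integral>y. k y * h (z - y) \<partial>lborel) - D (x - z)) \<le> e * norm (x - z)"
    proof (intro exI[of _ "min d 1"] conjI allI impI)
      fix x assume x: "norm (x - z) < min d 1"
      have eq: "(\<integral>y. k y * h (x - y) \<partial>lborel) - (\<integral>y. k y * h (z - y) \<partial>lborel) - D (x - z)
        = (\<integral>y. k y * (h (x - y) - h (z - y) - (x - z) \<bullet> ?G (z - y)) \<partial>lborel)"
        unfolding D_def right_diff_distrib
        by (simp only: Bochner_Integration.integral_diff[OF ih ih]
            Bochner_Integration.integral_diff[OF Bochner_Integration.integrable_diff[OF ih ih] iG])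
      have "norm (\<integral>y. k y * (h (x - y) - h (z - y) - (x - z) \<bullet> ?G (z - y)) \<partial>lborel) \<le> (\<integral>y. norm (k y * (h (x - y) - h (z - y) - (x - z) \<bullet> ?G (z - y))) \<partial>lborel)"
        by (rule integral_norm_bound)
      also have "\<dots> \<le> (\<integral>y. \<bar>k y\<bar> * (e' * norm (x - z)) \<partial>lborel)"
      proof (rule integral_mono)
        fix y
        show "norm (k y * (h (x - y) - h (z - y) - (x - z) \<bullet> ?G (z - y))) \<le> \<bar>k y\<bar> * (e' * norm (x - z))"
        proof (cases "norm y > R")
          case False
          have "norm (z - y) \<le> r - 1" using False norm_triangle_ineq4[of z y] by (simp add: r_def)
          note E = est[OF this x]
          have "z - y + (x - z) = x - y" by simp
          note E = E[unfolded this]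
          then have "\<bar>k y\<bar> * \<bar>h (x - y) - h (z - y) - (x - z) \<bullet> ?G (z - y)\<bar> \<le> \<bar>k y\<bar> * (e' * norm (x - z))"
            by (intro mult_left_mono abs_ge_zero E)
          then show ?thesis by (simp only: real_norm_def abs_mult)
        next
          case True
          then have "k y = 0" by (rule k(2))
          then show ?thesis by simp
        qed
      next
        have "(\<lambda>y. k y * (h (x - y) - h (z - y) - (x - z) \<bullet> ?G (z - y))) = (\<lambda>y. k y * h (x - y) - k y * h (z - y) - k y * ((x - z) \<bullet> ?G (z - y)))"
          by (rule ext) (simp only: right_diff_distrib)
        moreover have "integrable lborel (\<lambda>y. k y * h (x - y) - k y * h (z - y) - k y * ((x - z) \<bullet> ?G (z - y)))"
          by (intro Bochner_Integration.integrable_diff ih iG)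
        ultimately show "integrable lborel (\<lambda>y. norm (k y * (h (x - y) - h (z - y) - (x - z) \<bullet> ?G (z - y))))"
          by (simp only: integrable_norm)
        show "integrable lborel (\<lambda>y. \<bar>k y\<bar> * (e' * norm (x - z)))"
          by (intro integrable_mult_left integrable_abs k)
      qed
      also have "\<dots> = K * (e' * norm (x - z))" by (simp add: K_def)
      also have "\<dots> = (e' * K) * norm (x - z)" by simp
      also have "\<dots> \<le> e * norm (x - z)" using e' by (intro mult_right_mono) auto
      finally show "norm ((\<integral>y. k y * h (x - y) \<partial>lborel) - (\<integral>y. k y * h (z - y) \<partial>lborel) - D (x - z)) \<le> e * norm (x - z)"
        by (simp only: eq)
    qed (use d in auto)
  qed
  then show ?thesis unfolding D_def[abs_def] gradient(2)[OF h] .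
qed

definition conv :: "('a::euclidean_space \<Rightarrow> real) \<Rightarrow> ('a \<Rightarrow> real) \<Rightarrow> 'a \<Rightarrow> real" where
  "conv g f z = (\<integral>y. g y * f (z - y) \<partial>lborel)"

lemma distr_reflect: "distr lborel borel (\<lambda>y. z - y) = (lborel :: 'a::euclidean_space measure)"
proof -
  have "(lborel :: 'a measure) = density (distr lborel borel (\<lambda>x. z + (-1) *\<^sub>R x)) (\<lambda>_. ennreal (\<bar>-1\<bar> ^ DIM('a)))"
    by (rule lborel_affine) simp
  then show ?thesis by (simp add: density_1)
qed

lemma integral_reflect:
  fixes f :: "'a::euclidean_space \<Rightarrow> real"
  assumes [measurable]: "f \<in> borel_measurable borel"
  shows "(\<integral>y. f (z - y) \<partial>lborel) = (\<integral>y. f y \<partial>lborel)"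
proof -
  have "(\<integral>y. f y \<partial>lborel) = (\<integral>y. f y \<partial>(distr lborel borel (\<lambda>y. z - y)))" by (simp add: distr_reflect)
  also have "\<dots> = (\<integral>y. f (z - y) \<partial>lborel)" by (rule integral_distr) auto
  finally show ?thesis by simp
qed

lemma conv_commute:
  assumes [measurable]: "f \<in> borel_measurable borel" "g \<in> borel_measurable borel"
  shows "conv g f z = (\<integral>w. f w * g (z - w) \<partial>lborel)"
  unfolding conv_def using integral_reflect[of "\<lambda>y. g y * f (z - y)" z] by (simp add: mult.commute)

definition ball_integrable :: "('a::euclidean_space \<Rightarrow> real) \<Rightarrow> bool" where
  "ball_integrable f \<longleftrightarrow> f \<in> borel_measurable borel \<and> (\<forall>r. integrable lborel (\<lambda>w. indicator (cball 0 r) w * f w))"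

lemma pd_vanish:
  assumes "\<And>y. norm y > R \<Longrightarrow> g y = 0" "norm y > R"
  shows "pd v g y = 0"
proof -
  have "((\<lambda>_. 0) has_derivative (\<lambda>_. 0)) (at y)" by simp
  then have "(g has_derivative (\<lambda>_. 0)) (at y)"
    by (rule has_derivative_transform_within_open[of _ _ _ _ "{y. norm y > R}"])
      (use assms in \<open>auto intro!: open_Collect_less continuous_intros\<close>)
  then show ?thesis by (rule pd_eq)
qed

text \<open>
In a neighbourhood of \<open>z\<close> only the values of \<open>f\<close> on a fixed ball matter, so \<open>f\<close> may be cut off.
\<close>

lemma conv_has_derivative:
  fixes g f :: "'a::euclidean_space \<Rightarrow> real"
  assumes g: "Ck (Suc 0) g" "\<And>y. norm y > R \<Longrightarrow> g y = 0" and f: "ball_integrable f"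
  shows "(conv g f has_derivative (\<lambda>v. conv (pd v g) f z)) (at z)"
proof -
  have fm[measurable]: "f \<in> borel_measurable borel" using f by (simp add: ball_integrable_def)
  have gm[measurable]: "g \<in> borel_measurable borel" using C1_continuous[OF g(1)] by (rule borel_measurable_continuous_onI)
  define r where "r = norm z + 1 + \<bar>R\<bar>"
  define k where "k w = indicator (cball 0 r) w * f w" for w
  have k: "integrable lborel k" "\<And>y. norm y > r \<Longrightarrow> k y = 0"
    using f by (auto simp: k_def[abs_def] ball_integrable_def)
  have D: "((\<lambda>x. \<integral>y. k y * g (x - y) \<partial>lborel) has_derivative
      (\<lambda>v. \<integral>y. k y * frechet_derivative g (at (z - y)) v \<partial>lborel)) (at z)"
    by (rule has_derivative_integral_shift[OF k g(1)])
  have g0: "pd v g y = 0" if "norm y > R" for y v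
    by (rule pd_vanish[OF g(2) that])
  have pm[measurable]: "pd v g \<in> borel_measurable borel" for v
    unfolding gradient(2)[OF g(1)] using gradient(3)[OF g(1)]
    by (intro borel_measurable_continuous_onI continuous_intros)
  have loc: "f y * q (x - y) = k y * q (x - y)" if "norm (x - z) < 1" "\<And>y. norm y > R \<Longrightarrow> q y = 0" for x y and q :: "'a \<Rightarrow> real"
  proof (cases "norm y \<le> r")
    case False
    have "norm y \<le> norm (x - y) + norm (x - z) + norm z"
      using norm_triangle_ineq4[of x "x - y"] norm_triangle_ineq[of "x - z" z] by simp
    then have "norm (x - y) > R" using False that(1) by (simp add: r_def)
    then show ?thesis using that(2) by simp
  qed (simp add: k_def)
  have "(conv g f has_derivative (\<lambda>v. \<integral>y. k y * frechet_derivative g (at (z - y)) v \<partial>lborel)) (at z)"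
  proof (rule has_derivative_transform_within_open[OF D, of "ball z 1"])
    fix x assume "x \<in> ball z 1"
    then have "norm (x - z) < 1" by (simp add: dist_norm norm_minus_commute)
    then have "(\<lambda>y. k y * g (x - y)) = (\<lambda>y. f y * g (x - y))"
      by (intro ext loc[of x g, symmetric] g(2))
    then show "(\<integral>y. k y * g (x - y) \<partial>lborel) = conv g f x"
      by (simp only: conv_commute[OF fm gm])
  qed auto
  moreover have "(\<integral>y. k y * frechet_derivative g (at (z - y)) v \<partial>lborel) = conv (pd v g) f z" for v
    by (subst conv_commute) (auto simp: loc[of z "pd v g", OF _ g0])
  ultimately show ?thesis by simp
qed

lemma pd_conv:
  assumes "Ck (Suc 0) g" "\<And>y. norm y > R \<Longrightarrow> g y = 0" "ball_integrable f"
  shows "pd v (conv g f) = conv (pd v g) f"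
  using pd_eq[OF conv_has_derivative[OF assms]] by auto

lemma conv_smooth:
  assumes g: "smooth g" "\<And>y. norm y > R \<Longrightarrow> g y = 0" and f: "ball_integrable f"
  shows "smooth (conv g f)"
proof -
  have "Ck k (conv g f)" for k using g
  proof (induction k arbitrary: g)
    case 0
    have "conv g f differentiable (at z)" for z
      using conv_has_derivative[OF smooth_C1[OF 0(1)] 0(2) f] by (auto simp: differentiable_def)
    then show ?case
      by (auto intro!: continuous_at_imp_continuous_on differentiable_imp_continuous_within)
  next
    case (Suc k)
    have "conv g f differentiable (at z)" for z
      using conv_has_derivative[OF smooth_C1[OF Suc(2)] Suc(3) f] by (auto simp: differentiable_def)
    moreover have "Ck k (pd b (conv g f))" if "b \<in> Basis" for b
    proof -
      have eq: "pd b (conv g f) = conv (pd b g) f" by (rule pd_conv[OF smooth_C1[OF Suc(2)] Suc(3) f])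
      have "Ck k (conv (pd b g) f)"
        by (rule Suc.IH[OF smooth_pd[OF Suc(2) that]]) (rule pd_vanish[OF Suc(3)])
      then show ?thesis by (rule eq[THEN ssubst[of _ _ "Ck k"]])
    qed
    ultimately show ?case by simp
  qed
  then show ?thesis by (simp add: smooth_def)
qed

lemma pd_conv_right:
  fixes g f :: "'a::euclidean_space \<Rightarrow> real"
  assumes g: "integrable lborel g" "\<And>y. norm y > R \<Longrightarrow> g y = 0" and f: "Ck (Suc 0) f"
  shows "pd v (conv g f) z = conv g (pd v f) z"
  unfolding conv_def[abs_def] using pd_eq[OF has_derivative_integral_shift[OF g f]] by simp

lemma conv_dilated_aux:
  fixes f k :: "'a::euclidean_space \<Rightarrow> real"
  assumes e: "0 < e" and [measurable]: "f \<in> borel_measurable borel" "k \<in> borel_measurable borel"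
  shows "conv (\<lambda>y. k ((1 / e) *\<^sub>R y) / e ^ DIM('a)) f z = (\<integral>y. k y * f (z - e *\<^sub>R y) \<partial>lborel)"
proof -
  have "(\<integral>y. k ((1 / e) *\<^sub>R y) / e ^ DIM('a) * f (z - y) \<partial>lborel) =
    (\<integral>y. k ((1 / e) *\<^sub>R y) / e ^ DIM('a) * f (z - y) \<partial>density (distr lborel borel (\<lambda>x. 0 + e *\<^sub>R x)) (\<lambda>_. ennreal (\<bar>e\<bar> ^ DIM('a))))"
    using lborel_affine[of e "0 :: 'a"] e by simp
  also have "\<dots> = (\<integral>y. e ^ DIM('a) * (k ((1 / e) *\<^sub>R y) / e ^ DIM('a) * f (z - y)) \<partial>distr lborel borel (\<lambda>x. 0 + e *\<^sub>R x))"
    using e by (subst integral_density) auto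
  also have "\<dots> = (\<integral>y. k y * f (z - e *\<^sub>R y) \<partial>lborel)"
    using e by (subst integral_distr) auto
  finally show ?thesis by (simp add: conv_def)
qed

section \<open>Integration over the torus\<close>

text \<open>
Integration over \<open>\<real> \<times> \<T>\<^sup>d\<close> for lifts. A density, rather than a restriction of the measure, keeps
the Borel sets as measurable sets.
\<close>

definition cell_measure :: "(real \<times> (real ^ 'd)) measure" where
  "cell_measure = density lborel (indicator (UNIV \<times> unit_cell))"

lemma unit_cell_borel [measurable]: "(unit_cell :: (real ^ 'd) set) \<in> sets borel"
  unfolding unit_cell_def by measurable

lemma strip_borel [measurable]: "A \<in> sets borel \<Longrightarrow> A \<times> (unit_cell :: (real ^ 'd) set) \<in> sets borel"
  for A :: "real set"
  by (subst borel_prod[symmetric]) (intro pair_measureI, auto)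

lemma fst_borel [measurable]: "(fst :: 'a::second_countable_topology \<times> 'b::second_countable_topology \<Rightarrow> 'a) \<in> borel \<rightarrow>\<^sub>M borel"
  and snd_borel [measurable]: "(snd :: 'a::second_countable_topology \<times> 'b::second_countable_topology \<Rightarrow> 'b) \<in> borel \<rightarrow>\<^sub>M borel"
  by (intro borel_measurable_continuous_onI continuous_intros)+

lemma sets_cell_measure [simp, measurable_cong]: "sets cell_measure = sets borel"
  by (simp add: cell_measure_def)

lemma space_cell_measure [simp]: "space cell_measure = UNIV"
  by (simp add: cell_measure_def)

lemma nn_integral_cell_measure:
  fixes f :: "real \<times> (real ^ 'd) \<Rightarrow> ennreal"
  assumes "f \<in> borel_measurable borel"
  shows "(\<integral>\<^sup>+z. f z \<partial>cell_measure) = (\<integral>\<^sup>+z. f z * indicator (UNIV \<times> unit_cell) z \<partial>lborel)"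
  unfolding cell_measure_def using assms strip_borel[of UNIV] by (subst nn_integral_density) (auto simp: mult.commute)

lemma sigma_finite_cell_measure: "sigma_finite_measure (cell_measure :: (real \<times> (real ^ 'd)) measure)"
  unfolding cell_measure_def using strip_borel[of UNIV]
  by (subst sigma_finite_measure.sigma_finite_iff_density_finite[OF sigma_finite_lborel]) (auto simp: indicator_def)

interpretation cell_measure: sigma_finite_measure cell_measure
  by (rule sigma_finite_cell_measure)

interpretation LC: pair_sigma_finite lborel cell_measure ..

lemma countable_lattice: "countable (lattice :: (real ^ 'd) set)"
proof -
  have "lattice \<subseteq> range (\<lambda>f :: 'd \<Rightarrow> int. (\<chi> i. of_int (f i)) :: real ^ 'd)"
  proof
    fix k :: "real ^ 'd" assume "k \<in> lattice"
    then have "\<forall>i. \<exists>m :: int. k $ i = of_int m" by (auto simp: lattice_def elim: Ints_cases)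
    then obtain f where "\<forall>i. k $ i = of_int (f i)" by metis
    then have "k = (\<chi> i. of_int (f i))" by (simp add: vec_eq_iff)
    then show "k \<in> range (\<lambda>f :: 'd \<Rightarrow> int. (\<chi> i. of_int (f i)) :: real ^ 'd)" by blast
  qed
  moreover have "countable (range (\<lambda>f :: 'd \<Rightarrow> int. (\<chi> i. of_int (f i)) :: real ^ 'd))" by simp
  ultimately show ?thesis by (rule countable_subset)
qed

definition vfloor :: "real ^ 'd \<Rightarrow> real ^ 'd" where
  "vfloor x = (\<chi> i. of_int \<lfloor>x $ i\<rfloor>)"

lemma vfloor_lattice: "vfloor x \<in> lattice"
  by (simp add: vfloor_def lattice_def)

lemma lattice_minus: "k \<in> lattice \<Longrightarrow> - k \<in> lattice"
  by (simp add: lattice_def)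

lemma cell_iff_vfloor:
  assumes "k \<in> lattice"
  shows "x - k \<in> unit_cell \<longleftrightarrow> k = vfloor x"
proof
  assume "x - k \<in> unit_cell"
  then have *: "k $ i \<le> x $ i" "x $ i < k $ i + 1" for i by (auto simp: unit_cell_def algebra_simps)
  show "k = vfloor x"
    unfolding vec_eq_iff
  proof
    fix i
    from assms obtain m :: int where m: "k $ i = of_int m" by (auto simp: lattice_def elim: Ints_cases)
    have "\<lfloor>x $ i\<rfloor> = m" using *[of i] unfolding m by (intro floor_unique) auto
    then show "k $ i = vfloor x $ i" by (simp add: vfloor_def m)
  qed
next
  assume "k = vfloor x"
  then show "x - k \<in> unit_cell"
    by (simp add: unit_cell_def vfloor_def algebra_simps) linarith
qed

lemma frac_in_cell: "x - vfloor x \<in> unit_cell"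
  using cell_iff_vfloor[OF vfloor_lattice] by blast

text \<open>
The lattice translates of the unit cell form a partition.
\<close>

lemma lattice_sum_cell:
  fixes z :: "real \<times> (real ^ 'd)"
  shows "(\<integral>\<^sup>+k. indicator (UNIV \<times> unit_cell) (z - (0, k)) \<partial>count_space lattice) = (1 :: ennreal)"
    "(\<integral>\<^sup>+k. indicator (UNIV \<times> unit_cell) (z + (0, k)) \<partial>count_space lattice) = (1 :: ennreal)"
proof -
  obtain t x where z: "z = (t, x)" by fastforce
  have "(\<integral>\<^sup>+k. indicator (UNIV \<times> unit_cell) (z - (0, k)) \<partial>count_space lattice) =
    (\<integral>\<^sup>+k. indicator {vfloor x} k \<partial>count_space lattice)"
    by (intro nn_integral_cong) (auto simp: z indicator_def cell_iff_vfloor)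
  also have "\<dots> = 1" using vfloor_lattice[of x] by simp
  finally show "(\<integral>\<^sup>+k. indicator (UNIV \<times> unit_cell) (z - (0, k)) \<partial>count_space lattice) = (1 :: ennreal)" .
  have "(\<integral>\<^sup>+k. indicator (UNIV \<times> unit_cell) (z + (0, k)) \<partial>count_space lattice) =
    (\<integral>\<^sup>+k. indicator {- vfloor x} k \<partial>count_space lattice)"
  proof (intro nn_integral_cong)
    fix k :: "real ^ 'd" assume "k \<in> space (count_space lattice)"
    then have "- k \<in> lattice" using lattice_minus by simp
    from cell_iff_vfloor[OF this, of x] show "indicator (UNIV \<times> unit_cell) (z + (0, k)) = (indicator {- vfloor x} k :: ennreal)"
      by (auto simp: z indicator_def minus_equation_iff[of k])
  qed
  also have "\<dots> = 1" using lattice_minus[OF vfloor_lattice[of x]] by simp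
  finally show "(\<integral>\<^sup>+k. indicator (UNIV \<times> unit_cell) (z + (0, k)) \<partial>count_space lattice) = (1 :: ennreal)" .
qed

lemma nn_integral_translate:
  fixes F :: "'a::euclidean_space \<Rightarrow> ennreal"
  assumes [measurable]: "F \<in> borel_measurable borel"
  shows "(\<integral>\<^sup>+z. F (z + c) \<partial>lborel) = (\<integral>\<^sup>+z. F z \<partial>lborel)"
proof -
  have "(\<integral>\<^sup>+z. F z \<partial>lborel) = (\<integral>\<^sup>+z. F z \<partial>distr lborel borel ((+) c))" by (simp only: lborel_distr_plus)
  also have "\<dots> = (\<integral>\<^sup>+z. F (c + z) \<partial>lborel)" by (rule nn_integral_distr) auto
  finally show ?thesis by (simp add: add.commute)
qed

lemma space_periodicD: "space_periodic f \<Longrightarrow> k \<in> lattice \<Longrightarrow> f (z + (0, k)) = f z"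
  by (cases z) (simp add: space_periodic_def)

lemma space_periodicI: "(\<And>z k. k \<in> lattice \<Longrightarrow> f (z + (0, k)) = f z) \<Longrightarrow> space_periodic f"
  unfolding space_periodic_def
  by (metis add_0_right add_Pair)

text \<open>
Unfolding: insert the partition into translates of the cell, translate each piece back by its
lattice vector, and sum up the translates of the other indicator function.
\<close>

lemma nn_integral_cell_measure_shift:
  fixes F :: "real \<times> (real ^ 'd) \<Rightarrow> ennreal"
  assumes F[measurable]: "F \<in> borel_measurable borel" and per: "space_periodic F"
  shows "(\<integral>\<^sup>+z. F (z + c) \<partial>cell_measure) = (\<integral>\<^sup>+z. F z \<partial>cell_measure)"
proof -
  let ?S = "UNIV \<times> unit_cell :: (real \<times> (real ^ 'd)) set"
  have [measurable]: "?S \<in> sets borel" by (rule strip_borel) simp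
  have "(\<integral>\<^sup>+z. F (z + c) \<partial>cell_measure) = (\<integral>\<^sup>+z. F (z + c) * indicator ?S ((z + c) - c) \<partial>lborel)"
    by (subst nn_integral_cell_measure) auto
  also have "\<dots> = (\<integral>\<^sup>+z. F z * indicator ?S (z - c) \<partial>lborel)"
    by (rule nn_integral_translate[of "\<lambda>z. F z * indicator ?S (z - c)"]) measurable
  also have "\<dots> = (\<integral>\<^sup>+z. \<integral>\<^sup>+k. F z * indicator ?S (z - c) * indicator ?S (z + (0, k)) \<partial>count_space lattice \<partial>lborel)"
    by (intro nn_integral_cong) (simp add: nn_integral_cmult lattice_sum_cell)
  also have "\<dots> = (\<integral>\<^sup>+k. \<integral>\<^sup>+z. F z * indicator ?S (z - c) * indicator ?S (z + (0, k)) \<partial>lborel \<partial>count_space lattice)"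
    by (rule nn_integral_count_space_nn_integral[OF countable_lattice]) measurable
  also have "\<dots> = (\<integral>\<^sup>+k. \<integral>\<^sup>+z. F z * indicator ?S ((z - c) - (0, k)) * indicator ?S z \<partial>lborel \<partial>count_space lattice)"
  proof (rule nn_integral_cong)
    fix k :: "real ^ 'd" assume "k \<in> space (count_space lattice)"
    then have k: "k \<in> lattice" by simp
    have "(\<integral>\<^sup>+z. F z * indicator ?S ((z - c) - (0, k)) * indicator ?S z \<partial>lborel) =
        (\<integral>\<^sup>+z. F (z + (0, k)) * indicator ?S ((z + (0, k) - c) - (0, k)) * indicator ?S (z + (0, k)) \<partial>lborel)"
      by (rule nn_integral_translate[symmetric, of "\<lambda>z. F z * indicator ?S ((z - c) - (0, k)) * indicator ?S z"]) measurable
    also have "\<dots> = (\<integral>\<^sup>+z. F z * indicator ?S (z - c) * indicator ?S (z + (0, k)) \<partial>lborel)"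
    proof (intro nn_integral_cong)
      fix z :: "real \<times> (real ^ 'd)"
      have "z + (0, k) - c - (0, k) = z - c" by (simp add: algebra_simps)
      then show "F (z + (0, k)) * indicator ?S ((z + (0, k) - c) - (0, k)) * indicator ?S (z + (0, k)) = F z * indicator ?S (z - c) * indicator ?S (z + (0, k))"
        by (simp only: space_periodicD[OF per k])
    qed
    finally show "(\<integral>\<^sup>+z. F z * indicator ?S (z - c) * indicator ?S (z + (0, k)) \<partial>lborel) =
        (\<integral>\<^sup>+z. F z * indicator ?S ((z - c) - (0, k)) * indicator ?S z \<partial>lborel)" ..
  qed
  also have "\<dots> = (\<integral>\<^sup>+z. \<integral>\<^sup>+k. F z * indicator ?S ((z - c) - (0, k)) * indicator ?S z \<partial>count_space lattice \<partial>lborel)"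
    by (rule nn_integral_count_space_nn_integral[OF countable_lattice, symmetric]) measurable
  also have "\<dots> = (\<integral>\<^sup>+z. F z * indicator ?S z \<partial>lborel)"
    by (intro nn_integral_cong) (simp add: nn_integral_cmult nn_integral_multc lattice_sum_cell)
  also have "\<dots> = (\<integral>\<^sup>+z. F z \<partial>cell_measure)" by (subst nn_integral_cell_measure) auto
  finally show ?thesis .
qed

lemma integral_cell_measure_shift:
  fixes f :: "real \<times> (real ^ 'd) \<Rightarrow> real"
  assumes f[measurable]: "f \<in> borel_measurable borel" and per: "space_periodic f"
  shows "(\<integral>z. f (z + c) \<partial>cell_measure) = (\<integral>z. f z \<partial>cell_measure)"
proof -
  have nn: "(\<integral>\<^sup>+z. ennreal (h (f (z + c))) \<partial>cell_measure) = (\<integral>\<^sup>+z. ennreal (h (f z)) \<partial>cell_measure)"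
    if [measurable]: "h \<in> borel_measurable borel" for h
  proof (rule nn_integral_cell_measure_shift[of "\<lambda>z. ennreal (h (f z))"])
    show "space_periodic (\<lambda>z. ennreal (h (f z)))"
      by (rule space_periodicI) (simp only: space_periodicD[OF per])
  qed measurable
  have int: "integrable cell_measure (\<lambda>z. f (z + c)) \<longleftrightarrow> integrable cell_measure f"
    unfolding integrable_iff_bounded using nn[of norm] by auto
  show "(\<integral>z. f (z + c) \<partial>cell_measure) = (\<integral>z. f z \<partial>cell_measure)"
  proof (cases "integrable cell_measure f")
    case True
    then show ?thesis using int nn[of "\<lambda>x. x"] nn[of uminus] by (simp add: real_lebesgue_integral_def)
  next
    case False
    then show ?thesis using int by (simp add: not_integrable_integral_eq)
  qed
qed

definition strip_integrable :: "(real \<times> (real ^ 'd) \<Rightarrow> real) \<Rightarrow> bool" where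
  "strip_integrable f \<longleftrightarrow> f \<in> borel_measurable borel \<and> space_periodic f \<and>
     (\<forall>a b. integrable cell_measure (\<lambda>z. indicator {a..b} (fst z) * f z))"

lemma strip_integrableD:
  assumes "strip_integrable f"
  shows "f \<in> borel_measurable borel" "space_periodic f" "integrable cell_measure (\<lambda>z. indicator {a..b} (fst z) * f z)"
  using assms by (auto simp: strip_integrable_def)

lemma finite_lattice_box: "finite {k \<in> (lattice :: (real ^ 'd) set). \<forall>i. \<bar>k $ i\<bar> \<le> m}"
proof (rule finite_subset)
  show "{k \<in> (lattice :: (real ^ 'd) set). \<forall>i. \<bar>k $ i\<bar> \<le> m} \<subseteq>
    (\<lambda>f. \<chi> i. of_int (f i)) ` (PiE UNIV (\<lambda>_. {- \<lceil>m\<rceil> .. \<lceil>m\<rceil>}))"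
  proof
    fix k assume k: "k \<in> {k \<in> (lattice :: (real ^ 'd) set). \<forall>i. \<bar>k $ i\<bar> \<le> m}"
    then have "\<forall>i. k $ i \<in> \<int>" by (simp add: lattice_def)
    then have "\<forall>i. \<exists>m :: int. k $ i = of_int m" by (meson Ints_cases)
    then obtain f :: "'d \<Rightarrow> int" where f: "\<And>i. k $ i = of_int (f i)" by metis
    have "f i \<in> {- \<lceil>m\<rceil> .. \<lceil>m\<rceil>}" for i
    proof -
      have "\<bar>k $ i\<bar> \<le> m" using k by simp
      then have "\<bar>real_of_int (f i)\<bar> \<le> m" by (simp only: f)
      then show ?thesis by (simp add: abs_le_iff le_ceiling_iff) linarith
    qed
    moreover have "k = (\<chi> i. of_int (f i))" by (simp add: vec_eq_iff f)
    ultimately show "k \<in> (\<lambda>f. \<chi> i. of_int (f i)) ` (PiE UNIV (\<lambda>_. {- \<lceil>m\<rceil> .. \<lceil>m\<rceil>}))" by auto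
  qed
  show "finite ((\<lambda>f. (\<chi> i. of_int (f i)) :: real ^ 'd) ` (PiE UNIV (\<lambda>_. {- \<lceil>m\<rceil> .. \<lceil>m\<rceil>})))"
    by (intro finite_imageI finite_PiE) auto
qed

text \<open>
A ball is covered by finitely many translates of the cell, and the integral over each of them is
the same.
\<close>

lemma strip_integrable_ball:
  fixes f :: "real \<times> (real ^ 'd) \<Rightarrow> real"
  assumes f: "strip_integrable f"
  shows "ball_integrable f"
  unfolding ball_integrable_def
proof (intro conjI allI)
  show m[measurable]: "f \<in> borel_measurable borel" by (rule strip_integrableD[OF f])
  fix r :: real
  let ?S = "UNIV \<times> unit_cell :: (real \<times> (real ^ 'd)) set"
  have [measurable]: "?S \<in> sets borel" by (rule strip_borel) simp
  define G where "G z = ennreal \<bar>indicator {-r..r} (fst z) * f z\<bar>" for z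
  have Gm[measurable]: "G \<in> borel_measurable borel" unfolding G_def by measurable
  have Gp: "G (z + (0, k)) = G z" if "k \<in> lattice" for z k
    by (simp add: G_def space_periodicD[OF strip_integrableD(2)[OF f] that])
  have fin: "(\<integral>\<^sup>+z. G z * indicator ?S z \<partial>lborel) < \<infinity>"
    using strip_integrableD(3)[OF f, of "-r" r]
    unfolding integrable_iff_bounded by (simp add: nn_integral_cell_measure[symmetric] G_def[abs_def])
  define K where "K = {k \<in> (lattice :: (real ^ 'd) set). \<forall>i. \<bar>k $ i\<bar> \<le> r + 1}"
  have K: "finite K" unfolding K_def by (rule finite_lattice_box)
  have "(\<integral>\<^sup>+z. ennreal \<bar>indicator (cball 0 r) z * f z\<bar> \<partial>lborel) \<le> (\<integral>\<^sup>+z. (\<Sum>k\<in>K. G z * indicator ?S (z - (0, k))) \<partial>lborel)"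
  proof (rule nn_integral_mono)
    fix z :: "real \<times> (real ^ 'd)"
    obtain t x where z: "z = (t, x)" by fastforce
    show "ennreal \<bar>indicator (cball 0 r) z * f z\<bar> \<le> (\<Sum>k\<in>K. G z * indicator ?S (z - (0, k)))"
    proof (cases "norm z \<le> r")
      case True
      have t: "\<bar>t\<bar> \<le> r" using True norm_fst_le[of t x] by (simp add: z)
      have x: "\<bar>x $ i\<bar> \<le> r" for i
        using True norm_snd_le[of x t] component_le_norm_cart[of x i] by (simp add: z)
      have kK: "vfloor x \<in> K" unfolding K_def
      proof (intro CollectI conjI allI vfloor_lattice)
        fix i
        have "of_int \<lfloor>x $ i\<rfloor> \<le> x $ i" "x $ i < of_int \<lfloor>x $ i\<rfloor> + 1" by linarith+
        then show "\<bar>vfloor x $ i\<bar> \<le> r + 1" using x[of i] by (simp add: vfloor_def abs_le_iff) linarith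
      qed
      have "ennreal \<bar>indicator (cball 0 r) z * f z\<bar> = G z * indicator ?S (z - (0, vfloor x))"
        using t True frac_in_cell[of x] by (auto simp: G_def z indicator_def abs_le_iff)
      also have "\<dots> \<le> (\<Sum>k\<in>K. G z * indicator ?S (z - (0, k)))"
        using K kK by (intro member_le_sum) auto
      finally show ?thesis .
    qed (auto simp: indicator_def)
  qed
  also have "\<dots> = (\<Sum>k\<in>K. \<integral>\<^sup>+z. G z * indicator ?S (z - (0, k)) \<partial>lborel)"
    by (rule nn_integral_sum) measurable
  also have "\<dots> = (\<Sum>k\<in>K. \<integral>\<^sup>+z. G z * indicator ?S z \<partial>lborel)"
  proof (rule sum.cong[OF refl])
    fix k assume "k \<in> K"
    then have k: "k \<in> lattice" by (simp add: K_def)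
    have "(\<integral>\<^sup>+z. G z * indicator ?S (z - (0, k)) \<partial>lborel) = (\<integral>\<^sup>+z. G (z + (0, k)) * indicator ?S ((z + (0, k)) - (0, k)) \<partial>lborel)"
      by (rule nn_integral_translate[symmetric, of "\<lambda>z. G z * indicator ?S (z - (0, k))"]) measurable
    then show "(\<integral>\<^sup>+z. G z * indicator ?S (z - (0, k)) \<partial>lborel) = (\<integral>\<^sup>+z. G z * indicator ?S z \<partial>lborel)"
      by (simp add: Gp[OF k])
  qed
  also have "\<dots> < \<infinity>" using fin K by (simp add: ennreal_mult_less_top top.not_eq_extremum ennreal_of_nat_eq_real_of_nat)
  finally show "integrable lborel (\<lambda>w. indicator (cball 0 r) w * f w)"
    unfolding integrable_iff_bounded by (auto intro!: borel_measurable_times borel_measurable_indicator m)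
qed

definition time_supported :: "real \<Rightarrow> real \<Rightarrow> (real \<times> (real ^ 'd) \<Rightarrow> real) \<Rightarrow> bool" where
  "time_supported a b f \<longleftrightarrow> (\<forall>t x. t \<notin> {a..b} \<longrightarrow> f (t, x) = 0)"

lemma periodic_bounded:
  fixes f :: "real \<times> (real ^ 'd) \<Rightarrow> real"
  assumes c: "continuous_on UNIV f" and per: "space_periodic f" and s: "time_supported a b f"
  obtains B where "0 \<le> B" "\<And>z. \<bar>f z\<bar> \<le> B"
proof -
  have "compact ({a..b} \<times> cbox (0 :: real ^ 'd) 1)" by (intro compact_Times) auto
  then have "bounded (f ` ({a..b} \<times> cbox (0 :: real ^ 'd) 1))"
    by (intro compact_imp_bounded compact_continuous_image continuous_on_subset[OF c]) auto
  then obtain B where B: "\<forall>y\<in>f ` ({a..b} \<times> cbox (0 :: real ^ 'd) 1). norm y \<le> B" unfolding bounded_iff by blast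
  have "\<bar>f z\<bar> \<le> \<bar>B\<bar>" for z
  proof -
    obtain t x where z: "z = (t, x)" by fastforce
    show ?thesis
    proof (cases "t \<in> {a..b}")
      case True
      have "x - vfloor x \<in> cbox 0 1" using frac_in_cell[of x]
        by (auto simp: unit_cell_def mem_box_cart less_imp_le)
      then have "norm (f (t, x - vfloor x)) \<le> B" using B True by blast
      moreover have "f (t, x - vfloor x) = f z"
        using space_periodicD[OF per vfloor_lattice[of x], of "(t, x - vfloor x)"] by (simp add: z)
      ultimately show ?thesis by simp
    qed (use s in \<open>auto simp: time_supported_def z\<close>)
  qed
  then show thesis using that[of "\<bar>B\<bar>"] by simp
qed

lemma strip_integrable_mult_test:
  fixes w f :: "real \<times> (real ^ 'd) \<Rightarrow> real"
  assumes w: "strip_integrable w" and c: "continuous_on UNIV f" and per: "space_periodic f" and s: "time_supported a b f"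
  shows "integrable cell_measure (\<lambda>z. w z * f z)"
proof -
  obtain B where B: "0 \<le> B" "\<And>z. \<bar>f z\<bar> \<le> B" by (rule periodic_bounded[OF c per s]) blast
  have [measurable]: "w \<in> borel_measurable borel" "f \<in> borel_measurable borel"
    using strip_integrableD(1)[OF w] c by (auto intro: borel_measurable_continuous_onI)
  show ?thesis
  proof (rule Bochner_Integration.integrable_bound[of _ "\<lambda>z. B * (indicator {a..b} (fst z) * w z)"])
    show "AE z in cell_measure. norm (w z * f z) \<le> norm (B * (indicator {a..b} (fst z) * w z))"
    proof (rule AE_I2)
      fix z :: "real \<times> (real ^ 'd)"
      obtain t x where z: "z = (t, x)" by fastforce
      have "\<bar>w z\<bar> * \<bar>f z\<bar> \<le> \<bar>w z\<bar> * B" using B by (intro mult_left_mono) auto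
      then show "norm (w z * f z) \<le> norm (B * (indicator {a..b} (fst z) * w z))"
        using s B by (cases "t \<in> {a..b}") (auto simp: z time_supported_def abs_mult mult.commute)
    qed
  qed (use strip_integrableD(3)[OF w] in auto)
qed

text \<open>
Fubini's theorem and the translation invariance of the integral over the torus.
\<close>

lemma conv_adjoint:
  fixes w f g :: "real \<times> (real ^ 'd) \<Rightarrow> real"
  assumes w: "strip_integrable w" and f: "continuous_on UNIV f" "space_periodic f" "time_supported a b f"
    and g: "continuous_on UNIV g" "\<And>y. norm y > R \<Longrightarrow> g y = 0"
  shows "(\<integral>z. w z * conv g f z \<partial>cell_measure) = (\<integral>z. conv (\<lambda>y. g (- y)) w z * f z \<partial>cell_measure)"
proof -
  have [measurable]: "w \<in> borel_measurable borel" "f \<in> borel_measurable borel" "g \<in> borel_measurable borel"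
    using strip_integrableD(1)[OF w] f g by (auto intro: borel_measurable_continuous_onI)
  obtain B where B: "0 \<le> B" "\<And>z. \<bar>f z\<bar> \<le> B" by (rule periodic_bounded[OF f]) blast
  have ig: "integrable lborel (\<lambda>y. indicator (cball 0 R) y * g y)"
    by (rule integrable_compact_mult[of _ R, OF _ _ g(1)]) (auto intro!: integrable_real_indicator emeasure_bounded_finite)
  have gi: "indicator (cball 0 R) y * g y = g y" for y using g(2)[of y] by (auto simp: indicator_def)
  have ig: "integrable lborel g" using ig unfolding gi .
  define W where "W z = indicator {a - R..b + R} (fst z) * w z" for z
  have [measurable]: "W \<in> borel_measurable borel" unfolding W_def by measurable
  have iW: "integrable cell_measure W" unfolding W_def by (rule strip_integrableD[OF w])
  have perwf: "space_periodic (\<lambda>z. w z * f (z - y))" for y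
  proof (rule space_periodicI)
    fix z and k :: "real ^ 'd" assume k: "k \<in> lattice"
    have "z + (0, k) - y = (z - y) + (0, k)" by simp
    then show "w (z + (0, k)) * f (z + (0, k) - y) = w z * f (z - y)"
      by (simp only: space_periodicD[OF f(2) k] space_periodicD[OF strip_integrableD(2)[OF w] k])
  qed
  define H where "H p = g (fst p) * (w (snd p) * f (snd p - fst p))" for p
  define H2 where "H2 p = g (fst p) * (w (snd p + fst p) * f (snd p))" for p
  have [measurable]: "H \<in> borel_measurable (lborel \<Otimes>\<^sub>M cell_measure)" unfolding H_def by measurable
  have [measurable]: "H2 \<in> borel_measurable (lborel \<Otimes>\<^sub>M cell_measure)" unfolding H2_def by measurable
  have nnz: "(\<integral>\<^sup>+z. ennreal \<bar>w (z + y) * f z\<bar> \<partial>cell_measure) = (\<integral>\<^sup>+z. ennreal \<bar>w z * f (z - y)\<bar> \<partial>cell_measure)" for y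
  proof -
    have "(\<integral>\<^sup>+z. ennreal \<bar>w (z + y) * f (z + y - y)\<bar> \<partial>cell_measure) = (\<integral>\<^sup>+z. ennreal \<bar>w z * f (z - y)\<bar> \<partial>cell_measure)"
      using perwf[of y] by (intro nn_integral_cell_measure_shift[of "\<lambda>z. ennreal \<bar>w z * f (z - y)\<bar>"])
        (auto simp: space_periodic_def)
    then show ?thesis by simp
  qed
  have "(\<integral>\<^sup>+p. ennreal \<bar>H p\<bar> \<partial>(lborel \<Otimes>\<^sub>M cell_measure)) = (\<integral>\<^sup>+y. \<integral>\<^sup>+z. ennreal \<bar>H (y, z)\<bar> \<partial>cell_measure \<partial>lborel)"
    by (rule cell_measure.nn_integral_fst[symmetric]) measurable
  also have "\<dots> \<le> (\<integral>\<^sup>+y. \<integral>\<^sup>+z. ennreal \<bar>g y\<bar> * (ennreal B * ennreal \<bar>W z\<bar>) \<partial>cell_measure \<partial>lborel)"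
  proof (intro nn_integral_mono)
    fix y z :: "real \<times> (real ^ 'd)"
    obtain t x where z: "z = (t, x)" by fastforce
    show "ennreal \<bar>H (y, z)\<bar> \<le> ennreal \<bar>g y\<bar> * (ennreal B * ennreal \<bar>W z\<bar>)"
    proof (cases "g y = 0 \<or> f (z - y) = 0")
      case False
      then have "norm y \<le> R" using g(2)[of y] by force
      then have "\<bar>fst y\<bar> \<le> R" using norm_fst_le[of "fst y" "snd y"] by simp
      moreover have "t - fst y \<in> {a..b}" using False f(3) unfolding time_supported_def z by (cases y) auto
      ultimately have "W z = w z" by (auto simp: W_def z indicator_def)
      moreover have "\<bar>g y\<bar> * (\<bar>w z\<bar> * \<bar>f (z - y)\<bar>) \<le> \<bar>g y\<bar> * (\<bar>w z\<bar> * B)"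
        using B by (intro mult_left_mono) auto
      ultimately show ?thesis using B
        by (simp add: H_def abs_mult ennreal_mult[symmetric] mult.commute mult.left_commute)
    qed (auto simp: H_def)
  qed
  also have "\<dots> = (\<integral>\<^sup>+y. ennreal \<bar>g y\<bar> \<partial>lborel) * (ennreal B * (\<integral>\<^sup>+z. ennreal \<bar>W z\<bar> \<partial>cell_measure))"
    by (simp add: nn_integral_cmult nn_integral_multc)
  also have "\<dots> < \<infinity>"
    using ig iW by (auto simp: integrable_iff_bounded ennreal_mult_less_top)
  finally have fin: "(\<integral>\<^sup>+p. ennreal \<bar>H p\<bar> \<partial>(lborel \<Otimes>\<^sub>M cell_measure)) < \<infinity>" .
  then have iH: "integrable (lborel \<Otimes>\<^sub>M cell_measure) H" by (simp add: integrable_iff_bounded)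
  have "(\<integral>\<^sup>+p. ennreal \<bar>H2 p\<bar> \<partial>(lborel \<Otimes>\<^sub>M cell_measure)) = (\<integral>\<^sup>+y. \<integral>\<^sup>+z. ennreal \<bar>H2 (y, z)\<bar> \<partial>cell_measure \<partial>lborel)"
    by (rule cell_measure.nn_integral_fst[symmetric]) measurable
  also have "\<dots> = (\<integral>\<^sup>+y. \<integral>\<^sup>+z. ennreal \<bar>H (y, z)\<bar> \<partial>cell_measure \<partial>lborel)"
  proof (rule nn_integral_cong)
    fix y
    have "(\<integral>\<^sup>+z. ennreal \<bar>H2 (y, z)\<bar> \<partial>cell_measure) = ennreal \<bar>g y\<bar> * (\<integral>\<^sup>+z. ennreal \<bar>w (z + y) * f z\<bar> \<partial>cell_measure)"
      by (subst nn_integral_cmult[symmetric]) (auto simp: H2_def abs_mult[of "g y"] ennreal_mult intro!: nn_integral_cong)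
    also have "\<dots> = (\<integral>\<^sup>+z. ennreal \<bar>H (y, z)\<bar> \<partial>cell_measure)"
      unfolding nnz by (subst nn_integral_cmult[symmetric]) (auto simp: H_def abs_mult[of "g y"] ennreal_mult intro!: nn_integral_cong)
    finally show "(\<integral>\<^sup>+z. ennreal \<bar>H2 (y, z)\<bar> \<partial>cell_measure) = (\<integral>\<^sup>+z. ennreal \<bar>H (y, z)\<bar> \<partial>cell_measure)" .
  qed
  also have "\<dots> = (\<integral>\<^sup>+p. ennreal \<bar>H p\<bar> \<partial>(lborel \<Otimes>\<^sub>M cell_measure))"
    by (rule cell_measure.nn_integral_fst) measurable
  finally have iH2: "integrable (lborel \<Otimes>\<^sub>M cell_measure) H2" using fin by (simp add: integrable_iff_bounded)
  have "(\<integral>z. w z * conv g f z \<partial>cell_measure) = (\<integral>z. (\<integral>y. H (y, z) \<partial>lborel) \<partial>cell_measure)"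
    unfolding conv_def H_def by (simp add: mult.left_commute flip: integral_mult_right_zero)
  also have "\<dots> = (\<integral>y. (\<integral>z. H (y, z) \<partial>cell_measure) \<partial>lborel)"
    by (rule LC.Fubini_integral) (use iH in simp)
  also have "\<dots> = (\<integral>y. (\<integral>z. H2 (y, z) \<partial>cell_measure) \<partial>lborel)"
  proof (rule Bochner_Integration.integral_cong[OF refl])
    fix y
    have "(\<integral>z. w (z + y) * f (z + y - y) \<partial>cell_measure) = (\<integral>z. w z * f (z - y) \<partial>cell_measure)"
      using perwf[of y] by (intro integral_cell_measure_shift[of "\<lambda>z. w z * f (z - y)"]) auto
    then show "(\<integral>z. H (y, z) \<partial>cell_measure) = (\<integral>z. H2 (y, z) \<partial>cell_measure)" by (simp add: H_def H2_def)
  qed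
  also have "\<dots> = (\<integral>z. (\<integral>y. H2 (y, z) \<partial>lborel) \<partial>cell_measure)"
    by (rule LC.Fubini_integral[symmetric]) (use iH2 in simp)
  also have "\<dots> = (\<integral>z. conv (\<lambda>y. g (- y)) w z * f z \<partial>cell_measure)"
  proof (rule Bochner_Integration.integral_cong[OF refl])
    fix z
    have "(\<integral>y. H2 (y, z) \<partial>lborel) = (\<integral>y. g y * w (z + y) \<partial>lborel) * f z"
      by (simp add: H2_def mult.assoc[symmetric])
    also have "(\<integral>y. g y * w (z + y) \<partial>lborel) = (\<integral>y. g (0 - y) * w (z + (0 - y)) \<partial>lborel)"
      by (rule integral_reflect[symmetric]) measurable
    also have "\<dots> = conv (\<lambda>y. g (- y)) w z" by (simp add: conv_def)
    finally show "(\<integral>y. H2 (y, z) \<partial>lborel) = conv (\<lambda>y. g (- y)) w z * f z" .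
  qed
  finally show ?thesis .
qed


definition testable :: "real \<Rightarrow> real \<Rightarrow> (real \<times> (real ^ 'd) \<Rightarrow> real) \<Rightarrow> bool" where
  "testable a b f \<longleftrightarrow> Ck (Suc 0) f \<and> space_periodic f \<and> time_supported a b f"

lemma time_supportedD: "time_supported a b f \<Longrightarrow> fst z \<notin> {a..b} \<Longrightarrow> f z = 0"
  by (cases z) (auto simp: time_supported_def)

lemma pd_continuous: "Ck (Suc 0) f \<Longrightarrow> continuous_on UNIV (pd b f)"
  unfolding gradient(2) by (intro continuous_intros gradient(3))

lemma pd_periodic:
  fixes f :: "real \<times> (real ^ 'd) \<Rightarrow> real"
  assumes f: "Ck (Suc 0) f" "space_periodic f"
  shows "space_periodic (pd b f)"
proof (rule space_periodicI)
  fix z and k :: "real ^ 'd" assume k: "k \<in> lattice"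
  have "((\<lambda>y. f (y + (0, k))) has_derivative frechet_derivative f (at (z + (0, k)))) (at z)"
    by (rule has_derivative_compose[where f = "\<lambda>y. y + (0, k)" and g = f, OF _ C1_derivative[OF f(1)]])
      (auto intro!: derivative_eq_intros)
  moreover have "(\<lambda>y. f (y + (0, k))) = f" by (rule ext) (rule space_periodicD[OF f(2) k])
  ultimately show "pd b f (z + (0, k)) = pd b f z" using pd_eq[of f _ z b] by simp
qed

lemma pd_time_supported:
  fixes f :: "real \<times> (real ^ 'd) \<Rightarrow> real"
  assumes "time_supported a b f"
  shows "time_supported a b (pd c f)"
  unfolding time_supported_def
proof (intro allI impI)
  fix t :: real and x :: "real ^ 'd" assume t: "t \<notin> {a..b}"
  have "((\<lambda>_. 0) has_derivative (\<lambda>_. 0)) (at (t, x))" by simp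
  then have "(f has_derivative (\<lambda>_. 0)) (at (t, x))"
  proof (rule has_derivative_transform_within_open[of _ _ _ _ "(- {a..b}) \<times> UNIV"])
    show "open ((- {a..b}) \<times> (UNIV :: (real ^ 'd) set))" by (intro open_Times) auto
  qed (use t assms in \<open>auto simp: time_supported_def\<close>)
  then show "pd c f (t, x) = 0" by (rule pd_eq)
qed

lemma conv_periodic:
  fixes f g :: "real \<times> (real ^ 'd) \<Rightarrow> real"
  assumes "space_periodic f"
  shows "space_periodic (conv g f)"
proof (rule space_periodicI)
  fix z :: "real \<times> (real ^ 'd)" and k :: "real ^ 'd" assume k: "k \<in> lattice"
  have "z + (0, k) - y = (z - y) + (0, k)" for y by simp
  then show "conv g f (z + (0, k)) = conv g f z"
    unfolding conv_def by (simp only: space_periodicD[OF assms k])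
qed

lemma conv_time_supported:
  fixes f g :: "real \<times> (real ^ 'd) \<Rightarrow> real"
  assumes f: "time_supported a b f" and g: "\<And>y. norm y > R \<Longrightarrow> g y = 0"
  shows "time_supported (a - R) (b + R) (conv g f)"
  unfolding time_supported_def
proof (intro allI impI)
  fix t :: real and x :: "real ^ 'd" assume t: "t \<notin> {a - R..b + R}"
  have "g y * f ((t, x) - y) = 0" for y
  proof (cases "norm y > R")
    case False
    then have "\<bar>fst y\<bar> \<le> R" using norm_fst_le[of "fst y" "snd y"] by simp
    then have "fst ((t, x) - y) \<notin> {a..b}" using t by auto
    then show ?thesis using time_supportedD[OF f] by simp
  qed (simp add: g)
  then have "(\<lambda>y. g y * f ((t, x) - y)) = (\<lambda>_. 0)" by (rule ext)
  then show "conv g f (t, x) = 0" unfolding conv_def by simp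
qed

lemma bounded_unit_cell: "bounded (unit_cell :: (real ^ 'd) set)"
proof -
  have "(unit_cell :: (real ^ 'd) set) \<subseteq> cbox 0 1" by (auto simp: unit_cell_def mem_box_cart less_imp_le)
  then show ?thesis using bounded_cbox bounded_subset by blast
qed

lemma emeasure_strip:
  fixes a b :: real
  shows "emeasure lborel ({a..b} \<times> (unit_cell :: (real ^ 'd) set)) < \<infinity>"
  by (intro emeasure_bounded_finite bounded_Times bounded_unit_cell bounded_closed_interval)

lemma strip_integrable_bounded:
  fixes f :: "real \<times> (real ^ 'd) \<Rightarrow> real"
  assumes [measurable]: "f \<in> borel_measurable borel" and "space_periodic f" and B: "\<And>z. \<bar>f z\<bar> \<le> B"
  shows "strip_integrable f"
  unfolding strip_integrable_def
proof (intro conjI allI assms)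
  fix a b
  have "(\<integral>\<^sup>+z. ennreal (norm (indicator {a..b} (fst z) * f z)) \<partial>cell_measure) \<le> (\<integral>\<^sup>+z. ennreal B * indicator ({a..b} \<times> (unit_cell :: (real ^ 'd) set)) z \<partial>lborel)"
  proof (subst nn_integral_cell_measure, measurable, rule nn_integral_mono)
    fix z :: "real \<times> (real ^ 'd)"
    show "ennreal (norm (indicator {a..b} (fst z) * f z)) * indicator (UNIV \<times> unit_cell) z \<le> ennreal B * indicator ({a..b} \<times> unit_cell) z"
      using B[of z] by (cases z) (auto simp: indicator_def intro: ennreal_leI)
  qed
  also have "\<dots> < \<infinity>"
    using emeasure_strip[of a b] by (subst nn_integral_cmult_indicator) (auto simp: ennreal_mult_less_top intro: strip_borel)
  finally show "integrable cell_measure (\<lambda>z. indicator {a..b} (fst z) * f z)"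
    unfolding integrable_iff_bounded by simp
qed

lemma mollifierD:
  assumes "mollifier \<eta>"
  shows "smooth \<eta>" "\<And>y. norm y > 1 \<Longrightarrow> \<eta> y = 0" "\<And>y. \<eta> (- y) = \<eta> y" "(\<integral>y. \<eta> y \<partial>lborel) = 1" "\<And>y. 0 \<le> \<eta> y"
    "continuous_on UNIV \<eta>" "integrable lborel \<eta>" "\<eta> \<in> borel_measurable borel"
proof -
  show 1: "smooth \<eta>" and "\<And>y. \<eta> (- y) = \<eta> y" "\<And>y. 0 \<le> \<eta> y" and 4: "(\<integral>y. \<eta> y \<partial>lborel) = 1" 
    using assms unfolding mollifier_def by (blast, metis norm_minus_cancel, blast, blast)
  show "\<eta> y = 0" if "norm y > 1" for y using assms that unfolding mollifier_def by (meson less_imp_le)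
  show c: "continuous_on UNIV \<eta>" using C1_continuous[OF smooth_C1[OF 1]] .
  show "integrable lborel \<eta>" using 4 by (metis not_integrable_integral_eq zero_neq_one)
  show "\<eta> \<in> borel_measurable borel" using c by (rule borel_measurable_continuous_onI)
qed

text \<open>
Integration by parts on the torus. With \<open>\<eta>\<close> of integral \<open>1\<close>, the integral of \<open>\<partial>f\<close> equals that of
\<open>\<eta> * \<partial>f = (\<partial>\<eta>) * f\<close>, and moving the kernel to the other factor \<open>1\<close> leaves
\<open>(\<partial>\<eta>) * 1 = \<partial>(\<eta> * 1) = 0\<close>.
\<close>

lemma integral_pd_zero:
  fixes \<eta> f :: "real \<times> (real ^ 'd) \<Rightarrow> real"
  assumes m: "mollifier \<eta>" and f: "testable a b f"
  shows "(\<integral>z. pd c f z \<partial>cell_measure) = 0"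
proof -
  note \<eta> = mollifierD[OF m]
  have f': "Ck (Suc 0) f" "space_periodic f" "time_supported a b f" using f by (auto simp: testable_def)
  have one: "strip_integrable ((\<lambda>_. 1) :: real \<times> (real ^ 'd) \<Rightarrow> real)"
    by (rule strip_integrable_bounded[of _ 1]) (auto simp: space_periodic_def)
  have one_b: "ball_integrable ((\<lambda>_. 1) :: real \<times> (real ^ 'd) \<Rightarrow> real)" using one by (rule strip_integrable_ball)
  have c1: "conv \<eta> (\<lambda>_. 1) z = 1" for z using \<eta>(4) by (simp add: conv_def)
  have "pd c (conv \<eta> (\<lambda>_. 1)) = conv (pd c \<eta>) (\<lambda>_. 1)"
    by (rule pd_conv[OF smooth_C1[OF \<eta>(1)] \<eta>(2) one_b])
  moreover have "conv \<eta> (\<lambda>_. 1) = (\<lambda>_. 1)" using c1 by auto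
  ultimately have d1: "conv (pd c \<eta>) (\<lambda>_. 1) z = 0" for z by (metis frechet_derivative_const)
  have r: "conv (\<lambda>y. g (- y)) (\<lambda>_. 1) z = conv g (\<lambda>_. 1) z" if [measurable]: "g \<in> borel_measurable borel" for g :: "real \<times> (real ^ 'd) \<Rightarrow> real" and z
    unfolding conv_def using integral_reflect[of g 0] by simp
  have pm: "pd c \<eta> \<in> borel_measurable borel"
    by (rule borel_measurable_continuous_onI[OF pd_continuous[OF smooth_C1[OF \<eta>(1)]]])
  have pdf: "continuous_on UNIV (pd c f)" "space_periodic (pd c f)" "time_supported a b (pd c f)"
    using f' by (auto intro: pd_continuous pd_periodic pd_time_supported)
  have fb: "ball_integrable f"
  proof -
    obtain B where "\<And>z. \<bar>f z\<bar> \<le> B" by (rule periodic_bounded[OF C1_continuous[OF f'(1)] f'(2,3)]) blast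
    then have "strip_integrable f"
      using borel_measurable_continuous_onI[OF C1_continuous[OF f'(1)]] f'(2) by (intro strip_integrable_bounded)
    then show ?thesis by (rule strip_integrable_ball)
  qed
  have "(\<integral>z. pd c f z \<partial>cell_measure) = (\<integral>z. conv (\<lambda>y. \<eta> (- y)) (\<lambda>_. 1) z * pd c f z \<partial>cell_measure)"
    by (simp add: r[OF \<eta>(8)] c1)
  also have "\<dots> = (\<integral>z. 1 * conv \<eta> (pd c f) z \<partial>cell_measure)"
    by (rule conv_adjoint[OF one pdf \<eta>(6,2), symmetric])
  also have "conv \<eta> (pd c f) = conv (pd c \<eta>) f"
  proof
    fix z show "conv \<eta> (pd c f) z = conv (pd c \<eta>) f z"
      using pd_conv_right[OF \<eta>(7,2) f'(1), where v = c and z = z] pd_conv[OF smooth_C1[OF \<eta>(1)] \<eta>(2) fb, where v = c] by metis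
  qed
  also have "(\<integral>z. 1 * conv (pd c \<eta>) f z \<partial>cell_measure) = (\<integral>z. conv (\<lambda>y. pd c \<eta> (- y)) (\<lambda>_. 1) z * f z \<partial>cell_measure)"
    by (rule conv_adjoint[OF one C1_continuous[OF f'(1)] f'(2,3) pd_continuous[OF smooth_C1[OF \<eta>(1)]] pd_vanish[OF \<eta>(2)]])
  also have "\<dots> = 0" by (simp add: r[OF pm] d1)
  finally show ?thesis .
qed

definition balance :: "real \<Rightarrow> (real \<times> (real ^ 'd) \<Rightarrow> real) \<Rightarrow> ('d \<Rightarrow> real \<times> (real ^ 'd) \<Rightarrow> real) \<Rightarrow> bool" where
  "balance T w F \<longleftrightarrow> (\<forall>\<phi>. test_function T \<phi> \<longrightarrow>
     (\<integral>z. w z * pd (1, 0) \<phi> z + (\<Sum>i\<in>UNIV. F i z * pd (0, axis i 1) \<phi> z) \<partial>cell_measure) = 0)"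

text \<open>
For \<open>\<psi>\<close> of class \<open>C\<^sup>1\<close> the convolution with \<open>g\<close> is an admissible test function, since it is smooth
and the margin \<open>R\<close> in time keeps its support inside \<open>(0, T)\<close>. Its derivatives are convolutions of
the derivatives of \<open>\<psi>\<close>, and the even kernel can be moved to \<open>w\<close> and \<open>F\<close>.
\<close>

lemma mollified_balance:
  fixes g \<psi> w :: "real \<times> (real ^ 'd) \<Rightarrow> real" and F :: "'d \<Rightarrow> real \<times> (real ^ 'd) \<Rightarrow> real"
  assumes bal: "balance T w F" and w: "strip_integrable w" and F: "\<And>i. strip_integrable (F i)"
    and g: "smooth g" "\<And>y. norm y > R \<Longrightarrow> g y = 0" "\<And>y. g (- y) = g y"
    and \<psi>: "testable a b \<psi>" and ab: "0 < a - R" "b + R < T"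
  shows "(\<integral>z. conv g w z * pd (1, 0) \<psi> z + (\<Sum>i\<in>UNIV. conv g (F i) z * pd (0, axis i 1) \<psi> z) \<partial>cell_measure) = 0"
proof -
  have \<psi>': "Ck (Suc 0) \<psi>" "space_periodic \<psi>" "time_supported a b \<psi>" using \<psi> by (auto simp: testable_def)
  have gc: "continuous_on UNIV g" by (rule C1_continuous[OF smooth_C1[OF g(1)]])
  have gi: "integrable lborel g"
  proof -
    have "(\<lambda>y. indicator (cball 0 R) y * g y) = g" using g(2) by (auto simp: indicator_def fun_eq_iff)
    moreover have "integrable lborel (\<lambda>y. indicator (cball 0 R) y * g y)"
      by (rule integrable_compact_mult[of _ R, OF _ _ gc]) (auto intro!: integrable_real_indicator emeasure_bounded_finite)
    ultimately show ?thesis by simp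
  qed
  have \<psi>b: "ball_integrable \<psi>"
  proof -
    obtain B where "\<And>z. \<bar>\<psi> z\<bar> \<le> B" by (rule periodic_bounded[OF C1_continuous[OF \<psi>'(1)] \<psi>'(2,3)]) blast
    then have "strip_integrable \<psi>"
      using borel_measurable_continuous_onI[OF C1_continuous[OF \<psi>'(1)]] \<psi>'(2) by (intro strip_integrable_bounded)
    then show ?thesis by (rule strip_integrable_ball)
  qed
  have sm: "smooth (conv g \<psi>)" by (rule conv_smooth[OF g(1,2) \<psi>b])
  have per: "space_periodic (conv g \<psi>)" by (rule conv_periodic[OF \<psi>'(2)])
  have supp: "time_supported (a - R) (b + R) (conv g \<psi>)" by (rule conv_time_supported[OF \<psi>'(3) g(2)])
  have test: "test_function T (conv g \<psi>)"
    unfolding test_function_def using sm per supp ab unfolding time_supported_def by blast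
  have pdc: "pd c (conv g \<psi>) z = conv g (pd c \<psi>) z" for c z
    by (rule pd_conv_right[OF gi g(2) \<psi>'(1)])
  have pd\<psi>: "continuous_on UNIV (pd c \<psi>)" "space_periodic (pd c \<psi>)" "time_supported a b (pd c \<psi>)" for c
    using \<psi>' by (auto intro: pd_continuous pd_periodic pd_time_supported)
  have int1: "integrable cell_measure (\<lambda>z. v z * pd c (conv g \<psi>) z)" if "strip_integrable v" for v c
    by (rule strip_integrable_mult_test[OF that pd_continuous[OF smooth_C1[OF sm]] pd_periodic[OF smooth_C1[OF sm] per] pd_time_supported[OF supp]])
  have adj: "(\<integral>z. v z * pd c (conv g \<psi>) z \<partial>cell_measure) = (\<integral>z. conv g v z * pd c \<psi> z \<partial>cell_measure)" if "strip_integrable v" for v c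
    using conv_adjoint[OF that pd\<psi>[of c] gc g(2)] unfolding pdc g(3) by simp
  have int2: "integrable cell_measure (\<lambda>z. conv g v z * pd c \<psi> z)" if v: "strip_integrable v" for v c
  proof -
    have cc: "continuous_on UNIV (conv g v)"
      using conv_smooth[OF g(1,2) strip_integrable_ball[OF v]] smooth_C1 C1_continuous by blast
    have "integrable cell_measure (\<lambda>z. 1 * (conv g v z * pd c \<psi> z))"
    proof (rule strip_integrable_mult_test)
      show "strip_integrable (\<lambda>_. 1 :: real)"
        by (rule strip_integrable_bounded[of _ 1]) (auto simp: space_periodic_def)
      show "continuous_on UNIV (\<lambda>z. conv g v z * pd c \<psi> z)" by (intro continuous_intros cc pd\<psi>)
      show "space_periodic (\<lambda>z. conv g v z * pd c \<psi> z)"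
        by (rule space_periodicI) (simp only: space_periodicD[OF conv_periodic[OF strip_integrableD(2)[OF v]]] space_periodicD[OF pd\<psi>(2)])
      show "time_supported a b (\<lambda>z. conv g v z * pd c \<psi> z)"
        using pd\<psi>(3)[of c] by (auto simp: time_supported_def)
    qed
    then show ?thesis by simp
  qed
  have "(\<integral>z. conv g w z * pd (1, 0) \<psi> z + (\<Sum>i\<in>UNIV. conv g (F i) z * pd (0, axis i 1) \<psi> z) \<partial>cell_measure)
    = (\<integral>z. conv g w z * pd (1, 0) \<psi> z \<partial>cell_measure) + (\<Sum>i\<in>UNIV. \<integral>z. conv g (F i) z * pd (0, axis i 1) \<psi> z \<partial>cell_measure)"
    using int2[OF w] int2[OF F] by simp
  also have "\<dots> = (\<integral>z. w z * pd (1, 0) (conv g \<psi>) z \<partial>cell_measure) + (\<Sum>i\<in>UNIV. \<integral>z. F i z * pd (0, axis i 1) (conv g \<psi>) z \<partial>cell_measure)"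
    by (simp only: adj[OF w] adj[OF F])
  also have "\<dots> = (\<integral>z. w z * pd (1, 0) (conv g \<psi>) z + (\<Sum>i\<in>UNIV. F i z * pd (0, axis i 1) (conv g \<psi>) z) \<partial>cell_measure)"
    using int1[OF w] int1[OF F] by simp
  also have "\<dots> = 0" using bal test unfolding balance_def by blast
  finally show ?thesis .
qed

section \<open>Size of mollification errors and commutators\<close>

definition ball_measure :: "'a::euclidean_space measure" where
  "ball_measure = density lborel (indicator (cball 0 1))"

definition strip_measure :: "real \<Rightarrow> real \<Rightarrow> (real \<times> (real ^ 'd)) measure" where
  "strip_measure a b = density lborel (indicator ({a..b} \<times> unit_cell))"

lemma sets_ball_measure [simp, measurable_cong]: "sets ball_measure = sets borel"
  by (simp add: ball_measure_def)

lemma space_ball_measure [simp]: "space ball_measure = UNIV"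
  by (simp add: ball_measure_def)

lemma sets_strip_measure [simp, measurable_cong]: "sets (strip_measure a b) = sets borel"
  by (simp add: strip_measure_def)

lemma space_strip_measure [simp]: "space (strip_measure a b) = UNIV"
  by (simp add: strip_measure_def)

lemma finite_ball_measure: "finite_measure (ball_measure :: 'a::euclidean_space measure)"
proof (rule finite_measureI)
  have "emeasure (ball_measure :: 'a measure) (space ball_measure) = emeasure lborel (cball (0 :: 'a) 1)"
    unfolding ball_measure_def by (subst emeasure_density) (auto intro!: borel_measurable_indicator)
  then show "emeasure (ball_measure :: 'a measure) (space ball_measure) \<noteq> \<infinity>"
    using emeasure_lborel_cball_finite[of "0 :: 'a" 1] by simp
qed

lemma finite_strip_measure: "finite_measure (strip_measure a b :: (real \<times> (real ^ 'd)) measure)"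
proof (rule finite_measureI)
  have "emeasure (strip_measure a b :: (real \<times> (real ^ 'd)) measure) (space (strip_measure a b)) = emeasure lborel ({a..b} \<times> (unit_cell :: (real ^ 'd) set))"
    unfolding strip_measure_def using strip_borel[of "{a..b}"] by (subst emeasure_density) auto
  then show "emeasure (strip_measure a b :: (real \<times> (real ^ 'd)) measure) (space (strip_measure a b)) \<noteq> \<infinity>"
    using emeasure_strip[of a b] by (metis less_irrefl)
qed

lemma sigma_finite_strip_measure: "sigma_finite_measure (strip_measure a b)"
  using finite_strip_measure by (rule finite_measure.axioms)

lemma integral_ball_measure:
  fixes k D :: "'a::euclidean_space \<Rightarrow> real"
  assumes "\<And>y. norm y > 1 \<Longrightarrow> k y = 0" and [measurable]: "k \<in> borel_measurable borel" "D \<in> borel_measurable borel"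
  shows "(\<integral>y. k y * D y \<partial>ball_measure) = (\<integral>y. k y * D y \<partial>lborel)"
proof -
  have "(\<integral>y. k y * D y \<partial>ball_measure) = (\<integral>y. indicator (cball 0 1) y *\<^sub>R (k y * D y) \<partial>lborel)"
  proof -
    have eq: "(ball_measure :: 'a measure) = density lborel (\<lambda>y. ennreal (indicator (cball 0 1) y))"
      by (simp add: ball_measure_def ennreal_indicator)
    show ?thesis unfolding eq by (rule integral_density) (auto intro!: borel_measurable_indicator)
  qed
  also have "\<dots> = (\<integral>y. k y * D y \<partial>lborel)"
    using assms(1) by (intro Bochner_Integration.integral_cong) (auto simp: indicator_def)
  finally show ?thesis .
qed

lemma integrable_dilated:
  fixes f k :: "'a::euclidean_space \<Rightarrow> real"
  assumes f: "ball_integrable f" and k: "continuous_on UNIV k" "\<And>y. norm y > 1 \<Longrightarrow> k y = 0" and e: "0 < e"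
  shows "integrable lborel (\<lambda>y. k y * f (z - e *\<^sub>R y))"
proof -
  define r where "r = norm z + e"
  define h where "h w = indicator (cball 0 r) w * f w" for w
  have ih: "integrable lborel h" using f by (simp add: ball_integrable_def h_def[abs_def])
  have [measurable]: "f \<in> borel_measurable borel" "k \<in> borel_measurable borel"
    using f k by (auto simp: ball_integrable_def intro: borel_measurable_continuous_onI)
  have hm[measurable]: "h \<in> borel_measurable borel" using ih by auto
  have "integrable (density (distr lborel borel (\<lambda>x. z + (- e) *\<^sub>R x)) (\<lambda>_. ennreal (\<bar>- e\<bar> ^ DIM('a)))) h"
    using ih lborel_affine[of "- e" z] e by simp
  then have "integrable (distr lborel borel (\<lambda>x. z + (- e) *\<^sub>R x)) (\<lambda>x. e ^ DIM('a) * h x)"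
    using e by (subst (asm) integrable_density) auto
  then have "integrable lborel (\<lambda>x. e ^ DIM('a) * h (z + (- e) *\<^sub>R x))"
    by (subst (asm) integrable_distr_eq) auto
  then have i: "integrable lborel (\<lambda>y. h (z - e *\<^sub>R y))" using e by simp
  obtain B where B: "0 \<le> B" "\<And>x. x \<in> cball 0 1 \<Longrightarrow> norm (k x) \<le> B"
    by (rule continuous_bounded_on_cball[OF k(1), of 1]) blast
  show ?thesis
  proof (rule Bochner_Integration.integrable_bound[of _ "\<lambda>y. B * h (z - e *\<^sub>R y)"])
    show "AE y in lborel. norm (k y * f (z - e *\<^sub>R y)) \<le> norm (B * h (z - e *\<^sub>R y))"
    proof (rule AE_I2)
      fix y :: 'a
      show "norm (k y * f (z - e *\<^sub>R y)) \<le> norm (B * h (z - e *\<^sub>R y))"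
      proof (cases "norm y > 1")
        case False
        have "norm (z - e *\<^sub>R y) \<le> norm z + e * norm y" using norm_triangle_ineq4[of z "e *\<^sub>R y"] e by simp
        also have "\<dots> \<le> r" unfolding r_def using False e by simp
        finally have "h (z - e *\<^sub>R y) = f (z - e *\<^sub>R y)" by (simp add: h_def)
        moreover have "\<bar>k y\<bar> \<le> B" using B(2)[of y] False by simp
        ultimately show ?thesis using B by (simp add: abs_mult mult_right_mono)
      qed (simp add: k)
    qed
  qed (use i in auto)
qed

text \<open>
The mollifier \<open>k\<^sup>e\<close> of the customary notation.
\<close>

definition dilated :: "('a::euclidean_space \<Rightarrow> real) \<Rightarrow> real \<Rightarrow> 'a \<Rightarrow> real" where
  "dilated k e y = k ((1 / e) *\<^sub>R y) / e ^ DIM('a)"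

lemma conv_dilated:
  assumes "0 < e" "f \<in> borel_measurable borel" "k \<in> borel_measurable borel"
  shows "conv (dilated k e) f z = (\<integral>y. k y * f (z - e *\<^sub>R y) \<partial>lborel)"
  using conv_dilated_aux[OF assms] unfolding dilated_def[abs_def] .

lemma dilated_mollifier:
  fixes \<eta> :: "real \<times> (real ^ 'd) \<Rightarrow> real"
  assumes m: "mollifier \<eta>" and e: "0 < e"
  shows "smooth (dilated \<eta> e)" "\<And>y. norm y > e \<Longrightarrow> dilated \<eta> e y = 0" "\<And>y. dilated \<eta> e (- y) = dilated \<eta> e y"
    "pd c (dilated \<eta> e) = (\<lambda>y. (1 / e) * dilated (pd c \<eta>) e y)"
proof -
  note \<eta> = mollifierD[OF m]
  have eq: "dilated \<eta> e = (\<lambda>y. (1 / e ^ DIM(real \<times> (real ^ 'd))) * \<eta> ((1 / e) *\<^sub>R y))" by (auto simp: dilated_def)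
  show "smooth (dilated \<eta> e)" unfolding eq by (rule smooth_scale[OF \<eta>(1)])
  show "dilated \<eta> e y = 0" if "norm y > e" for y
    using \<eta>(2)[of "(1 / e) *\<^sub>R y"] that e by (simp add: dilated_def)
  show "dilated \<eta> e (- y) = dilated \<eta> e y" for y using \<eta>(3)[of "(1 / e) *\<^sub>R y"] by (simp add: dilated_def)
  show "pd c (dilated \<eta> e) = (\<lambda>y. (1 / e) * dilated (pd c \<eta>) e y)"
  proof
    fix y
    have "((\<lambda>y. (1 / e ^ DIM(real \<times> (real ^ 'd))) * \<eta> ((1 / e) *\<^sub>R y)) has_derivative
       (\<lambda>h. (1 / e ^ DIM(real \<times> (real ^ 'd))) * ((1 / e) * frechet_derivative \<eta> (at ((1 / e) *\<^sub>R y)) h))) (at y)"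
      by (rule pd_scale[OF C1_differentiable[OF smooth_C1[OF \<eta>(1)]]])
    from pd_eq[OF this, of c] show "pd c (dilated \<eta> e) y = (1 / e) * dilated (pd c \<eta>) e y"
      unfolding eq[symmetric] by (simp add: dilated_def)
  qed
qed

text \<open>
The regularity information on \<open>f\<close> in the form in which it is used: increments in the direction \<open>y\<close>,
as functions of \<open>(z, y)\<close> with \<open>y\<close> in the unit ball, have size \<open>e\<^sup>s\<close>.
\<close>

definition increment_order :: "real \<Rightarrow> real \<Rightarrow> real \<Rightarrow> real \<Rightarrow> real \<Rightarrow> (real \<times> (real ^ 'd) \<Rightarrow> real) \<Rightarrow> bool" where
  "increment_order a b e0 \<theta> s f \<longleftrightarrow> Lp_order (strip_measure a b \<Otimes>\<^sub>M ball_measure) e0 \<theta> s (\<lambda>e p. f (fst p - e *\<^sub>R snd p) - f (fst p))"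

context
  fixes \<eta> :: "real \<times> (real ^ 'd) \<Rightarrow> real" and a b e0 :: real
  assumes \<eta>: "mollifier \<eta>" and e0: "e0 \<le> 1"
begin

lemma bounded_kernel:
  fixes k :: "'a::euclidean_space \<Rightarrow> real"
  assumes "continuous_on UNIV k" "\<And>y. norm y > 1 \<Longrightarrow> k y = 0"
  shows "\<exists>B. \<forall>y. \<bar>k y\<bar> \<le> B"
proof -
  obtain B where B: "0 \<le> B" "\<And>x. x \<in> cball 0 1 \<Longrightarrow> norm (k x) \<le> B"
    by (rule continuous_bounded_on_cball[OF assms(1), of 1]) blast
  have "\<bar>k y\<bar> \<le> B" for y using B assms(2)[of y] by (cases "norm y > 1") auto
  then show ?thesis by blast
qed

lemma Lp_order_ball_average:
  fixes k :: "real \<times> (real ^ 'd) \<Rightarrow> real"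
  assumes D: "Lp_order (strip_measure a b \<Otimes>\<^sub>M ball_measure) e0 \<theta> s D" and \<theta>: "0 \<le> \<theta>" "\<theta> \<le> 1"
    and k: "continuous_on UNIV k" "\<And>y. norm y > 1 \<Longrightarrow> k y = 0"
    and m: "\<And>e z. (\<lambda>y. D e (z, y)) \<in> borel_measurable borel"
  shows "Lp_order (strip_measure a b) e0 \<theta> s (\<lambda>e z. \<integral>y. k y * D e (z, y) \<partial>lborel)"
proof -
  obtain B where B: "\<And>y. \<bar>k y\<bar> \<le> B" using bounded_kernel[OF k] by blast
  have "Lp_order (strip_measure a b) e0 \<theta> s (\<lambda>e z. \<integral>y. k y * D e (z, y) \<partial>ball_measure)"
    by (rule Lp_order_average[OF D sigma_finite_strip_measure finite_ball_measure \<theta> B])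
  moreover have "(\<integral>y. k y * D e (z, y) \<partial>ball_measure) = (\<integral>y. k y * D e (z, y) \<partial>lborel)" for e z
    by (rule integral_ball_measure[OF k(2) borel_measurable_continuous_onI[OF k(1)] m])
  ultimately show ?thesis by simp
qed

lemma increment_measurable:
  "f \<in> borel_measurable borel \<Longrightarrow> (\<lambda>y. f (fst (z, y) - e *\<^sub>R snd (z, y)) - f (fst (z, y))) \<in> borel_measurable borel"
  for f :: "real \<times> (real ^ 'd) \<Rightarrow> real"
  by simp

lemma mollification_error_eq:
  assumes f: "ball_integrable f" and e: "0 < e"
  shows "conv (dilated \<eta> e) f z - f z = (\<integral>y. \<eta> y * (f (z - e *\<^sub>R y) - f z) \<partial>lborel)"
proof -
  note m = mollifierD[OF \<eta>]
  have "(\<integral>y. \<eta> y * (f (z - e *\<^sub>R y) - f z) \<partial>lborel) = (\<integral>y. \<eta> y * f (z - e *\<^sub>R y) \<partial>lborel) - (\<integral>y. \<eta> y * f z \<partial>lborel)"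
    unfolding right_diff_distrib
    by (rule Bochner_Integration.integral_diff) (use integrable_dilated[OF f m(6,2) e] m(7) in auto)
  then show ?thesis
    using m(4) conv_dilated[OF e _ m(8), of f z] f by (simp add: ball_integrable_def)
qed

lemma Lp_order_mollification_error:
  assumes f: "ball_integrable f" and inc: "increment_order a b e0 \<theta> s f" and \<theta>: "0 \<le> \<theta>" "\<theta> \<le> 1"
  shows "Lp_order (strip_measure a b) e0 \<theta> s (\<lambda>e z. conv (dilated \<eta> e) f z - f z)"
proof -
  note m = mollifierD[OF \<eta>]
  have fm: "f \<in> borel_measurable borel" using f by (simp add: ball_integrable_def)
  have "Lp_order (strip_measure a b) e0 \<theta> s (\<lambda>e z. \<integral>y. \<eta> y * (f (fst (z, y) - e *\<^sub>R snd (z, y)) - f (fst (z, y))) \<partial>lborel)"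
    by (rule Lp_order_ball_average[OF inc[unfolded increment_order_def] \<theta> m(6,2) increment_measurable[OF fm]])
  then show ?thesis
    by (rule Lp_order_cong[OF _ e0]) (simp add: mollification_error_eq[OF f])
qed

text \<open>
Since the derivative of the kernel has integral \<open>0\<close>, the function \<open>f\<close> can be replaced by its increment; the
scaling of the kernel costs a factor \<open>1 / e\<close>.
\<close>

lemma Lp_order_pd_mollification:
  assumes f: "ball_integrable f" and inc: "increment_order a b e0 \<theta> s f" and \<theta>: "0 \<le> \<theta>" "\<theta> \<le> 1"
  shows "Lp_order (strip_measure a b) e0 \<theta> (s - 1) (\<lambda>e z. pd c (conv (dilated \<eta> e) f) z)"
proof -
  note m = mollifierD[OF \<eta>]
  have fm: "f \<in> borel_measurable borel" using f by (simp add: ball_integrable_def)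
  have C: "Ck (Suc 0) \<eta>" by (rule smooth_C1[OF m(1)])
  have k: "continuous_on UNIV (pd c \<eta>)" "\<And>y. norm y > 1 \<Longrightarrow> pd c \<eta> y = 0"
    by (rule pd_continuous[OF C]) (rule pd_vanish[OF m(2)])
  have km: "pd c \<eta> \<in> borel_measurable borel" by (rule borel_measurable_continuous_onI[OF k(1)])
  obtain B where B: "\<And>y. \<bar>pd c \<eta> y\<bar> \<le> B" using bounded_kernel[OF k] by blast
  have one: "ball_integrable (\<lambda>_ :: real \<times> (real ^ 'd). 1 :: real)"
    unfolding ball_integrable_def by (auto intro!: integrable_real_indicator emeasure_bounded_finite)
  have ki: "integrable lborel (pd c \<eta>)"
    using integrable_dilated[OF one k, of 1] by simp
  have k0: "(\<integral>y. pd c \<eta> y \<partial>lborel) = 0"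
  proof -
    have "pd c (conv \<eta> (\<lambda>_. 1)) = conv (pd c \<eta>) (\<lambda>_. 1)" by (rule pd_conv[OF C m(2) one])
    moreover have "conv \<eta> (\<lambda>_. 1) = (\<lambda>_. 1)" using m(4) by (simp add: conv_def fun_eq_iff)
    ultimately have "conv (pd c \<eta>) (\<lambda>_. 1) 0 = 0" by (metis frechet_derivative_const)
    then show ?thesis by (simp add: conv_def)
  qed
  have eq: "pd c (conv (dilated \<eta> e) f) z = (1 / e) * (\<integral>y. pd c \<eta> y * (f (z - e *\<^sub>R y) - f z) \<partial>lborel)" if e: "0 < e" for e z
  proof -
    have "pd c (conv (dilated \<eta> e) f) = conv (pd c (dilated \<eta> e)) f"
      by (rule pd_conv[OF smooth_C1[OF dilated_mollifier(1)[OF \<eta> e]] dilated_mollifier(2)[OF \<eta> e] f])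
    also have "pd c (dilated \<eta> e) = (\<lambda>y. (1 / e) * dilated (pd c \<eta>) e y)" by (rule dilated_mollifier(4)[OF \<eta> e])
    finally have "pd c (conv (dilated \<eta> e) f) z = conv (\<lambda>y. (1 / e) * dilated (pd c \<eta>) e y) f z"
      by (rule fun_cong)
    also have "\<dots> = (1 / e) * conv (dilated (pd c \<eta>) e) f z"
      by (simp add: conv_def)
    also have "conv (dilated (pd c \<eta>) e) f z = (\<integral>y. pd c \<eta> y * f (z - e *\<^sub>R y) \<partial>lborel)"
      by (rule conv_dilated[OF e fm km])
    also have "\<dots> = (\<integral>y. pd c \<eta> y * (f (z - e *\<^sub>R y) - f z) \<partial>lborel)"
      unfolding right_diff_distrib
      by (subst Bochner_Integration.integral_diff) (use integrable_dilated[OF f k e] ki k0 in auto)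
    finally show ?thesis .
  qed
  have "Lp_order (strip_measure a b) e0 \<theta> s (\<lambda>e z. \<integral>y. pd c \<eta> y * (f (fst (z, y) - e *\<^sub>R snd (z, y)) - f (fst (z, y))) \<partial>lborel)"
    by (rule Lp_order_ball_average[OF inc[unfolded increment_order_def] \<theta> k increment_measurable[OF fm]])
  moreover have "Lp_order (strip_measure a b) e0 0 (- 1) (\<lambda>e z. 1 / e)"
    by (rule Lp_order_bounded[where C = 1]) (simp add: powr_minus_divide)
  ultimately have "Lp_order (strip_measure a b) e0 (0 + \<theta>) (- 1 + s) (\<lambda>e z. (1 / e) * (\<integral>y. pd c \<eta> y * (f (fst (z, y) - e *\<^sub>R snd (z, y)) - f (fst (z, y))) \<partial>lborel))"
    using \<theta> by (intro Lp_order_mult) auto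
  then have "Lp_order (strip_measure a b) e0 \<theta> (s - 1) (\<lambda>e z. (1 / e) * (\<integral>y. pd c \<eta> y * (f (fst (z, y) - e *\<^sub>R snd (z, y)) - f (fst (z, y))) \<partial>lborel))"
    by simp
  then show ?thesis by (rule Lp_order_cong[OF _ e0]) (simp add: eq)
qed

text \<open>
With \<open>\<delta>f = f(z - e y) - f(z)\<close> the commutator equals the average of \<open>\<delta>f \<delta>g\<close> minus the product of the
averages of \<open>\<delta>f\<close> and of \<open>\<delta>g\<close> (the identity of Constantin, E and Titi).
\<close>

lemma Lp_order_commutator:
  assumes f: "ball_integrable f" "increment_order a b e0 \<theta> s f" and g: "ball_integrable g" "increment_order a b e0 \<kappa> t g"
    and fg: "ball_integrable (\<lambda>z. f z * g z)"
    and \<theta>: "0 \<le> \<theta>" "0 \<le> \<kappa>" "\<theta> + \<kappa> \<le> 1"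
  shows "Lp_order (strip_measure a b) e0 (\<theta> + \<kappa>) (s + t)
    (\<lambda>e z. conv (dilated \<eta> e) (\<lambda>z. f z * g z) z - conv (dilated \<eta> e) f z * conv (dilated \<eta> e) g z)"
proof -
  note m = mollifierD[OF \<eta>]
  have [measurable]: "f \<in> borel_measurable borel" "g \<in> borel_measurable borel" using f g by (auto simp: ball_integrable_def)
  let ?D = "\<lambda>e p. (f (fst p - e *\<^sub>R snd p) - f (fst p)) * (g (fst p - e *\<^sub>R snd p) - g (fst p))"
  have "Lp_order (strip_measure a b \<Otimes>\<^sub>M ball_measure) e0 (\<theta> + \<kappa>) (s + t) ?D"
    using f(2) g(2) \<theta> unfolding increment_order_def by (intro Lp_order_mult)
  then have A: "Lp_order (strip_measure a b) e0 (\<theta> + \<kappa>) (s + t) (\<lambda>e z. \<integral>y. \<eta> y * ?D e (z, y) \<partial>lborel)"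
    by (rule Lp_order_ball_average) (use \<theta> m in auto)
  have B: "Lp_order (strip_measure a b) e0 (\<theta> + \<kappa>) (s + t) (\<lambda>e z. (conv (dilated \<eta> e) f z - f z) * (conv (dilated \<eta> e) g z - g z))"
    using \<theta> by (intro Lp_order_mult Lp_order_mollification_error f g) auto
  have C: "Lp_order (strip_measure a b) e0 (\<theta> + \<kappa>) (s + t) (\<lambda>e z. (\<integral>y. \<eta> y * ?D e (z, y) \<partial>lborel) - (conv (dilated \<eta> e) f z - f z) * (conv (dilated \<eta> e) g z - g z))"
    using \<theta> by (intro Lp_order_diff A B e0) auto
  show ?thesis
  proof (rule Lp_order_cong[OF C e0], rule AE_I2)
    fix e z assume e: "0 < e" "e < e0"
    note i = integrable_dilated[OF f(1) m(6,2) e(1), of z] integrable_dilated[OF g(1) m(6,2) e(1), of z]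
      integrable_dilated[OF fg m(6,2) e(1), of z]
    have "(\<integral>y. \<eta> y * ?D e (z, y) \<partial>lborel) = (\<integral>y. \<eta> y * (f (z - e *\<^sub>R y) * g (z - e *\<^sub>R y)) - f z * (\<eta> y * g (z - e *\<^sub>R y))
        - g z * (\<eta> y * f (z - e *\<^sub>R y)) + (f z * g z) * \<eta> y \<partial>lborel)"
      by (intro Bochner_Integration.integral_cong refl) (simp add: algebra_simps)
    also have "\<dots> = conv (dilated \<eta> e) (\<lambda>z. f z * g z) z - f z * conv (dilated \<eta> e) g z - g z * conv (dilated \<eta> e) f z + f z * g z"
      using i m(4,7) conv_dilated[OF e(1) _ m(8), of _ z] by (simp add: integrable_mult_right)
    finally show "conv (dilated \<eta> e) (\<lambda>z. f z * g z) z - conv (dilated \<eta> e) f z * conv (dilated \<eta> e) g z =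
       (\<integral>y. \<eta> y * ?D e (z, y) \<partial>lborel) - (conv (dilated \<eta> e) f z - f z) * (conv (dilated \<eta> e) g z - g z)"
      by (simp add: algebra_simps)
  qed
qed

lemma conv_in_interval:
  assumes f: "ball_integrable f" "\<And>z. f z \<in> {l..h}" and e: "0 < e"
  shows "conv (dilated \<eta> e) f z \<in> {l..h}"
proof -
  note m = mollifierD[OF \<eta>]
  have eq: "conv (dilated \<eta> e) f z = (\<integral>y. \<eta> y * f (z - e *\<^sub>R y) \<partial>lborel)"
    using conv_dilated[OF e _ m(8)] f by (simp add: ball_integrable_def)
  have "(\<integral>y. \<eta> y * l \<partial>lborel) \<le> (\<integral>y. \<eta> y * f (z - e *\<^sub>R y) \<partial>lborel)"
  proof (rule integral_mono)
    fix y
    show "\<eta> y * l \<le> \<eta> y * f (z - e *\<^sub>R y)"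
      using f(2)[of "z - e *\<^sub>R y"] m(5)[of y] by (intro mult_left_mono) auto
  qed (use integrable_dilated[OF f(1) m(6,2) e] m(7) in auto)
  moreover have "(\<integral>y. \<eta> y * f (z - e *\<^sub>R y) \<partial>lborel) \<le> (\<integral>y. \<eta> y * h \<partial>lborel)"
  proof (rule integral_mono)
    fix y
    show "\<eta> y * f (z - e *\<^sub>R y) \<le> \<eta> y * h"
      using f(2)[of "z - e *\<^sub>R y"] m(5)[of y] by (intro mult_left_mono) auto
  qed (use integrable_dilated[OF f(1) m(6,2) e] m(7) in auto)
  ultimately show ?thesis using m(4) eq by simp
qed

text \<open>
Taylor's formula at the value \<open>\<rho>\<^sup>e(z)\<close>: the linear term has average \<open>0\<close>, and the remainder is a power
\<open>\<gamma>\<close> of the difference between \<open>\<rho>(z - e y)\<close> and \<open>\<rho>\<^sup>e(z)\<close>.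
\<close>

lemma Lp_order_pressure_commutator:
  assumes \<rho>: "ball_integrable \<rho>" "increment_order a b e0 \<kappa> s \<rho>" "\<And>z. \<rho> z \<in> {l..h}" and p\<rho>: "ball_integrable (\<lambda>z. p (\<rho> z))"
    and \<kappa>: "0 \<le> \<kappa>" "0 \<le> \<gamma>" "\<gamma> * \<kappa> \<le> 1" "\<kappa> \<le> 1"
    and taylor: "\<And>s t. s \<in> {l..h} \<Longrightarrow> t \<in> {l..h} \<Longrightarrow> \<bar>p s - p t - p' t * (s - t)\<bar> \<le> C * \<bar>s - t\<bar> powr \<gamma>" and C: "0 \<le> C"
  shows "Lp_order (strip_measure a b) e0 (\<gamma> * \<kappa>) (\<gamma> * s) (\<lambda>e z. conv (dilated \<eta> e) (\<lambda>z. p (\<rho> z)) z - p (conv (dilated \<eta> e) \<rho> z))"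
proof -
  note m = mollifierD[OF \<eta>]
  have [measurable]: "\<rho> \<in> borel_measurable borel" using \<rho>(1) by (simp add: ball_integrable_def)
  let ?R = "\<lambda>e. conv (dilated \<eta> e) \<rho>"
  have "Lp_order (strip_measure a b \<Otimes>\<^sub>M ball_measure) e0 \<kappa> s (\<lambda>e (z, y). ?R e z - \<rho> z)"
    by (rule Lp_order_pull[OF Lp_order_mollification_error[OF \<rho>(1,2) \<kappa>(1,4)] sigma_finite_strip_measure finite_ball_measure])
  then have "Lp_order (strip_measure a b \<Otimes>\<^sub>M ball_measure) e0 \<kappa> s (\<lambda>e p. (\<rho> (fst p - e *\<^sub>R snd p) - \<rho> (fst p)) - (case p of (z, y) \<Rightarrow> ?R e z - \<rho> z))"
    by (rule Lp_order_diff[OF \<rho>(2)[unfolded increment_order_def] _ \<kappa>(1) e0])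
  then have "Lp_order (strip_measure a b \<Otimes>\<^sub>M ball_measure) e0 \<kappa> s (\<lambda>e p. \<rho> (fst p - e *\<^sub>R snd p) - ?R e (fst p))"
    by (rule Lp_order_cong[OF _ e0]) auto
  from Lp_order_powr[OF this \<kappa>(2)]
  have "Lp_order (strip_measure a b \<Otimes>\<^sub>M ball_measure) e0 (\<gamma> * \<kappa>) (\<gamma> * s) (\<lambda>e p. \<bar>\<rho> (fst p - e *\<^sub>R snd p) - ?R e (fst p)\<bar> powr \<gamma>)" .
  then have T: "Lp_order (strip_measure a b) e0 (\<gamma> * \<kappa>) (\<gamma> * s) (\<lambda>e z. \<integral>y. \<eta> y * (\<bar>\<rho> (fst (z, y) - e *\<^sub>R snd (z, y)) - ?R e (fst (z, y))\<bar> powr \<gamma>) \<partial>lborel)"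
    by (rule Lp_order_ball_average) (use \<kappa> m in auto)
  show ?thesis
  proof (rule Lp_order_mono[OF T C e0 order_refl order_refl], rule AE_I2)
    fix e z assume e: "0 < e" "e < e0"
    have R: "?R e z \<in> {l..h}" by (rule conv_in_interval[OF \<rho>(1,3) e(1)])
    note i = integrable_dilated[OF \<rho>(1) m(6,2) e(1), of z] integrable_dilated[OF p\<rho> m(6,2) e(1), of z]
    let ?d = "\<lambda>y. \<rho> (z - e *\<^sub>R y) - ?R e z"
    have pm[measurable]: "(\<lambda>z. p (\<rho> z)) \<in> borel_measurable borel" using p\<rho> by (simp add: ball_integrable_def)
    have [measurable]: "\<eta> \<in> borel_measurable borel" by (rule m)
    define M where "M = \<bar>h - l\<bar> powr \<gamma>"
    have dM: "\<bar>?d y\<bar> powr \<gamma> \<le> M" for y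
      unfolding M_def using \<rho>(3)[of "z - e *\<^sub>R y"] R \<kappa> by (intro powr_mono2) auto
    have id: "integrable lborel (\<lambda>y. \<eta> y * (\<bar>?d y\<bar> powr \<gamma>))"
    proof (rule Bochner_Integration.integrable_bound[of _ "\<lambda>y. M * \<eta> y"])
      show "AE y in lborel. norm (\<eta> y * (\<bar>?d y\<bar> powr \<gamma>)) \<le> norm (M * \<eta> y)"
      proof (rule AE_I2)
        fix y
        have "\<eta> y * (\<bar>?d y\<bar> powr \<gamma>) \<le> \<eta> y * M" by (rule mult_left_mono[OF dM m(5)])
        then show "norm (\<eta> y * (\<bar>?d y\<bar> powr \<gamma>)) \<le> norm (M * \<eta> y)"
          using m(5)[of y] by (simp add: abs_mult M_def mult.commute)
      qed
    qed (use m in auto)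
    have e1: "(\<integral>y. \<eta> y * (p (\<rho> (z - e *\<^sub>R y)) - p (?R e z) - p' (?R e z) * ?d y) \<partial>lborel)
      = (\<integral>y. \<eta> y * p (\<rho> (z - e *\<^sub>R y)) - (p (?R e z) - p' (?R e z) * ?R e z) * \<eta> y - p' (?R e z) * (\<eta> y * \<rho> (z - e *\<^sub>R y)) \<partial>lborel)"
      by (intro Bochner_Integration.integral_cong refl) (simp add: algebra_simps)
    also have "\<dots> = conv (dilated \<eta> e) (\<lambda>z. p (\<rho> z)) z - (p (?R e z) - p' (?R e z) * ?R e z) - p' (?R e z) * ?R e z"
      using i m(4,7) conv_dilated[OF e(1) _ m(8), of _ z] by simp
    finally have eq: "conv (dilated \<eta> e) (\<lambda>z. p (\<rho> z)) z - p (?R e z) = (\<integral>y. \<eta> y * (p (\<rho> (z - e *\<^sub>R y)) - p (?R e z) - p' (?R e z) * ?d y) \<partial>lborel)"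
      by simp
    have int: "integrable lborel (\<lambda>y. \<eta> y * (p (\<rho> (z - e *\<^sub>R y)) - p (?R e z) - p' (?R e z) * ?d y))"
    proof -
      have "(\<lambda>y. \<eta> y * (p (\<rho> (z - e *\<^sub>R y)) - p (?R e z) - p' (?R e z) * ?d y)) =
        (\<lambda>y. \<eta> y * p (\<rho> (z - e *\<^sub>R y)) - (p (?R e z) - p' (?R e z) * ?R e z) * \<eta> y - p' (?R e z) * (\<eta> y * \<rho> (z - e *\<^sub>R y)))"
        by (rule ext) (simp add: algebra_simps)
      then show ?thesis using i m(7) by simp
    qed
    have "\<bar>conv (dilated \<eta> e) (\<lambda>z. p (\<rho> z)) z - p (?R e z)\<bar> \<le> (\<integral>y. \<bar>\<eta> y * (p (\<rho> (z - e *\<^sub>R y)) - p (?R e z) - p' (?R e z) * ?d y)\<bar> \<partial>lborel)"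
      unfolding eq by (rule integral_abs_bound)
    also have "\<dots> \<le> (\<integral>y. C * (\<eta> y * (\<bar>?d y\<bar> powr \<gamma>)) \<partial>lborel)"
    proof (rule integral_mono)
      fix y
      have "\<eta> y * \<bar>p (\<rho> (z - e *\<^sub>R y)) - p (?R e z) - p' (?R e z) * ?d y\<bar> \<le> \<eta> y * (C * \<bar>?d y\<bar> powr \<gamma>)"
        using m(5) by (intro mult_left_mono taylor \<rho>(3) R)
      then show "\<bar>\<eta> y * (p (\<rho> (z - e *\<^sub>R y)) - p (?R e z) - p' (?R e z) * ?d y)\<bar> \<le> C * (\<eta> y * (\<bar>?d y\<bar> powr \<gamma>))"
        using m(5)[of y] by (simp add: abs_mult mult_ac)
    qed (use int id in auto)
    also have "\<dots> \<le> C * \<bar>\<integral>y. \<eta> y * (\<bar>?d y\<bar> powr \<gamma>) \<partial>lborel\<bar>"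
      using C by (simp add: mult_left_mono)
    finally show "\<bar>conv (dilated \<eta> e) (\<lambda>z. p (\<rho> z)) z - p (?R e z)\<bar>
       \<le> C * \<bar>\<integral>y. \<eta> y * (\<bar>\<rho> (fst (z, y) - e *\<^sub>R snd (z, y)) - ?R e (fst (z, y))\<bar> powr \<gamma>) \<partial>lborel\<bar>" by simp
  qed
qed

end

section \<open>Borel representatives and Besov regularity\<close>

lemma AE_translate:
  fixes P :: "'a::euclidean_space \<Rightarrow> bool"
  assumes "AE z in lborel. P z"
  shows "AE z in lborel. P (z + c)"
proof -
  from assms obtain N where N: "{z \<in> space lborel. \<not> P z} \<subseteq> N" "emeasure lborel N = 0" "N \<in> sets lborel" by (rule AE_E)
  have [measurable]: "N \<in> sets borel" using N by simp
  show ?thesis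
  proof (rule AE_I[of _ _ "{z. z + c \<in> N}"])
    have "emeasure lborel {z. z + c \<in> N} = (\<integral>\<^sup>+z. indicator {z. z + c \<in> N} z \<partial>lborel)"
      by (subst nn_integral_indicator) auto
    also have "\<dots> = (\<integral>\<^sup>+z. indicator N (z + c) \<partial>lborel)" by (intro nn_integral_cong) (auto simp: indicator_def)
    also have "\<dots> = (\<integral>\<^sup>+z. indicator N z \<partial>lborel)" by (rule nn_integral_translate) measurable
    also have "\<dots> = 0" using N by simp
    finally show "emeasure lborel {z. z + c \<in> N} = 0" .
  qed (use N in auto)
qed

lemma slab_borel [measurable]: "slab T \<in> sets borel"
  unfolding slab_def by (intro borel_open open_Times) auto

lemma slab_cell_borel [measurable]: "(slab_cell T :: (real \<times> (real ^ 'd)) set) \<in> sets borel"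
  unfolding slab_cell_def by (rule strip_borel) simp

lemma emeasure_slab_cell: "emeasure lborel (slab_cell T :: (real \<times> (real ^ 'd)) set) < \<infinity>"
proof -
  have "emeasure lborel (slab_cell T :: (real \<times> (real ^ 'd)) set) \<le> emeasure lborel ({0..T} \<times> (unit_cell :: (real ^ 'd) set))"
    by (intro emeasure_mono) (auto simp: slab_cell_def intro: strip_borel)
  also have "\<dots> < \<infinity>" by (rule emeasure_strip)
  finally show ?thesis .
qed

lemma vfloor_borel [measurable]: "(vfloor :: real ^ 'd \<Rightarrow> real ^ 'd) \<in> borel \<rightarrow>\<^sub>M borel"
proof (rule borel_measurable_euclidean_space[THEN iffD2], rule ballI)
  fix b :: "real ^ 'd" assume "b \<in> Basis"
  then obtain i where b: "b = axis i 1" by (auto simp: Basis_vec_def)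
  have "(\<lambda>x. vfloor x \<bullet> b) = (\<lambda>x. of_int \<lfloor>x $ i\<rfloor>)"
    unfolding b by (auto simp: vfloor_def inner_axis)
  then show "(\<lambda>x. vfloor x \<bullet> b) \<in> borel_measurable borel" by simp
qed

text \<open>
The slab is a countable union of translates of the cell.
\<close>

lemma AE_slab_of_cell:
  fixes P :: "real \<times> (real ^ 'd) \<Rightarrow> bool"
  assumes ae: "AE z in lborel. z \<in> slab_cell T \<longrightarrow> P z" and per: "space_periodic P"
  shows "AE z in lborel. z \<in> slab T \<longrightarrow> P z"
proof -
  have "AE z in lborel. \<forall>k\<in>lattice. z + (0, k) \<in> slab_cell T \<longrightarrow> P (z + (0, k))"
    unfolding AE_ball_countable[OF countable_lattice] using AE_translate[OF ae] by blast
  then show ?thesis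
  proof eventually_elim
    case (elim z)
    obtain t x where z: "z = (t, x)" by fastforce
    show ?case
    proof
      assume s: "z \<in> slab T"
      have k: "- vfloor x \<in> lattice" by (intro lattice_minus vfloor_lattice)
      have "z + (0, - vfloor x) \<in> slab_cell T" using s frac_in_cell[of x] by (auto simp: z slab_def slab_cell_def)
      then have "P (z + (0, - vfloor x))" using elim k by blast
      then show "P z" by (simp only: space_periodicD[OF per k])
    qed
  qed
qed

text \<open>
A Borel function that agrees with \<open>f\<close> almost everywhere on the cell is extended periodically, so that
the agreement persists on the whole slab and hence for shifted arguments. Fubini's theorem
is then available in the product of two Borel spaces.
\<close>

lemma borel_version:
  fixes f :: "real \<times> (real ^ 'd) \<Rightarrow> real"
  assumes per: "space_periodic f" and m: "f \<in> borel_measurable (lebesgue_on (slab_cell T))"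
  obtains g where "g \<in> borel_measurable borel" "space_periodic g" "\<And>z. fst z \<notin> {0<..<T} \<Longrightarrow> g z = 0"
    "AE z in lborel. z \<in> slab T \<longrightarrow> f z = g z"
proof -
  define h where "h z = (if z \<in> slab_cell T then f z else 0)" for z
  have "h \<in> borel_measurable lebesgue"
    unfolding h_def[abs_def] using m by (simp add: borel_measurable_if)
  then obtain g' where g'[measurable]: "g' \<in> borel_measurable lborel" and ae: "AE z in lborel. h z = g' z"
    using completion_ex_borel_measurable_real[of h lborel] by blast
  have g'b[measurable]: "g' \<in> borel_measurable borel" using g' by simp
  define g where "g z = (if fst z \<in> {0<..<T} then g' (fst z, snd z - vfloor (snd z)) else 0)" for z
  have vf: "vfloor (x + k) = vfloor x + k" if "k \<in> lattice" for x k :: "real ^ 'd"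
  proof -
    have "(x + k) - (vfloor x + k) \<in> unit_cell" using frac_in_cell[of x] by simp
    moreover have "vfloor x + k \<in> lattice" using vfloor_lattice[of x] that by (simp add: lattice_def)
    ultimately show ?thesis using cell_iff_vfloor by metis
  qed
  show thesis
  proof (rule that)
    have "(\<lambda>z :: real \<times> (real ^ 'd). (fst z, snd z - vfloor (snd z))) \<in> borel \<rightarrow>\<^sub>M borel"
      unfolding borel_prod[symmetric] by measurable
    then have "(\<lambda>z. g' (fst z, snd z - vfloor (snd z))) \<in> borel_measurable borel"
      by (rule measurable_compose[OF _ g'b])
    then show "g \<in> borel_measurable borel" unfolding g_def[abs_def] by measurable
    show "space_periodic g" by (rule space_periodicI) (auto simp: g_def vf)
    show "g z = 0" if "fst z \<notin> {0<..<T}" for z using that unfolding g_def by auto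
    have "AE z in lborel. z \<in> slab_cell T \<longrightarrow> f z = g z"
      using ae
    proof eventually_elim
      case (elim z)
      show ?case
      proof
        assume z: "z \<in> slab_cell T"
        then have "vfloor (snd z) = 0"
          using cell_iff_vfloor[of 0 "snd z"] by (auto simp: slab_cell_def lattice_def)
        then show "f z = g z" using elim z by (auto simp: h_def g_def slab_cell_def)
      qed
    qed
    moreover have "space_periodic (\<lambda>z. f z = g z)"
      by (rule space_periodicI) (simp only: space_periodicD[OF per] space_periodicD[OF \<open>space_periodic g\<close>])
    ultimately show "AE z in lborel. z \<in> slab T \<longrightarrow> f z = g z" by (rule AE_slab_of_cell)
  qed
qed

lemma AE_density_indicator:
  fixes P :: "'a::euclidean_space \<Rightarrow> bool"
  assumes "A \<in> sets borel"
  shows "(AE z in density lborel (indicator A). P z) \<longleftrightarrow> (AE z in lborel. z \<in> A \<longrightarrow> P z)"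
proof -
  have "(AE z in density lborel (indicator A). P z) \<longleftrightarrow> (AE z in lborel. 0 < (indicator A z :: ennreal) \<longrightarrow> P z)"
    using assms by (subst AE_density) auto
  also have "\<dots> \<longleftrightarrow> (AE z in lborel. z \<in> A \<longrightarrow> P z)"
    by (intro arg_cong2[of _ _ _ _ eventually] ext refl) (auto simp: indicator_def)
  finally show ?thesis .
qed

lemma nn_integral_density_indicator:
  fixes f :: "'a::euclidean_space \<Rightarrow> ennreal"
  assumes "f \<in> borel_measurable borel" "A \<in> sets borel"
  shows "(\<integral>\<^sup>+z. f z \<partial>density lborel (indicator A)) = (\<integral>\<^sup>+z. f z * indicator A z \<partial>lborel)"
  using assms by (subst nn_integral_density) (auto simp: mult.commute)

lemma AE_lebesgue_onD:
  assumes "AE z in lebesgue_on S. P z" "S \<in> sets lebesgue"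
  shows "AE z in lborel. z \<in> S \<longrightarrow> P z"
  using assms by (simp add: AE_restrict_space_iff AE_completion_iff)

lemma exponent_ge_2: "2 \<le> q \<Longrightarrow> q \<noteq> \<infinity> \<Longrightarrow> 2 \<le> enn2real q"
  by (cases q) (auto simp: ennreal_numeral[symmetric] simp del: ennreal_numeral)

lemma Lq_norm_finite_le:
  assumes q: "q \<noteq> \<infinity>" "0 < enn2real q" and "Lq_norm q M w \<le> ennreal c" "0 \<le> c"
  shows "(\<integral>\<^sup>+ z. ennreal (norm (w z) powr enn2real q) \<partial>M) \<le> ennreal (c powr enn2real q)"
proof -
  let ?I = "\<integral>\<^sup>+ z. ennreal (norm (w z) powr enn2real q) \<partial>M"
  have fin: "?I \<noteq> \<infinity>" using assms(3) q unfolding Lq_norm_def Let_def by (auto simp: top_unique)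
  then have "ennreal (enn2real ?I powr (1 / enn2real q)) \<le> ennreal c"
    using assms(3) q unfolding Lq_norm_def Let_def by auto
  then have "enn2real ?I powr (1 / enn2real q) \<le> c" using assms(4) by (simp add: ennreal_le_iff)
  then have "(enn2real ?I powr (1 / enn2real q)) powr enn2real q \<le> c powr enn2real q"
    using q by (intro powr_mono2) auto
  then have "enn2real ?I \<le> c powr enn2real q" using q by (simp add: powr_powr)
  then have "ennreal (enn2real ?I) \<le> ennreal (c powr enn2real q)" by (rule ennreal_leI)
  then show ?thesis using fin by (simp add: ennreal_enn2real_if)
qed

lemma Lq_bound_transfer:
  fixes v v' :: "'a::euclidean_space \<Rightarrow> 'b::{real_normed_vector, second_countable_topology}"
  assumes q: "2 \<le> q" and S: "S \<in> sets lebesgue" "A \<subseteq> S" and A: "A \<in> sets borel"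
    and L: "Lq_norm q (lebesgue_on S) v \<le> ennreal c" "0 \<le> c"
    and ae: "AE z in lborel. z \<in> A \<longrightarrow> v z = v' z" and v'[measurable]: "v' \<in> borel_measurable borel"
  shows "q = \<infinity> \<Longrightarrow> AE z in density lborel (indicator A). norm (v' z) \<le> c"
    and "q \<noteq> \<infinity> \<Longrightarrow> (\<integral>\<^sup>+z. ennreal (norm (v' z) powr enn2real q) \<partial>density lborel (indicator A)) \<le> ennreal (c powr enn2real q)"
proof -
  show "AE z in density lborel (indicator A). norm (v' z) \<le> c" if "q = \<infinity>"
  proof -
    have "AE z in lebesgue_on S. ennreal (norm (v z)) \<le> ennreal c"
      using esssup_AE[of "\<lambda>z. ennreal (norm (v z))" "lebesgue_on S"]
    proof eventually_elim
      case (elim z)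
      then show ?case using L(1) that unfolding Lq_norm_def by simp
    qed
    from AE_lebesgue_onD[OF this S(1)] ae show ?thesis
      unfolding AE_density_indicator[OF A]
    proof eventually_elim
      case (elim z)
      then show ?case using S(2) L(2) by (auto simp: ennreal_le_iff)
    qed
  qed
  show "(\<integral>\<^sup>+z. ennreal (norm (v' z) powr enn2real q) \<partial>density lborel (indicator A)) \<le> ennreal (c powr enn2real q)" if qf: "q \<noteq> \<infinity>"
  proof -
    have q0: "0 < enn2real q" using exponent_ge_2[OF q qf] by simp
    have "(\<integral>\<^sup>+z. ennreal (norm (v' z) powr enn2real q) \<partial>density lborel (indicator A))
      = (\<integral>\<^sup>+z. ennreal (norm (v' z) powr enn2real q) * indicator (A) z \<partial>lebesgue)"
      by (simp add: nn_integral_density_indicator[OF _ A] nn_integral_completion)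
    also have "\<dots> \<le> (\<integral>\<^sup>+z. ennreal (norm (v z) powr enn2real q) * indicator S z \<partial>lebesgue)"
    proof (rule nn_integral_mono_AE)
      show "AE z in lebesgue. ennreal (norm (v' z) powr enn2real q) * indicator (A) z
        \<le> ennreal (norm (v z) powr enn2real q) * indicator S z"
        using AE_completion[OF ae]
      proof eventually_elim
        case (elim z)
        then show ?case using S(2) by (auto simp: indicator_def)
      qed
    qed
    also have "\<dots> = (\<integral>\<^sup>+z. ennreal (norm (v z) powr enn2real q) \<partial>lebesgue_on S)"
      using S(1) by (subst nn_integral_restrict_space) auto
    also have "\<dots> \<le> ennreal (c powr enn2real q)" by (rule Lq_norm_finite_le[OF qf q0 L])
    finally show ?thesis .
  qed
qed

definition reciprocal :: "ennreal \<Rightarrow> real" where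
  "reciprocal q = enn2real (1 / q)"

lemma reciprocal_eq: "2 \<le> q \<Longrightarrow> q \<noteq> \<infinity> \<Longrightarrow> reciprocal q = 1 / enn2real q" "reciprocal \<infinity> = 0"
  by (cases q; auto simp: reciprocal_def divide_ennreal ennreal_1[symmetric] simp del: ennreal_1; fail)
    (simp add: reciprocal_def)

lemma besov_bound:
  assumes w: "w \<in> besov T \<alpha> q"
  obtains B where "0 \<le> B" "Lq_norm q (lebesgue_on (slab_cell T)) w \<le> ennreal B"
    "\<And>\<xi>. \<xi> \<noteq> 0 \<Longrightarrow> Lq_norm q (lebesgue_on {z \<in> slab_cell T. z + \<xi> \<in> slab T}) (\<lambda>z. w (z + \<xi>) - w z) \<le> ennreal (B * norm \<xi> powr \<alpha>)"
proof -
  define B where "B = enn2real (besov_norm T \<alpha> q w)"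
  have fin: "besov_norm T \<alpha> q w < \<infinity>" using w by (simp add: besov_def)
  then have eB: "besov_norm T \<alpha> q w = ennreal B" by (simp add: B_def)
  show thesis
  proof (rule that)
    show "0 \<le> B" by (simp add: B_def)
    show "Lq_norm q (lebesgue_on (slab_cell T)) w \<le> ennreal B"
      unfolding eB[symmetric] besov_norm_def by (rule add_increasing2) auto
    fix \<xi> :: "real \<times> (real ^ 'a)" assume \<xi>: "\<xi> \<noteq> 0"
    let ?L = "\<lambda>\<xi>. Lq_norm q (lebesgue_on {z \<in> slab_cell T. z + \<xi> \<in> slab T}) (\<lambda>z. w (z + \<xi>) - w z)"
    have n: "0 < norm \<xi> powr \<alpha>" using \<xi> by simp
    have "?L \<xi> / ennreal (norm \<xi> powr \<alpha>) \<le> (SUP \<xi>\<in>{\<xi>. \<xi> \<noteq> 0}. ?L \<xi> / ennreal (norm \<xi> powr \<alpha>))"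
      using \<xi> by (intro SUP_upper) auto
    also have "\<dots> \<le> besov_norm T \<alpha> q w" unfolding besov_norm_def by (simp add: add_increasing)
    finally have "?L \<xi> / ennreal (norm \<xi> powr \<alpha>) \<le> ennreal B" unfolding eB .
    then have "?L \<xi> / ennreal (norm \<xi> powr \<alpha>) * ennreal (norm \<xi> powr \<alpha>) \<le> ennreal B * ennreal (norm \<xi> powr \<alpha>)"
      by (rule mult_right_mono) simp
    moreover have "?L \<xi> / ennreal (norm \<xi> powr \<alpha>) * ennreal (norm \<xi> powr \<alpha>) = ?L \<xi>"
      using n by (simp add: ennreal_divide_times ennreal_mult_divide_eq)
    ultimately show "?L \<xi> \<le> ennreal (B * norm \<xi> powr \<alpha>)" by (simp add: ennreal_mult B_def)
  qed
qed


lemma AE_ball_measure: "(AE y in ball_measure. P y) \<longleftrightarrow> (AE y in lborel. norm y \<le> 1 \<longrightarrow> P y)" for P :: "'a::euclidean_space \<Rightarrow> bool"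
  unfolding ball_measure_def by (subst AE_density_indicator) auto

lemma besov_Lp_order_norm:
  fixes w w' :: "real \<times> (real ^ 'd) \<Rightarrow> 'b::{real_normed_vector, second_countable_topology}"
  assumes w: "w \<in> besov T \<alpha> q" and q: "2 \<le> q" and [measurable]: "w' \<in> borel_measurable borel"
    and ae: "AE z in lborel. z \<in> slab T \<longrightarrow> w z = w' z" and ab: "0 < a" "b < T"
  shows "Lp_order (strip_measure a b) e0 (reciprocal q) 0 (\<lambda>e z. norm (w' z))"
proof -
  obtain B where B: "0 \<le> B" "Lq_norm q (lebesgue_on (slab_cell T)) w \<le> ennreal B"
    by (rule besov_bound[OF w]) blast
  have S: "slab_cell T \<in> sets lebesgue" "{a..b} \<times> unit_cell \<subseteq> slab_cell T" "slab_cell T \<subseteq> slab T"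
    using slab_cell_borel[of T] ab by (auto simp: slab_cell_def slab_def)
  have ae': "AE z in lborel. z \<in> {a..b} \<times> unit_cell \<longrightarrow> w z = w' z"
    using ae by eventually_elim (use S in auto)
  have "{a..b} \<times> (unit_cell :: (real ^ 'd) set) \<in> sets borel" by (rule strip_borel) simp
  note L = Lq_bound_transfer[OF q S(1,2) this B(2,1) ae', folded strip_measure_def]
  show ?thesis
  proof (cases "q = \<infinity>")
    case True
    show ?thesis unfolding True reciprocal_eq
      by (rule Lp_order_bounded[where C = B]) (use L(1)[OF _ True] in simp)
  next
    case False
    define Q where "Q = enn2real q"
    have Q: "2 \<le> Q" unfolding Q_def by (rule exponent_ge_2[OF q False])
    show ?thesis
    proof (rule Lp_orderI[of "1 + B powr Q" _ "\<lambda>e z. norm (w' z) powr Q"])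
      fix e :: real assume e: "0 < e"
      show "(\<lambda>z. norm (w' z) powr Q) \<in> borel_measurable (strip_measure a b)" by measurable
      have "(\<integral>\<^sup>+z. ennreal (norm (w' z) powr Q) \<partial>strip_measure a b) \<le> ennreal (B powr Q)"
        using L(2)[OF _ False] by (simp add: Q_def)
      also have "\<dots> \<le> ennreal (1 + B powr Q)" by (intro ennreal_leI) simp
      finally show "(\<integral>\<^sup>+z. ennreal (norm (w' z) powr Q) \<partial>strip_measure a b) \<le> ennreal (1 + B powr Q)" .
      show "AE z in strip_measure a b. \<bar>norm (w' z)\<bar> \<le> (1 + B powr Q) * e powr 0 * (1 + norm (w' z) powr Q) powr reciprocal q"
      proof (rule AE_I2)
        fix z
        have "norm (w' z) = (norm (w' z) powr Q) powr reciprocal q"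
          using Q by (simp add: powr_powr reciprocal_eq(1)[OF q False] Q_def[symmetric])
        also have "\<dots> \<le> 1 * (1 + norm (w' z) powr Q) powr reciprocal q"
          using Q by (simp, intro powr_mono2) (auto simp: reciprocal_def)
        also have "\<dots> \<le> (1 + B powr Q) * (1 + norm (w' z) powr Q) powr reciprocal q"
          by (intro mult_right_mono) auto
        finally show "\<bar>norm (w' z)\<bar> \<le> (1 + B powr Q) * e powr 0 * (1 + norm (w' z) powr Q) powr reciprocal q"
          using e by simp
      qed
    qed auto
  qed
qed

text \<open>
For a fixed direction \<open>y\<close> the weight is the \<open>q\<close>-th power of the increment, normalised by its Besov
bound, so its integral over \<open>z\<close> is at most \<open>1\<close>; for \<open>q = \<infinity>\<close> the weight is \<open>0\<close>.
\<close>

lemma besov_Lp_order_increments: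
  fixes w w' :: "real \<times> (real ^ 'd) \<Rightarrow> 'b::{real_normed_vector, second_countable_topology}"
  assumes w: "w \<in> besov T \<alpha> q" and q: "2 \<le> q" and \<alpha>: "0 \<le> \<alpha>" and w'm[measurable]: "w' \<in> borel_measurable borel"
    and ae: "AE z in lborel. z \<in> slab T \<longrightarrow> w z = w' z" and ab: "0 < a - e0" "b + e0 < T"
  shows "Lp_order (strip_measure a b \<Otimes>\<^sub>M ball_measure) e0 (reciprocal q) \<alpha> (\<lambda>e p. norm (w' (fst p - e *\<^sub>R snd p) - w' (fst p)))"
proof -
  interpret B: finite_measure "ball_measure :: (real \<times> (real ^ 'd)) measure" by (rule finite_ball_measure)
  interpret S: sigma_finite_measure "strip_measure a b :: (real \<times> (real ^ 'd)) measure" by (rule sigma_finite_strip_measure)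
  interpret P: pair_sigma_finite "strip_measure a b :: (real \<times> (real ^ 'd)) measure" "ball_measure :: (real \<times> (real ^ 'd)) measure" ..
  obtain B where B: "0 \<le> B"
    "\<And>\<xi>. \<xi> \<noteq> 0 \<Longrightarrow> Lq_norm q (lebesgue_on {z \<in> slab_cell T. z + \<xi> \<in> slab T}) (\<lambda>z. w (z + \<xi>) - w z) \<le> ennreal (B * norm \<xi> powr \<alpha>)"
    by (rule besov_bound[OF w]) blast
  define \<delta> where "\<delta> e z y = norm (w' (z - e *\<^sub>R y) - w' z)" for e z y
  have dm[measurable]: "(\<lambda>p. \<delta> e (fst p) (snd p)) \<in> borel_measurable (strip_measure a b \<Otimes>\<^sub>M ball_measure)" for e
    unfolding \<delta>_def by measurable
  have dm1[measurable]: "(\<lambda>z. \<delta> e z y) \<in> borel_measurable (strip_measure a b)" for e y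
    unfolding \<delta>_def by measurable
  define c where "c e = (B + 1) * e powr \<alpha>" for e
  have cpos: "0 < c e" if "0 < e" for e using that B by (simp add: c_def)
  \<comment> \<open>the Besov bound for the single shift \<open>-e y\<close>\<close>
  have key: "(q = \<infinity> \<longrightarrow> (AE z in strip_measure a b. \<delta> e z y \<le> c e)) \<and>
     (q \<noteq> \<infinity> \<longrightarrow> (\<integral>\<^sup>+z. ennreal (\<delta> e z y powr enn2real q) \<partial>strip_measure a b) \<le> ennreal (c e powr enn2real q))"
    if e: "0 < e" "e < e0" and y: "norm y \<le> 1" for e y
  proof (cases "y = 0")
    case True
    then have "\<delta> e z y = 0" for z by (simp add: \<delta>_def)
    then show ?thesis using cpos[OF e(1)] by simp
  next
    case False
    define \<xi> where "\<xi> = - (e *\<^sub>R y)"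
    have \<xi>: "\<xi> \<noteq> 0" "norm \<xi> \<le> e" using False e y by (auto simp: \<xi>_def mult_left_le)
    let ?S = "{z \<in> slab_cell T. z + \<xi> \<in> slab T}"
    have "?S \<in> sets borel" by measurable
    then have S1: "?S \<in> sets lebesgue" by simp
    have f\<xi>: "\<bar>fst \<xi>\<bar> \<le> e" using \<xi>(2) norm_fst_le[of "fst \<xi>" "snd \<xi>"] by simp
    have S2: "{a..b} \<times> unit_cell \<subseteq> ?S"
    proof
      fix z :: "real \<times> (real ^ 'd)" assume z: "z \<in> {a..b} \<times> unit_cell"
      then have "a \<le> fst z" "fst z \<le> b" by auto
      then have "0 < fst (z + \<xi>)" "fst (z + \<xi>) < T" "0 < fst z" "fst z < T"
        using f\<xi> e ab by auto
      then show "z \<in> ?S" using z by (cases \<xi>) (auto simp: slab_cell_def slab_def)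
    qed
    have ae': "AE z in lborel. z \<in> {a..b} \<times> unit_cell \<longrightarrow> w (z + \<xi>) - w z = w' (z + \<xi>) - w' z"
      using ae AE_translate[OF ae, of \<xi>]
    proof eventually_elim
      case (elim z)
      show ?case
      proof
        assume "z \<in> {a..b} \<times> unit_cell"
        then have "z \<in> ?S" using S2 by blast
        then have "z \<in> slab T" "z + \<xi> \<in> slab T" by (auto simp: slab_cell_def slab_def)
        then show "w (z + \<xi>) - w z = w' (z + \<xi>) - w' z" using elim by simp
      qed
    qed
    have cc: "B * norm \<xi> powr \<alpha> \<le> c e" "0 \<le> B * norm \<xi> powr \<alpha>"
      unfolding c_def using B \<xi> \<alpha> by (auto intro!: mult_mono powr_mono2)
    have L: "Lq_norm q (lebesgue_on ?S) (\<lambda>z. w (z + \<xi>) - w z) \<le> ennreal (c e)"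
      using B(2)[OF \<xi>(1)] ennreal_leI[OF cc(1)] by order
    have d: "\<delta> e z y = norm (w' (z + \<xi>) - w' z)" for z by (simp add: \<delta>_def \<xi>_def)
    have m: "(\<lambda>z. w' (z + \<xi>) - w' z) \<in> borel_measurable borel" by measurable
    have "{a..b} \<times> (unit_cell :: (real ^ 'd) set) \<in> sets borel" by (rule strip_borel) simp
    then show ?thesis
      using Lq_bound_transfer[OF q S1 S2 _ L less_imp_le[OF cpos[OF e(1)]] ae' m, folded strip_measure_def] unfolding d by blast
  qed
  show ?thesis
  proof (cases "q = \<infinity>")
    case True
    show ?thesis unfolding True reciprocal_eq
    proof (rule Lp_order_bounded[where C = "B + 1"])
      fix e assume e: "0 < e" "e < e0"
      have "AE p in strip_measure a b \<Otimes>\<^sub>M ball_measure. \<delta> e (fst p) (snd p) \<le> c e"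
      proof (rule P.AE_pair_measure)
        have 1: "AE y in ball_measure. AE z in strip_measure a b. \<delta> e z y \<le> c e"
          unfolding AE_ball_measure
        proof (rule AE_I2, rule impI)
          fix y :: "real \<times> (real ^ 'd)" assume "norm y \<le> 1"
          from key[OF e this] True show "AE z in strip_measure a b. \<delta> e z y \<le> c e" by blast
        qed
        have "(AE z in strip_measure a b. AE y in ball_measure. \<delta> e z y \<le> c e) \<longleftrightarrow> (AE y in ball_measure. AE z in strip_measure a b. \<delta> e z y \<le> c e)"
          by (rule P.AE_commute) measurable
        then show "AE z in strip_measure a b. AE y in ball_measure. \<delta> e (fst (z, y)) (snd (z, y)) \<le> c e"
          using 1 by simp
      qed measurable
      then show "AE p in strip_measure a b \<Otimes>\<^sub>M ball_measure. \<bar>norm (w' (fst p - e *\<^sub>R snd p) - w' (fst p))\<bar> \<le> (B + 1) * e powr \<alpha>"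
        by (simp add: \<delta>_def c_def)
    qed
  next
    case False
    define Q where "Q = enn2real q"
    have Q: "2 \<le> Q" unfolding Q_def by (rule exponent_ge_2[OF q False])
    define n where "n = measure (ball_measure :: (real \<times> (real ^ 'd)) measure) (space ball_measure)"
    have n: "0 \<le> n" by (simp add: n_def)
    have \<Phi>m: "(\<lambda>p. \<delta> e (fst p) (snd p) powr Q / c e powr Q) \<in> borel_measurable (strip_measure a b \<Otimes>\<^sub>M ball_measure)" for e
      by (intro borel_measurable_divide powr_real_measurable dm borel_measurable_const)
    show ?thesis
    proof (rule Lp_orderI[of "B + 1 + n" _ "\<lambda>e p. \<delta> e (fst p) (snd p) powr Q / c e powr Q"])
      fix e assume e: "0 < e" "e < e0"
      show "(\<lambda>p. \<delta> e (fst p) (snd p) powr Q / c e powr Q) \<in> borel_measurable (strip_measure a b \<Otimes>\<^sub>M ball_measure)" by (rule \<Phi>m)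
      have "(\<integral>\<^sup>+p. ennreal (\<delta> e (fst p) (snd p) powr Q / c e powr Q) \<partial>(strip_measure a b \<Otimes>\<^sub>M ball_measure))
        = (\<integral>\<^sup>+y. \<integral>\<^sup>+z. ennreal (\<delta> e z y powr Q / c e powr Q) \<partial>strip_measure a b \<partial>ball_measure)"
        using P.nn_integral_snd[of "\<lambda>p. ennreal (\<delta> e (fst p) (snd p) powr Q / c e powr Q)"] \<Phi>m[of e]
        by (simp only: fst_conv snd_conv measurable_compose[OF \<Phi>m measurable_ennreal])
      also have "\<dots> \<le> (\<integral>\<^sup>+y. 1 \<partial>(ball_measure :: (real \<times> (real ^ 'd)) measure))"
      proof (rule nn_integral_mono_AE)
        show "AE y in ball_measure. (\<integral>\<^sup>+z. ennreal (\<delta> e z y powr Q / c e powr Q) \<partial>strip_measure a b) \<le> 1"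
          unfolding AE_ball_measure
        proof (intro AE_I2 impI)
          fix y :: "real \<times> (real ^ 'd)" assume y: "norm y \<le> 1"
          have cp: "0 < c e powr Q" using cpos[OF e(1)] by simp
          have "(\<integral>\<^sup>+z. ennreal (\<delta> e z y powr Q / c e powr Q) \<partial>strip_measure a b)
            = (\<integral>\<^sup>+z. ennreal (1 / c e powr Q) * ennreal (\<delta> e z y powr Q) \<partial>strip_measure a b)"
            using cp by (intro nn_integral_cong) (simp add: ennreal_mult[symmetric])
          also have "\<dots> = ennreal (1 / c e powr Q) * (\<integral>\<^sup>+z. ennreal (\<delta> e z y powr Q) \<partial>strip_measure a b)"
            by (rule nn_integral_cmult) measurable
          also have "\<dots> \<le> ennreal (1 / c e powr Q) * ennreal (c e powr Q)"
            using key[OF e y] False by (intro mult_left_mono) (auto simp: Q_def)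
          also have "\<dots> = 1" using cp by (simp add: ennreal_mult[symmetric])
          finally show "(\<integral>\<^sup>+z. ennreal (\<delta> e z y powr Q / c e powr Q) \<partial>strip_measure a b) \<le> 1" .
        qed
      qed
      also have "\<dots> = ennreal n" by (simp add: n_def B.emeasure_eq_measure)
      also have "\<dots> \<le> ennreal (B + 1 + n)" using B by (intro ennreal_leI) simp
      finally show "(\<integral>\<^sup>+p. ennreal (\<delta> e (fst p) (snd p) powr Q / c e powr Q) \<partial>(strip_measure a b \<Otimes>\<^sub>M ball_measure)) \<le> ennreal (B + 1 + n)" .
      show "AE p in strip_measure a b \<Otimes>\<^sub>M ball_measure. \<bar>norm (w' (fst p - e *\<^sub>R snd p) - w' (fst p))\<bar>
        \<le> (B + 1 + n) * e powr \<alpha> * (1 + \<delta> e (fst p) (snd p) powr Q / c e powr Q) powr reciprocal q"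
      proof (rule AE_I2)
        fix p :: "(real \<times> (real ^ 'd)) \<times> real \<times> (real ^ 'd)"
        let ?d = "\<delta> e (fst p) (snd p)"
        have d0: "0 \<le> ?d" by (simp add: \<delta>_def)
        have "?d = c e * (?d / c e)" using cpos[OF e(1)] by simp
        also have "?d / c e = ((?d / c e) powr Q) powr reciprocal q"
          using Q d0 cpos[OF e(1)] by (simp add: powr_powr reciprocal_eq(1)[OF q False] Q_def[symmetric])
        also have "(?d / c e) powr Q = ?d powr Q / c e powr Q" using d0 cpos[OF e(1)] by (simp add: powr_divide)
        also have "c e * (?d powr Q / c e powr Q) powr reciprocal q \<le> c e * (1 + ?d powr Q / c e powr Q) powr reciprocal q"
          using cpos[OF e(1)] by (intro mult_left_mono powr_mono2) (auto simp: reciprocal_def)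
        also have "\<dots> \<le> ((B + 1 + n) * e powr \<alpha>) * (1 + ?d powr Q / c e powr Q) powr reciprocal q"
          unfolding c_def using n by (intro mult_right_mono) auto
        finally show "\<bar>norm (w' (fst p - e *\<^sub>R snd p) - w' (fst p))\<bar>
        \<le> (B + 1 + n) * e powr \<alpha> * (1 + ?d powr Q / c e powr Q) powr reciprocal q"
          by (simp add: \<delta>_def)
      qed
    qed (use B n in auto)
  qed
qed


lemma besov_square_integrable:
  fixes w w' :: "real \<times> (real ^ 'd) \<Rightarrow> 'b::{real_normed_vector, second_countable_topology}"
  assumes w: "w \<in> besov T \<alpha> q" and q: "2 \<le> q" and [measurable]: "w' \<in> borel_measurable borel"
    and ae: "AE z in lborel. z \<in> slab T \<longrightarrow> w z = w' z"
  shows "(\<integral>\<^sup>+z. ennreal ((norm (w' z))\<^sup>2) * indicator (slab_cell T) z \<partial>lborel) < \<infinity>"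
proof -
  let ?N = "density lborel (indicator (slab_cell T)) :: (real \<times> (real ^ 'd)) measure"
  obtain B where B: "0 \<le> B" "Lq_norm q (lebesgue_on (slab_cell T)) w \<le> ennreal B"
    by (rule besov_bound[OF w]) blast
  have S: "slab_cell T \<in> sets lebesgue" using slab_cell_borel[of T] by simp
  have ae': "AE z in lborel. z \<in> slab_cell T \<longrightarrow> w z = w' z"
    using ae by eventually_elim (auto simp: slab_cell_def slab_def)
  note L = Lq_bound_transfer[OF q S subset_refl slab_cell_borel B(2,1) ae' assms(3)]
  have fin: "emeasure ?N (space ?N) < \<infinity>"
    using emeasure_slab_cell[of T] by (subst emeasure_density) auto
  have "(\<integral>\<^sup>+z. ennreal ((norm (w' z))\<^sup>2) * indicator (slab_cell T) z \<partial>lborel) = (\<integral>\<^sup>+z. ennreal ((norm (w' z))\<^sup>2) \<partial>?N)"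
    by (rule nn_integral_density_indicator[symmetric]) measurable
  also have "\<dots> < \<infinity>"
  proof (cases "q = \<infinity>")
    case True
    have "(\<integral>\<^sup>+z. ennreal ((norm (w' z))\<^sup>2) \<partial>?N) \<le> (\<integral>\<^sup>+z. ennreal (B\<^sup>2) \<partial>?N)"
    proof (rule nn_integral_mono_AE)
      show "AE z in ?N. ennreal ((norm (w' z))\<^sup>2) \<le> ennreal (B\<^sup>2)"
        using L(1)[OF True] by eventually_elim (intro ennreal_leI power_mono, auto)
    qed
    also have "\<dots> < \<infinity>" using fin by (simp add: ennreal_mult_less_top)
    finally show ?thesis .
  next
    case False
    define Q where "Q = enn2real q"
    have Q: "2 \<le> Q" unfolding Q_def by (rule exponent_ge_2[OF q False])
    have "(\<integral>\<^sup>+z. ennreal ((norm (w' z))\<^sup>2) \<partial>?N) \<le> (\<integral>\<^sup>+z. 1 + ennreal (norm (w' z) powr Q) \<partial>?N)"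
    proof (rule nn_integral_mono)
      fix z
      have "(norm (w' z))\<^sup>2 \<le> 1 + norm (w' z) powr Q"
      proof (cases "norm (w' z) \<le> 1")
        case True
        then have "(norm (w' z))\<^sup>2 \<le> 1" by (simp add: power_le_one)
        then show ?thesis using powr_ge_zero[of "norm (w' z)" Q] by linarith
      next
        case False
        then have "norm (w' z) powr 2 \<le> norm (w' z) powr Q" using Q by (intro powr_mono) auto
        moreover have "norm (w' z) powr 2 = (norm (w' z))\<^sup>2" using False by (intro powr_numeral) linarith
        ultimately show ?thesis by simp
      qed
      then have "ennreal ((norm (w' z))\<^sup>2) \<le> ennreal (1 + norm (w' z) powr Q)" by (rule ennreal_leI)
      then show "ennreal ((norm (w' z))\<^sup>2) \<le> 1 + ennreal (norm (w' z) powr Q)" by simp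
    qed
    also have "\<dots> = emeasure ?N (space ?N) + (\<integral>\<^sup>+z. ennreal (norm (w' z) powr Q) \<partial>?N)"
      by (subst nn_integral_add) auto
    also have "\<dots> < \<infinity>" using fin L(2)[OF False] by (auto simp: Q_def ennreal_add_less_top top.not_eq_extremum intro: le_less_trans)
    finally show ?thesis .
  qed
  finally show ?thesis .
qed

section \<open>The energy identity of the mollified equations\<close>

lemma test_integrable:
  fixes f :: "real \<times> (real ^ 'd) \<Rightarrow> real"
  assumes "continuous_on UNIV f" "space_periodic f" "time_supported a b f"
  shows "integrable cell_measure f"
proof -
  have "strip_integrable ((\<lambda>_. 1) :: real \<times> (real ^ 'd) \<Rightarrow> real)"
    by (rule strip_integrable_bounded[of _ 1]) (auto simp: space_periodic_def)
  from strip_integrable_mult_test[OF this assms] show ?thesis by simp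
qed

lemma testable_mult:
  assumes "testable a b \<phi>" "Ck (Suc 0) f" "space_periodic f"
  shows "testable a b (\<lambda>z. \<phi> z * f z)"
  using assms C1_mult[of \<phi> f] unfolding testable_def
  by (auto simp: space_periodic_def time_supported_def)

lemma integrable_mult_pd:
  fixes f \<psi> :: "real \<times> (real ^ 'd) \<Rightarrow> real"
  assumes "testable a b \<psi>" "continuous_on UNIV f" "space_periodic f"
  shows "integrable cell_measure (\<lambda>z. f z * pd c \<psi> z)"
proof (rule test_integrable)
  have \<psi>: "Ck (Suc 0) \<psi>" "space_periodic \<psi>" "time_supported a b \<psi>" using assms by (auto simp: testable_def)
  show "continuous_on UNIV (\<lambda>z. f z * pd c \<psi> z)" by (intro continuous_intros assms pd_continuous \<psi>)
  show "space_periodic (\<lambda>z. f z * pd c \<psi> z)"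
    by (rule space_periodicI) (simp only: space_periodicD[OF assms(3)] space_periodicD[OF pd_periodic[OF \<psi>(1,2)]])
  show "time_supported a b (\<lambda>z. f z * pd c \<psi> z)"
    using pd_time_supported[OF \<psi>(3), of c] by (auto simp: time_supported_def)
qed

text \<open>
The functions \<open>R, U, M, F, Pm\<close> stand for the mollifications of \<open>\<rho>, u, \<rho> u, \<rho> u \<otimes> u\<close> and \<open>p(\<rho>)\<close>. The
integrand \<open>X\<close> is a combination of the momentum equations tested with \<open>\<phi> U i\<close>, of the mass equation
tested with \<open>- \<phi> (U i)\<^sup>2 / 2\<close> and with \<open>\<phi> Q(R)\<close>, and of the integrals of \<open>- \<partial>\<^sub>j (\<phi> U j pe(R))\<close> and
\<open>- \<partial>\<^sub>t (\<phi> pe(R))\<close>, which vanish.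
\<close>

lemma mollified_energy_identity:
  fixes R \<phi> Pm :: "real \<times> (real ^ 'd) \<Rightarrow> real" and U M :: "'d \<Rightarrow> real \<times> (real ^ 'd) \<Rightarrow> real"
    and F :: "'d \<Rightarrow> 'd \<Rightarrow> real \<times> (real ^ 'd) \<Rightarrow> real" and Q Q' pe :: "real \<Rightarrow> real"
  assumes \<phi>: "testable a b \<phi>"
    and R: "Ck (Suc 0) R" "space_periodic R" and U: "\<And>i. Ck (Suc 0) (U i)" "\<And>i. space_periodic (U i)"
    and M: "\<And>i. continuous_on UNIV (M i)" "\<And>i. space_periodic (M i)"
    and F: "\<And>i j. continuous_on UNIV (F i j)" "\<And>i j. space_periodic (F i j)"
    and Pm: "continuous_on UNIV Pm" "space_periodic Pm"
    and mass: "\<And>\<psi>. testable a b \<psi> \<Longrightarrow> (\<integral>z. R z * pd (1, 0) \<psi> z + (\<Sum>j\<in>UNIV. M j z * pd (0, axis j 1) \<psi> z) \<partial>cell_measure) = 0"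
    and mom: "\<And>i \<psi>. testable a b \<psi> \<Longrightarrow>
      (\<integral>z. M i z * pd (1, 0) \<psi> z + (\<Sum>j\<in>UNIV. (F i j z + (if i = j then Pm z else 0)) * pd (0, axis j 1) \<psi> z) \<partial>cell_measure) = 0"
    and ibp: "\<And>c (\<psi> :: real \<times> (real ^ 'd) \<Rightarrow> real). testable a b \<psi> \<Longrightarrow> (\<integral>z. pd c \<psi> z \<partial>cell_measure) = 0"
    and Q: "\<And>s. (Q has_real_derivative Q' s) (at s)" "continuous_on UNIV Q'" "\<And>s. (pe has_real_derivative s * Q' s) (at s)"
  defines "X \<equiv> \<lambda>z.
      (\<Sum>i\<in>UNIV. 1 / 2 * (R z * (U i z)\<^sup>2) * pd (1, 0) \<phi> z + (M i z - R z * U i z) * pd (1, 0) (\<lambda>z. \<phi> z * U i z) z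
        + (\<Sum>j\<in>UNIV. 1 / 2 * ((U i z)\<^sup>2 * M j z) * pd (0, axis j 1) \<phi> z
             + (F i j z - M j z * U i z) * pd (0, axis j 1) (\<lambda>z. \<phi> z * U i z) z))
      + (R z * Q (R z) - pe (R z)) * pd (1, 0) \<phi> z
      + (\<Sum>j\<in>UNIV. Q (R z) * M j z * pd (0, axis j 1) \<phi> z
           + (Pm z - pe (R z)) * pd (0, axis j 1) (\<lambda>z. \<phi> z * U j z) z
           + \<phi> z * (M j z - R z * U j z) * Q' (R z) * pd (0, axis j 1) R z)"
  shows "integrable cell_measure X" "(\<integral>z. X z \<partial>cell_measure) = 0"
proof -
  have \<phi>1: "Ck (Suc 0) \<phi>" using \<phi> by (simp add: testable_def)
  have cid: "continuous_on UNIV (\<lambda>s. s * Q' s)" by (intro continuous_intros Q)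
  define \<psi> where "\<psi> i z = \<phi> z * U i z" for i z
  define \<psi>2 where "\<psi>2 i z = \<phi> z * (1 / 2 * (U i z * U i z))" for i z
  define \<psi>Q where "\<psi>Q z = \<phi> z * Q (R z)" for z
  define \<psi>p where "\<psi>p i z = \<psi> i z * pe (R z)" for i z
  define \<psi>t where "\<psi>t z = \<phi> z * pe (R z)" for z
  have QR: "Ck (Suc 0) (\<lambda>z. Q (R z))" "space_periodic (\<lambda>z. Q (R z))"
    and pR: "Ck (Suc 0) (\<lambda>z. pe (R z))" "space_periodic (\<lambda>z. pe (R z))"
    using C1_compose[OF R(1) Q(1,2)] C1_compose[OF R(1) Q(3) cid] R(2) by (auto simp: space_periodic_def)
  have UU: "Ck (Suc 0) (\<lambda>z. 1 / 2 * (U i z * U i z))" "space_periodic (\<lambda>z. 1 / 2 * (U i z * U i z))" for i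
    by (rule C1_cmult[OF C1_mult[OF U(1) U(1)]]) (use U(2) in \<open>simp add: space_periodic_def\<close>)
  have t: "testable a b (\<psi> i)" "testable a b (\<psi>2 i)" "testable a b \<psi>Q" "testable a b (\<psi>p i)" "testable a b \<psi>t" for i
    unfolding \<psi>_def[abs_def] \<psi>2_def[abs_def] \<psi>Q_def[abs_def] \<psi>p_def[abs_def] \<psi>t_def[abs_def]
    by (intro testable_mult \<phi> U UU QR pR)+
  have pd\<psi>: "pd c (\<psi> i) z = \<phi> z * pd c (U i) z + pd c \<phi> z * U i z" for c i z
    unfolding \<psi>_def[abs_def] by (rule pd_mult[OF \<phi>1 U(1)])
  have pd\<psi>2: "pd c (\<psi>2 i) z = \<phi> z * (U i z * pd c (U i) z) + pd c \<phi> z * (1 / 2 * (U i z * U i z))" for c i z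
    unfolding \<psi>2_def[abs_def] pd_mult[OF \<phi>1 UU(1)] pd_cmult[OF C1_mult[OF U(1) U(1)]] pd_mult[OF U(1) U(1)]
    by (simp add: algebra_simps)
  have pd\<psi>Q: "pd c \<psi>Q z = \<phi> z * (Q' (R z) * pd c R z) + pd c \<phi> z * Q (R z)" for c z
    unfolding \<psi>Q_def[abs_def] pd_mult[OF \<phi>1 QR(1)] pd_compose[OF R(1) Q(1,2)] ..
  have \<psi>1: "Ck (Suc 0) (\<psi> i)" for i using t(1) by (simp add: testable_def)
  have pd\<psi>p: "pd c (\<psi>p i) z = \<psi> i z * (R z * Q' (R z) * pd c R z) + pd c (\<psi> i) z * pe (R z)" for c i z
    unfolding \<psi>p_def[abs_def] pd_mult[OF \<psi>1 pR(1)] pd_compose[OF R(1) Q(3) cid] ..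
  have pd\<psi>t: "pd c \<psi>t z = \<phi> z * (R z * Q' (R z) * pd c R z) + pd c \<phi> z * pe (R z)" for c z
    unfolding \<psi>t_def[abs_def] pd_mult[OF \<phi>1 pR(1)] pd_compose[OF R(1) Q(3) cid] ..
  define A where "A i z = M i z * pd (1, 0) (\<psi> i) z + (\<Sum>j\<in>UNIV. (F i j z + (if i = j then Pm z else 0)) * pd (0, axis j 1) (\<psi> i) z)" for i z
  define B where "B i z = R z * pd (1, 0) (\<psi>2 i) z + (\<Sum>j\<in>UNIV. M j z * pd (0, axis j 1) (\<psi>2 i) z)" for i z
  define Cc where "Cc z = R z * pd (1, 0) \<psi>Q z + (\<Sum>j\<in>UNIV. M j z * pd (0, axis j 1) \<psi>Q z)" for z
  have zero: "(\<integral>z. A i z \<partial>cell_measure) = 0" "(\<integral>z. B i z \<partial>cell_measure) = 0" "(\<integral>z. Cc z \<partial>cell_measure) = 0"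
    "(\<integral>z. pd (0, axis i 1) (\<psi>p i) z \<partial>cell_measure) = 0" "(\<integral>z. pd (1, 0) \<psi>t z \<partial>cell_measure) = 0" for i
    unfolding A_def B_def Cc_def by (rule mom[OF t(1)] mass[OF t(2)] mass[OF t(3)] ibp[OF t(4)] ibp[OF t(5)])+
  have Rc: "continuous_on UNIV R" by (rule C1_continuous[OF R(1)])
  have FP: "continuous_on UNIV (\<lambda>z. F i j z + (if i = j then Pm z else 0))" "space_periodic (\<lambda>z. F i j z + (if i = j then Pm z else 0))" for i j
    using F Pm by (cases "i = j"; auto intro!: continuous_intros simp: space_periodic_def)+
  have int: "integrable cell_measure (A i)" "integrable cell_measure (B i)" "integrable cell_measure Cc"
    "integrable cell_measure (\<lambda>z. pd (0, axis i 1) (\<psi>p i) z)" "integrable cell_measure (\<lambda>z. pd (1, 0) \<psi>t z)" for i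
  proof -
    show "integrable cell_measure (A i)" unfolding A_def[abs_def]
      by (intro Bochner_Integration.integrable_add Bochner_Integration.integrable_sum integrable_mult_pd[OF t(1)] M FP)
    show "integrable cell_measure (B i)" unfolding B_def[abs_def]
      by (intro Bochner_Integration.integrable_add Bochner_Integration.integrable_sum integrable_mult_pd[OF t(2)] M Rc R)
    show "integrable cell_measure Cc" unfolding Cc_def[abs_def]
      by (intro Bochner_Integration.integrable_add Bochner_Integration.integrable_sum integrable_mult_pd[OF t(3)] M Rc R)
    have one: "continuous_on UNIV (\<lambda>_ :: real \<times> (real ^ 'd). 1 :: real)" "space_periodic (\<lambda>_ :: real \<times> (real ^ 'd). 1 :: real)"
      by (auto simp: space_periodic_def)
    show "integrable cell_measure (\<lambda>z. pd (0, axis i 1) (\<psi>p i) z)" "integrable cell_measure (\<lambda>z. pd (1, 0) \<psi>t z)"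
      using integrable_mult_pd[OF t(4)[of i] one, where c = "(0, axis i 1)"] integrable_mult_pd[OF t(5) one, where c = "(1, 0)"] by simp_all
  qed
  have AB: "A i z - B i z = 1 / 2 * (R z * (U i z)\<^sup>2) * pd (1, 0) \<phi> z + (M i z - R z * U i z) * pd (1, 0) (\<psi> i) z
        + (\<Sum>j\<in>UNIV. 1 / 2 * ((U i z)\<^sup>2 * M j z) * pd (0, axis j 1) \<phi> z
             + (F i j z - M j z * U i z) * pd (0, axis j 1) (\<psi> i) z) + Pm z * pd (0, axis i 1) (\<psi> i) z" for i z
  proof -
    have one: "M i z * pd c (\<psi> i) z - R z * pd c (\<psi>2 i) z
        = 1 / 2 * (R z * (U i z)\<^sup>2) * pd c \<phi> z + (M i z - R z * U i z) * pd c (\<psi> i) z" for c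
      unfolding pd\<psi> pd\<psi>2 by (simp add: algebra_simps power2_eq_square)
    have two: "(F i j z + (if i = j then Pm z else 0)) * pd c (\<psi> i) z - M j z * pd c (\<psi>2 i) z
        = 1 / 2 * ((U i z)\<^sup>2 * M j z) * pd c \<phi> z + (F i j z - M j z * U i z) * pd c (\<psi> i) z
          + (if i = j then Pm z * pd c (\<psi> i) z else 0)" for c j
      unfolding pd\<psi> pd\<psi>2 by (simp add: algebra_simps power2_eq_square)
    have "A i z - B i z = (M i z * pd (1, 0) (\<psi> i) z - R z * pd (1, 0) (\<psi>2 i) z)
      + (\<Sum>j\<in>UNIV. (F i j z + (if i = j then Pm z else 0)) * pd (0, axis j 1) (\<psi> i) z - M j z * pd (0, axis j 1) (\<psi>2 i) z)"
      unfolding A_def B_def sum_subtractf by simp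
    also have "\<dots> = 1 / 2 * (R z * (U i z)\<^sup>2) * pd (1, 0) \<phi> z + (M i z - R z * U i z) * pd (1, 0) (\<psi> i) z
        + (\<Sum>j\<in>UNIV. (1 / 2 * ((U i z)\<^sup>2 * M j z) * pd (0, axis j 1) \<phi> z
             + (F i j z - M j z * U i z) * pd (0, axis j 1) (\<psi> i) z) + (if i = j then Pm z * pd (0, axis j 1) (\<psi> i) z else 0))"
      unfolding one two ..
    also have "\<dots> = 1 / 2 * (R z * (U i z)\<^sup>2) * pd (1, 0) \<phi> z + (M i z - R z * U i z) * pd (1, 0) (\<psi> i) z
        + ((\<Sum>j\<in>UNIV. (1 / 2 * ((U i z)\<^sup>2 * M j z) * pd (0, axis j 1) \<phi> z
             + (F i j z - M j z * U i z) * pd (0, axis j 1) (\<psi> i) z)) + Pm z * pd (0, axis i 1) (\<psi> i) z)"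
      unfolding sum.distrib[of _ "\<lambda>j. if i = j then Pm z * pd (0, axis j 1) (\<psi> i) z else 0"] by simp
    finally show ?thesis by simp
  qed
  have CDE: "Cc z - (\<Sum>j\<in>UNIV. pd (0, axis j 1) (\<psi>p j) z) - pd (1, 0) \<psi>t z
      = (R z * Q (R z) - pe (R z)) * pd (1, 0) \<phi> z
      + (\<Sum>j\<in>UNIV. Q (R z) * M j z * pd (0, axis j 1) \<phi> z - pe (R z) * pd (0, axis j 1) (\<psi> j) z
           + \<phi> z * (M j z - R z * U j z) * Q' (R z) * pd (0, axis j 1) R z)" for z
  proof -
    have "M j z * pd c \<psi>Q z - pd c (\<psi>p j) z = Q (R z) * M j z * pd c \<phi> z - pe (R z) * pd c (\<psi> j) z
           + \<phi> z * (M j z - R z * U j z) * Q' (R z) * pd c R z" for c j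
      unfolding pd\<psi>Q pd\<psi>p \<psi>_def by (simp add: algebra_simps)
    moreover have "R z * pd c \<psi>Q z - pd c \<psi>t z = (R z * Q (R z) - pe (R z)) * pd c \<phi> z" for c
      unfolding pd\<psi>Q pd\<psi>t by (simp add: algebra_simps)
    moreover have "Cc z - (\<Sum>j\<in>UNIV. pd (0, axis j 1) (\<psi>p j) z) - pd (1, 0) \<psi>t z
      = (R z * pd (1, 0) \<psi>Q z - pd (1, 0) \<psi>t z) + (\<Sum>j\<in>UNIV. M j z * pd (0, axis j 1) \<psi>Q z - pd (0, axis j 1) (\<psi>p j) z)"
      unfolding Cc_def sum_subtractf by simp
    ultimately show ?thesis by simp
  qed
  have X: "X z = (\<Sum>i\<in>UNIV. A i z - B i z) + (Cc z - (\<Sum>j\<in>UNIV. pd (0, axis j 1) (\<psi>p j) z) - pd (1, 0) \<psi>t z)" for z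
  proof -
    have "(\<Sum>j\<in>UNIV. Q (R z) * M j z * pd (0, axis j 1) \<phi> z
           + (Pm z - pe (R z)) * pd (0, axis j 1) (\<psi> j) z
           + \<phi> z * (M j z - R z * U j z) * Q' (R z) * pd (0, axis j 1) R z)
      = (\<Sum>j\<in>UNIV. Q (R z) * M j z * pd (0, axis j 1) \<phi> z - pe (R z) * pd (0, axis j 1) (\<psi> j) z
           + \<phi> z * (M j z - R z * U j z) * Q' (R z) * pd (0, axis j 1) R z)
        + (\<Sum>j\<in>UNIV. Pm z * pd (0, axis j 1) (\<psi> j) z)"
      unfolding sum.distrib[symmetric] by (intro sum.cong refl) (simp add: algebra_simps)
    then show ?thesis
      unfolding X_def AB CDE \<psi>_def[abs_def]
      by (simp add: sum.distrib)
  qed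
  show "integrable cell_measure X"
    unfolding X[abs_def] using int by (intro Bochner_Integration.integrable_add Bochner_Integration.integrable_sum Bochner_Integration.integrable_diff)
  show "(\<integral>z. X z \<partial>cell_measure) = 0"
    unfolding X using int zero by simp
qed

section \<open>Passage to the limit\<close>

lemma conv_add_if:
  fixes f h g :: "'a::euclidean_space \<Rightarrow> real"
  assumes "integrable lborel (\<lambda>y. g y * f (z - y))" "integrable lborel (\<lambda>y. g y * h (z - y))"
  shows "conv g (\<lambda>z. f z + (if P then h z else 0)) z = conv g f z + (if P then conv g h z else 0)"
  using assms by (cases P) (auto simp: conv_def distrib_left)

lemma integrable_dilated_conv:
  fixes f g :: "'a::euclidean_space \<Rightarrow> real"
  assumes f: "ball_integrable f" and k: "continuous_on UNIV k" "\<And>y. norm y > 1 \<Longrightarrow> k y = 0" and e: "0 < e" "e \<le> 1"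
  shows "integrable lborel (\<lambda>y. dilated k e y * f (z - y))"
proof -
  have c: "continuous_on UNIV (dilated k e)"
    unfolding dilated_def[abs_def] using e by (intro continuous_intros continuous_on_compose2[OF k(1)]) auto
  have s: "dilated k e y = 0" if "norm y > 1" for y
  proof -
    have "norm y \<le> norm y / e" using e by (simp add: field_simps mult_left_le_one_le)
    then have "norm ((1 / e) *\<^sub>R y) > 1" using that e by simp
    then show ?thesis using k(2) by (simp add: dilated_def)
  qed
  show ?thesis using integrable_dilated[OF f c s, of 1 z] by simp
qed

lemma time_supported_mult:
  assumes "time_supported a b \<phi>"
  shows "time_supported a b (\<lambda>z. \<phi> z * f z)"
  using assms by (auto simp: time_supported_def)

text \<open>
This is how a bound for all small mollification parameters yields an exact identity.
\<close>

lemma vanishing_limit: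
  assumes "0 < (e0::real)" "0 < \<sigma>" "\<And>e. 0 < e \<Longrightarrow> e < e0 \<Longrightarrow> \<bar>J\<bar> \<le> C * e powr \<sigma>"
  shows "J = (0::real)"
proof -
  have "((\<lambda>e. C * e powr \<sigma>) \<longlongrightarrow> C * 0 powr \<sigma>) (at_right 0)"
    using assms(2) by (intro tendsto_intros tendsto_powr') (auto simp: eventually_at_right_field intro!: exI[of _ 1])
  moreover have "\<forall>\<^sub>F e in at_right 0. \<bar>J\<bar> \<le> C * e powr \<sigma>"
    unfolding eventually_at_right_field using assms by (intro exI[of _ e0]) auto
  ultimately have "\<bar>J\<bar> \<le> C * 0 powr \<sigma>"
    by (intro tendsto_lowerbound[OF _ _ trivial_limit_at_right_real]) auto
  then show ?thesis using assms(2) by simp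
qed

text \<open>
The integrand \<open>Y\<close> of the claim and the integrand \<open>X e\<close> of \<open>mollified_energy_identity\<close> differ by terms
of order \<open>\<sigma> > 0\<close> in \<open>L\<^sup>1\<close>, where \<open>\<sigma>\<close> is the least of \<open>\<alpha>\<close>, \<open>\<beta>\<close>, \<open>2 \<alpha> + \<beta> - 1\<close> and \<open>\<alpha> + \<gamma> \<beta> - 1\<close>; the
integral of \<open>X e\<close> is \<open>0\<close>.
\<close>

lemma borel_energy_balance:
  fixes \<rho> \<phi> \<eta> :: "real \<times> (real ^ 'd) \<Rightarrow> real" and u :: "'d \<Rightarrow> real \<times> (real ^ 'd) \<Rightarrow> real" and p P p' :: "real \<Rightarrow> real"
  assumes \<eta>: "mollifier \<eta>" and e0: "0 < e0" "e0 \<le> 1" and ab: "0 < a - e0" "b + e0 < T"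
    and lohi: "0 \<le> lo" "\<And>z. \<rho> z \<in> {lo..hi}"
    and \<rho>m: "\<rho> \<in> borel_measurable borel" "space_periodic \<rho>" and u: "\<And>i. strip_integrable (u i)"
    and m: "\<And>i. strip_integrable (\<lambda>z. \<rho> z * u i z)" and mu: "\<And>i j. strip_integrable (\<lambda>z. \<rho> z * u j z * u i z)"
    and p\<rho>: "strip_integrable (\<lambda>z. p (\<rho> z))"
    and mass: "balance T \<rho> (\<lambda>j z. \<rho> z * u j z)"
    and mom: "\<And>i. balance T (\<lambda>z. \<rho> z * u i z) (\<lambda>j z. \<rho> z * u j z * u i z + (if i = j then p (\<rho> z) else 0))"
    and iu: "\<And>i. increment_order a b e0 \<theta> \<alpha> (u i)" and i\<rho>: "increment_order a b e0 \<kappa> \<beta> \<rho>"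
    and im: "\<And>i. increment_order a b e0 \<kappa> \<beta> (\<lambda>z. \<rho> z * u i z)"
    and tu: "\<And>i. Lp_order (strip_measure a b) e0 \<theta> 0 (\<lambda>e. u i)" and tm: "\<And>i. Lp_order (strip_measure a b) e0 \<kappa> 0 (\<lambda>e z. \<rho> z * u i z)"
    and \<theta>: "0 \<le> \<theta>" "0 \<le> \<kappa>" "2 * \<theta> + \<kappa> \<le> 1" "\<theta> + 2 * \<kappa> \<le> 1"
    and \<alpha>: "0 < \<alpha>" "\<alpha> \<le> 1" "0 < \<beta>" "\<beta> \<le> 1" and \<gamma>: "1 < \<gamma>" "\<gamma> < 2" "\<alpha> + \<gamma> * \<beta> > 1" "2 * \<alpha> + \<beta> > 1"
    and C: "0 \<le> C" and h0: "e0 powr \<beta> \<le> h0"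
    and taylor: "\<And>s t. s \<in> {lo..hi} \<Longrightarrow> t \<in> {lo..hi} \<Longrightarrow> \<bar>p s - p t - p' t * (s - t)\<bar> \<le> C * \<bar>s - t\<bar> powr \<gamma>"
    and reg: "\<And>h. 0 < h \<Longrightarrow> h < h0 \<Longrightarrow> \<exists>Q Q' pe. regularised_potential lo hi p P \<gamma> C h Q Q' pe"
    and \<phi>: "testable a b \<phi>"
  shows "(\<integral>z. (\<Sum>i\<in>UNIV. 1 / 2 * (\<rho> z * (u i z)\<^sup>2) * pd (1, 0) \<phi> z
             + (\<Sum>j\<in>UNIV. 1 / 2 * ((u i z)\<^sup>2 * (\<rho> z * u j z)) * pd (0, axis j 1) \<phi> z))
          + P (\<rho> z) * pd (1, 0) \<phi> z
          + (\<Sum>j\<in>UNIV. (p (\<rho> z) + P (\<rho> z)) * u j z * pd (0, axis j 1) \<phi> z) \<partial>cell_measure) = 0"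
proof -
  note mD = mollifierD[OF \<eta>]
  have "\<exists>t. 0 < e \<and> e < e0 \<longrightarrow> regularised_potential lo hi p P \<gamma> C (e powr \<beta>) (fst t) (fst (snd t)) (snd (snd t))" for e
  proof (cases "0 < e \<and> e < e0")
    case True
    then have "e powr \<beta> < e0 powr \<beta>" using \<alpha> by (intro powr_less_mono2) auto
    then obtain Q Q' pe where "regularised_potential lo hi p P \<gamma> C (e powr \<beta>) Q Q' pe"
      using reg[of "e powr \<beta>"] True h0 by auto
    then show ?thesis by (intro exI[of _ "(Q, Q', pe)"]) simp
  qed blast
  then obtain tt where tt: "\<And>e. 0 < e \<Longrightarrow> e < e0 \<Longrightarrow> regularised_potential lo hi p P \<gamma> C (e powr \<beta>) (fst (tt e)) (fst (snd (tt e))) (snd (snd (tt e)))"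
    by metis
  define Q Q' pe where "Q e = fst (tt e)" and "Q' e = fst (snd (tt e))" and "pe e = snd (snd (tt e))" for e
  have reg: "regularised_potential lo hi p P \<gamma> C (e powr \<beta>) (Q e) (Q' e) (pe e)" if "0 < e" "e < e0" for e
    unfolding Q_def Q'_def pe_def by (rule tt[OF that])
  define g where "g e = dilated \<eta> e" for e
  have g: "smooth (g e)" "\<And>y. norm y > e \<Longrightarrow> g e y = 0" "\<And>y. g e (- y) = g e y" if "0 < e" for e
    unfolding g_def by (rule dilated_mollifier[OF \<eta> that]; assumption)+
  have abs\<rho>: "\<bar>\<rho> z\<bar> \<le> hi" for z using lohi(2)[of z] lohi(1) by auto
  have s\<rho>: "strip_integrable \<rho>"
    by (rule strip_integrable_bounded[OF \<rho>m abs\<rho>])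
  note ball = strip_integrable_ball
  define R where "R e = conv (g e) \<rho>" for e
  define U where "U e i = conv (g e) (u i)" for e i
  define M where "M e i = conv (g e) (\<lambda>z. \<rho> z * u i z)" for e i
  define F where "F e i j = conv (g e) (\<lambda>z. \<rho> z * u j z * u i z)" for e i j
  define Pm where "Pm e = conv (g e) (\<lambda>z. p (\<rho> z))" for e
  have cs: "Ck (Suc 0) (conv (g e) f)" "continuous_on UNIV (conv (g e) f)" "space_periodic (conv (g e) f)"
    if "0 < e" "strip_integrable f" for e f
  proof -
    show *: "Ck (Suc 0) (conv (g e) f)"
      by (rule smooth_C1[OF conv_smooth[OF g(1)[OF that(1)] g(2)[OF that(1)] ball[OF that(2)]]])
    show "continuous_on UNIV (conv (g e) f)" by (rule C1_continuous[OF *])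
    show "space_periodic (conv (g e) f)" by (rule conv_periodic[OF strip_integrableD(2)[OF that(2)]])
  qed
  have Rin: "R e z \<in> {lo..hi}" if "0 < e" for e z
    unfolding R_def g_def by (rule conv_in_interval[OF \<eta> e0(2) ball[OF s\<rho>] lohi(2) that])
  define X where "X e z =
      (\<Sum>i\<in>UNIV. 1 / 2 * (R e z * (U e i z)\<^sup>2) * pd (1, 0) \<phi> z + (M e i z - R e z * U e i z) * pd (1, 0) (\<lambda>z. \<phi> z * U e i z) z
        + (\<Sum>j\<in>UNIV. 1 / 2 * ((U e i z)\<^sup>2 * M e j z) * pd (0, axis j 1) \<phi> z
             + (F e i j z - M e j z * U e i z) * pd (0, axis j 1) (\<lambda>z. \<phi> z * U e i z) z))
      + (R e z * Q e (R e z) - pe e (R e z)) * pd (1, 0) \<phi> z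
      + (\<Sum>j\<in>UNIV. Q e (R e z) * M e j z * pd (0, axis j 1) \<phi> z
           + (Pm e z - pe e (R e z)) * pd (0, axis j 1) (\<lambda>z. \<phi> z * U e j z) z
           + \<phi> z * (M e j z - R e z * U e j z) * Q' e (R e z) * pd (0, axis j 1) (R e) z)" for e z
  have X0: "integrable cell_measure (X e)" "(\<integral>z. X e z \<partial>cell_measure) = 0" if e: "0 < e" "e < e0" for e
  proof -
    have abe: "0 < a - e" "b + e < T" using ab e by auto
    note gg = g[OF e(1)]
    have mass': "(\<integral>z. R e z * pd (1, 0) \<psi> z + (\<Sum>j\<in>UNIV. M e j z * pd (0, axis j 1) \<psi> z) \<partial>cell_measure) = 0"
      if "testable a b \<psi>" for \<psi>
      unfolding R_def M_def by (rule mollified_balance[OF mass s\<rho> m gg that abe])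
    have flux: "strip_integrable (\<lambda>z. \<rho> z * u j z * u i z + (if i = j then p (\<rho> z) else 0))" for i j
    proof (cases "i = j")
      case True
      then show ?thesis using mu[of j i] p\<rho> unfolding strip_integrable_def
        by (auto simp: space_periodic_def distrib_left)
    qed (use mu[of j i] in simp)
    have ci: "conv (g e) (\<lambda>z. \<rho> z * u j z * u i z + (if i = j then p (\<rho> z) else 0)) z = F e i j z + (if i = j then Pm e z else 0)" for i j z
      unfolding F_def Pm_def g_def
      by (rule conv_add_if) (rule integrable_dilated_conv[OF ball mD(6,2) e(1)]; use mu p\<rho> e e0 in simp)+
    have mom': "(\<integral>z. M e i z * pd (1, 0) \<psi> z + (\<Sum>j\<in>UNIV. (F e i j z + (if i = j then Pm e z else 0)) * pd (0, axis j 1) \<psi> z) \<partial>cell_measure) = 0"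
      if "testable a b \<psi>" for \<psi> i
      using mollified_balance[OF mom m flux gg that abe, of i] unfolding ci M_def .
    have r: "continuous_on UNIV (Q' e)" "\<And>s. (Q e has_real_derivative Q' e s) (at s)" "\<And>s. (pe e has_real_derivative s * Q' e s) (at s)"
      using reg[OF e] unfolding regularised_potential_def by blast+
    note id = mollified_energy_identity[OF \<phi> _ _ _ _ _ _ _ _ _ _ mass' mom' integral_pd_zero[OF \<eta>] r(2,1,3)]
    show "integrable cell_measure (X e)" unfolding X_def[abs_def]
      by (rule id) (auto simp only: R_def U_def M_def F_def Pm_def intro!: cs e s\<rho> u m mu p\<rho>)
    show "(\<integral>z. X e z \<partial>cell_measure) = 0" unfolding X_def
      by (rule id) (auto simp only: R_def U_def M_def F_def Pm_def intro!: cs e s\<rho> u m mu p\<rho>)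
  qed
  let ?T = "Lp_order (strip_measure a b) e0"
  have bdd: "?T 0 0 (\<lambda>e z. f z)" if f: "continuous_on UNIV f" "space_periodic f" "time_supported a b f" for f
  proof -
    obtain B where "0 \<le> B" "\<And>z. \<bar>f z\<bar> \<le> B" by (rule periodic_bounded[OF f]) blast
    then show ?thesis by (intro Lp_order_bounded[where C = B]) simp
  qed
  have \<phi>': "Ck (Suc 0) \<phi>" "space_periodic \<phi>" "time_supported a b \<phi>" using \<phi> by (auto simp: testable_def)
  have t\<phi>: "?T 0 0 (\<lambda>e z. \<phi> z)" by (rule bdd[OF C1_continuous[OF \<phi>'(1)] \<phi>'(2,3)])
  have t\<phi>': "?T 0 0 (\<lambda>e z. pd c \<phi> z)" for c
    by (rule bdd[OF pd_continuous[OF \<phi>'(1)] pd_periodic[OF \<phi>'(1,2)] pd_time_supported[OF \<phi>'(3)]])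
  have absR: "\<bar>R e z\<bar> \<le> hi" if "0 < e" for e z using Rin[OF that, of z] lohi(1) by auto
  have tR: "?T 0 0 (\<lambda>e z. R e z)"
    by (rule Lp_order_bounded[where C = hi]) (use absR in simp)
  have \<theta>1: "\<theta> \<le> 1" "\<kappa> \<le> 1" "\<theta> + \<kappa> \<le> 1" "\<kappa> + \<theta> \<le> 1" using \<theta> by auto
  have dR: "?T \<kappa> \<beta> (\<lambda>e z. R e z - \<rho> z)" unfolding R_def g_def
    by (rule Lp_order_mollification_error[OF \<eta> e0(2) ball[OF s\<rho>] i\<rho> \<theta>(2) \<theta>1(2)])
  have dU: "?T \<theta> \<alpha> (\<lambda>e z. U e i z - u i z)" for i unfolding U_def g_def
    by (rule Lp_order_mollification_error[OF \<eta> e0(2) ball[OF u] iu \<theta>(1) \<theta>1(1)])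
  have dM: "?T \<kappa> \<beta> (\<lambda>e z. M e i z - \<rho> z * u i z)" for i unfolding M_def g_def
    by (rule Lp_order_mollification_error[OF \<eta> e0(2) ball[OF m] im \<theta>(2) \<theta>1(2)])
  have weaken: "?T t s' D" if "?T t s D" "s' \<le> s" for t s s' D
    by (rule Lp_order_mono[OF that(1) _ e0(2) order_refl that(2), of 1]) auto
  have tU: "?T \<theta> 0 (\<lambda>e z. U e i z)" for i
    using Lp_order_add[OF weaken[OF dU[of i], of 0] tu[of i] \<theta>(1)] \<alpha> by simp
  have tM: "?T \<kappa> 0 (\<lambda>e z. M e i z)" for i
    using Lp_order_add[OF weaken[OF dM[of i], of 0] tm[of i] \<theta>(2)] \<alpha> by simp
  have pU: "?T \<theta> (\<alpha> - 1) (\<lambda>e z. pd c (U e i) z)" for c i unfolding U_def g_def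
    by (rule Lp_order_pd_mollification[OF \<eta> e0(2) ball[OF u] iu \<theta>(1) \<theta>1(1)])
  have pR: "?T \<kappa> (\<beta> - 1) (\<lambda>e z. pd c (R e) z)" for c unfolding R_def g_def
    by (rule Lp_order_pd_mollification[OF \<eta> e0(2) ball[OF s\<rho>] i\<rho> \<theta>(2) \<theta>1(2)])
  have p\<psi>: "?T \<theta> (\<alpha> - 1) (\<lambda>e z. pd c (\<lambda>z. \<phi> z * U e i z) z)" for c i
  proof -
    have "?T \<theta> (\<alpha> - 1) (\<lambda>e z. \<phi> z * pd c (U e i) z)"
      using Lp_order_mult[OF t\<phi> pU[of i c]] \<theta> by simp
    moreover have "?T \<theta> (\<alpha> - 1) (\<lambda>e z. pd c \<phi> z * U e i z)"
      using weaken[OF Lp_order_mult[OF t\<phi>'[of c] tU[of i]], of "\<alpha> - 1"] \<theta> \<alpha> by simp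
    ultimately have "?T \<theta> (\<alpha> - 1) (\<lambda>e z. \<phi> z * pd c (U e i) z + pd c \<phi> z * U e i z)"
      by (rule Lp_order_add) (rule \<theta>)
    then show ?thesis
    proof (rule Lp_order_cong[OF _ e0(2)])
      fix e :: real assume e: "0 < e"
      have "Ck (Suc 0) (U e i)" unfolding U_def by (rule cs[OF e u])
      from pd_mult[OF \<phi>'(1) this] show "AE z in strip_measure a b. pd c (\<lambda>z. \<phi> z * U e i z) z = \<phi> z * pd c (U e i) z + pd c \<phi> z * U e i z"
        by simp
    qed
  qed
  have c1: "?T (\<kappa> + \<theta>) (\<beta> + \<alpha>) (\<lambda>e z. M e i z - R e z * U e i z)" for i
    unfolding M_def R_def U_def g_def
    by (rule Lp_order_commutator[OF \<eta> e0(2) ball[OF s\<rho>] i\<rho> ball[OF u] iu ball[OF m] \<theta>(2,1) \<theta>1(4)])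
  have c2: "?T (\<kappa> + \<theta>) (\<beta> + \<alpha>) (\<lambda>e z. F e i j z - M e j z * U e i z)" for i j
    unfolding M_def F_def U_def g_def
    by (rule Lp_order_commutator[OF \<eta> e0(2) ball[OF m] im ball[OF u] iu ball[OF mu] \<theta>(2,1) \<theta>1(4)])
  define \<sigma> where "\<sigma> = min (min \<alpha> \<beta>) (min (2 * \<alpha> + \<beta> - 1) (\<alpha> + \<gamma> * \<beta> - 1))"
  have \<sigma>: "0 < \<sigma>" "\<sigma> \<le> \<alpha>" "\<sigma> \<le> \<beta>" "\<sigma> \<le> 2 * \<alpha> + \<beta> - 1" "\<sigma> \<le> \<alpha> + \<gamma> * \<beta> - 1"
    unfolding \<sigma>_def using \<alpha> \<gamma> by auto
  have up: "?T 1 \<sigma> D" if "?T t s D" "t \<le> 1" "\<sigma> \<le> s" for t s D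
    by (rule Lp_order_mono[OF that(1) _ e0(2) that(2,3), of 1]) auto
  \<comment> \<open>kinetic energy and its flux: differences of products are expanded in mollification errors\<close>
  have k1: "?T 1 \<sigma> (\<lambda>e z. (\<rho> z * (u i z)\<^sup>2 - R e z * (U e i z)\<^sup>2) * pd c \<phi> z)" for i c
  proof -
    have "?T (\<kappa> + (\<theta> + \<theta>) + 0) (\<beta> + (0 + 0) + 0) (\<lambda>e z. (R e z - \<rho> z) * (u i z * u i z) * pd c \<phi> z)"
      using \<theta> by (intro Lp_order_mult dR tu t\<phi>') auto
    then have "?T 1 \<sigma> (\<lambda>e z. (R e z - \<rho> z) * (u i z * u i z) * pd c \<phi> z)" by (rule up) (use \<theta> \<sigma> in auto)
    moreover have "?T (0 + (\<theta> + \<theta>) + 0) (0 + (\<alpha> + 0) + 0) (\<lambda>e z. R e z * ((U e i z - u i z) * (U e i z + u i z)) * pd c \<phi> z)"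
      using \<theta> by (intro Lp_order_mult tR dU Lp_order_add[OF tU tu] t\<phi>') auto
    then have "?T 1 \<sigma> (\<lambda>e z. R e z * ((U e i z - u i z) * (U e i z + u i z)) * pd c \<phi> z)" by (rule up) (use \<theta> \<sigma> in auto)
    ultimately have "?T 1 \<sigma> (\<lambda>e z. -1 * ((R e z - \<rho> z) * (u i z * u i z) * pd c \<phi> z + R e z * ((U e i z - u i z) * (U e i z + u i z)) * pd c \<phi> z))"
      by (intro Lp_order_cmult[OF _ e0(2)] Lp_order_add) auto
    then show ?thesis
      by (rule Lp_order_cong[OF _ e0(2)]) (intro AE_I2, simp add: algebra_simps power2_eq_square)
  qed
  have k2: "?T 1 \<sigma> (\<lambda>e z. ((u i z)\<^sup>2 * (\<rho> z * u j z) - (U e i z)\<^sup>2 * M e j z) * pd c \<phi> z)" for i j c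
  proof -
    have "?T ((\<theta> + \<theta>) + \<kappa> + 0) ((\<alpha> + 0) + 0 + 0) (\<lambda>e z. (U e i z - u i z) * (U e i z + u i z) * (\<rho> z * u j z) * pd c \<phi> z)"
      using \<theta> by (intro Lp_order_mult dU Lp_order_add[OF tU tu] tm t\<phi>') auto
    then have "?T 1 \<sigma> (\<lambda>e z. (U e i z - u i z) * (U e i z + u i z) * (\<rho> z * u j z) * pd c \<phi> z)" by (rule up) (use \<theta> \<sigma> in auto)
    moreover have "?T ((\<theta> + \<theta>) + \<kappa> + 0) ((0 + 0) + \<beta> + 0) (\<lambda>e z. (U e i z * U e i z) * (M e j z - \<rho> z * u j z) * pd c \<phi> z)"
      using \<theta> by (intro Lp_order_mult tU dM t\<phi>') auto
    then have "?T 1 \<sigma> (\<lambda>e z. (U e i z * U e i z) * (M e j z - \<rho> z * u j z) * pd c \<phi> z)" by (rule up) (use \<theta> \<sigma> in auto)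
    ultimately have "?T 1 \<sigma> (\<lambda>e z. -1 * ((U e i z - u i z) * (U e i z + u i z) * (\<rho> z * u j z) * pd c \<phi> z + (U e i z * U e i z) * (M e j z - \<rho> z * u j z) * pd c \<phi> z))"
      by (intro Lp_order_cmult[OF _ e0(2)] Lp_order_add) auto
    then show ?thesis
      by (rule Lp_order_cong[OF _ e0(2)]) (intro AE_I2, simp add: algebra_simps power2_eq_square)
  qed
  have regD: "\<bar>Q e s\<bar> \<le> C" "\<bar>Q' e s\<bar> \<le> C * e powr (\<beta> * (\<gamma> - 2))" "\<bar>pe e s - p s\<bar> \<le> C * e powr (\<beta> * \<gamma>)"
      "\<bar>s * Q e s - pe e s - P s\<bar> \<le> C * e powr \<beta>"
    if "0 < e" "e < e0" "s \<in> {lo..hi}" for e s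
    using reg[OF that(1,2)] that(3) unfolding regularised_potential_def powr_powr by blast+
  have regL: "\<bar>pe e s - pe e t\<bar> \<le> C * \<bar>s - t\<bar>" "\<bar>(s * Q e s - pe e s) - (t * Q e t - pe e t)\<bar> \<le> C * \<bar>s - t\<bar>"
    if "0 < e" "e < e0" "s \<in> {lo..hi}" "t \<in> {lo..hi}" for e s t
    using reg[OF that(1,2)] that(3,4) unfolding regularised_potential_def by blast+
  have tQ: "?T 0 0 (\<lambda>e z. Q e (R e z))"
    by (rule Lp_order_bounded[where C = C]) (use regD(1) Rin in simp)
  have tQ': "?T 0 (\<beta> * (\<gamma> - 2)) (\<lambda>e z. Q' e (R e z))"
    by (rule Lp_order_bounded[where C = C]) (use regD(2) Rin in simp)
  \<comment> \<open>potential energy: the regularised potential is uniformly Lipschitz and \<open>O(e\<^sup>\<beta>)\<close>-close to \<open>P\<close>\<close>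
  have k3: "?T 1 \<sigma> (\<lambda>e z. (P (\<rho> z) - (R e z * Q e (R e z) - pe e (R e z))) * pd c \<phi> z)" for c
  proof -
    have "?T 0 \<beta> (\<lambda>e z. P (\<rho> z) - (\<rho> z * Q e (\<rho> z) - pe e (\<rho> z)))"
      by (rule Lp_order_bounded[where C = C]) (use regD(4) lohi(2) in \<open>simp add: abs_minus_commute\<close>)
    then have "?T \<kappa> \<beta> (\<lambda>e z. P (\<rho> z) - (\<rho> z * Q e (\<rho> z) - pe e (\<rho> z)))"
      by (rule Lp_order_mono[OF _ zero_le_one e0(2) \<theta>(2) order_refl]) simp
    moreover have "?T \<kappa> \<beta> (\<lambda>e z. (\<rho> z * Q e (\<rho> z) - pe e (\<rho> z)) - (R e z * Q e (R e z) - pe e (R e z)))"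
      by (rule Lp_order_mono[OF dR C e0(2) order_refl order_refl]) (use regL(2) lohi(2) Rin in \<open>simp add: abs_minus_commute[of "R _ _"]\<close>)
    ultimately have "?T \<kappa> \<beta> (\<lambda>e z. (P (\<rho> z) - (\<rho> z * Q e (\<rho> z) - pe e (\<rho> z))) + ((\<rho> z * Q e (\<rho> z) - pe e (\<rho> z)) - (R e z * Q e (R e z) - pe e (R e z))))"
      by (rule Lp_order_add) (rule \<theta>)
    then have "?T \<kappa> \<beta> (\<lambda>e z. P (\<rho> z) - (R e z * Q e (R e z) - pe e (R e z)))"
      by (rule Lp_order_cong[OF _ e0(2)]) simp
    then have "?T (\<kappa> + 0) (\<beta> + 0) (\<lambda>e z. (P (\<rho> z) - (R e z * Q e (R e z) - pe e (R e z))) * pd c \<phi> z)"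
      using \<theta> by (intro Lp_order_mult t\<phi>') auto
    then show ?thesis by (rule up) (use \<theta>1 \<sigma> in auto)
  qed
  \<comment> \<open>flux of enthalpy: the Lipschitz constant of \<open>Q\<close> grows as \<open>e\<close> decreases, but that of \<open>s Q(s)\<close> does
    not, so \<open>\<rho> (Q(\<rho>) - Q(R))\<close> is at most a multiple of \<open>\<rho> - R\<close>\<close>
  have k4: "?T 1 \<sigma> (\<lambda>e z. ((p (\<rho> z) + P (\<rho> z)) * u j z - Q e (R e z) * M e j z) * pd c \<phi> z)" for j c
  proof -
    have g1: "?T 0 \<beta> (\<lambda>e z. p (\<rho> z) + P (\<rho> z) - \<rho> z * Q e (\<rho> z))"
    proof (rule Lp_order_bounded[where C = "2 * C"], rule AE_I2)
      fix e z assume e: "0 < e" "e < e0"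
      have "e powr (\<beta> * \<gamma>) \<le> e powr \<beta>" using e e0 \<alpha> \<gamma> by (intro powr_mono') auto
      then have "C * e powr (\<beta> * \<gamma>) \<le> C * e powr \<beta>" using C by (intro mult_left_mono) auto
      then show "\<bar>p (\<rho> z) + P (\<rho> z) - \<rho> z * Q e (\<rho> z)\<bar> \<le> 2 * C * e powr \<beta>"
        using regD(3)[OF e lohi(2)[of z]] regD(4)[OF e lohi(2)[of z]] by (simp add: abs_le_iff)
    qed
    have g2: "?T \<kappa> \<beta> (\<lambda>e z. \<rho> z * (Q e (\<rho> z) - Q e (R e z)))"
    proof (rule Lp_order_mono[OF dR _ e0(2) order_refl order_refl, of "3 * C"], use C in simp, rule AE_I2)
      fix e z assume e: "0 < e" "e < e0"
      note L = regL[OF e lohi(2)[of z] Rin[OF e(1), of z]]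
      have "\<bar>\<rho> z - R e z\<bar> * \<bar>Q e (R e z)\<bar> \<le> \<bar>\<rho> z - R e z\<bar> * C"
        using regD(1)[OF e Rin[OF e(1)]] by (intro mult_left_mono) auto
      then have "\<bar>(\<rho> z - R e z) * Q e (R e z)\<bar> \<le> C * \<bar>\<rho> z - R e z\<bar>" by (simp add: abs_mult mult.commute)
      moreover have "\<rho> z * (Q e (\<rho> z) - Q e (R e z)) = ((\<rho> z * Q e (\<rho> z) - pe e (\<rho> z)) - (R e z * Q e (R e z) - pe e (R e z)))
          + (pe e (\<rho> z) - pe e (R e z)) - (\<rho> z - R e z) * Q e (R e z)" by (simp add: algebra_simps)
      ultimately have "\<bar>\<rho> z * (Q e (\<rho> z) - Q e (R e z))\<bar> \<le> 3 * C * \<bar>\<rho> z - R e z\<bar>" using L by linarith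
      then show "\<bar>\<rho> z * (Q e (\<rho> z) - Q e (R e z))\<bar> \<le> 3 * C * \<bar>R e z - \<rho> z\<bar>" by (simp add: abs_minus_commute)
    qed
    have "?T (0 + \<theta> + 0) (\<beta> + 0 + 0) (\<lambda>e z. (p (\<rho> z) + P (\<rho> z) - \<rho> z * Q e (\<rho> z)) * u j z * pd c \<phi> z)"
      using \<theta> by (intro Lp_order_mult g1 tu t\<phi>') auto
    then have a1: "?T 1 \<sigma> (\<lambda>e z. (p (\<rho> z) + P (\<rho> z) - \<rho> z * Q e (\<rho> z)) * u j z * pd c \<phi> z)" by (rule up) (use \<theta>1 \<sigma> in auto)
    have "?T (\<kappa> + \<theta> + 0) (\<beta> + 0 + 0) (\<lambda>e z. (\<rho> z * (Q e (\<rho> z) - Q e (R e z))) * u j z * pd c \<phi> z)"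
      using \<theta> by (intro Lp_order_mult g2 tu t\<phi>') auto
    then have a2: "?T 1 \<sigma> (\<lambda>e z. (\<rho> z * (Q e (\<rho> z) - Q e (R e z))) * u j z * pd c \<phi> z)" by (rule up) (use \<theta>1 \<sigma> in auto)
    have "?T (0 + \<kappa> + 0) (0 + \<beta> + 0) (\<lambda>e z. Q e (R e z) * (M e j z - \<rho> z * u j z) * pd c \<phi> z)"
      using \<theta> by (intro Lp_order_mult tQ dM t\<phi>') auto
    then have a3: "?T 1 \<sigma> (\<lambda>e z. Q e (R e z) * (M e j z - \<rho> z * u j z) * pd c \<phi> z)" by (rule up) (use \<theta>1 \<sigma> in auto)
    have "?T 1 \<sigma> (\<lambda>e z. ((p (\<rho> z) + P (\<rho> z) - \<rho> z * Q e (\<rho> z)) * u j z * pd c \<phi> z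
       + (\<rho> z * (Q e (\<rho> z) - Q e (R e z))) * u j z * pd c \<phi> z) - Q e (R e z) * (M e j z - \<rho> z * u j z) * pd c \<phi> z)"
      by (rule Lp_order_diff[OF Lp_order_add[OF a1 a2 zero_le_one] a3 zero_le_one e0(2)])
    then show ?thesis
      by (rule Lp_order_cong[OF _ e0(2)]) (intro AE_I2, simp add: algebra_simps)
  qed
  \<comment> \<open>the commutator errors, of order \<open>2 \<alpha> + \<beta> - 1\<close>\<close>
  have k5: "?T 1 \<sigma> (\<lambda>e z. (M e i z - R e z * U e i z) * pd c (\<lambda>z. \<phi> z * U e i z) z)" for i c
    by (rule up[OF Lp_order_mult[OF c1 p\<psi>]]) (use \<theta> \<sigma> in auto)
  have k6: "?T 1 \<sigma> (\<lambda>e z. (F e i j z - M e j z * U e i z) * pd c (\<lambda>z. \<phi> z * U e i z) z)" for i j c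
    by (rule up[OF Lp_order_mult[OF c2 p\<psi>]]) (use \<theta> \<sigma> in auto)
  have \<gamma>\<kappa>: "0 \<le> \<gamma> * \<kappa>" "\<gamma> * \<kappa> \<le> 2 * \<kappa>" using \<gamma> \<theta> by (auto intro: mult_right_mono)
  \<comment> \<open>the pressure error: \<open>Pm - p(R)\<close> and \<open>p(R) - pe(R)\<close> both have order \<open>\<gamma> \<beta>\<close>\<close>
  have k7: "?T 1 \<sigma> (\<lambda>e z. (Pm e z - pe e (R e z)) * pd c (\<lambda>z. \<phi> z * U e j z) z)" for j c
  proof -
    have 1: "?T (\<gamma> * \<kappa>) (\<gamma> * \<beta>) (\<lambda>e z. Pm e z - p (R e z))"
      unfolding Pm_def R_def g_def
      by (rule Lp_order_pressure_commutator[OF \<eta> e0(2) ball[OF s\<rho>] i\<rho> lohi(2) ball[OF p\<rho>] \<theta>(2) _ _ \<theta>1(2) taylor C])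
        (use \<gamma> \<gamma>\<kappa> \<theta> in auto)
    have "?T 0 (\<gamma> * \<beta>) (\<lambda>e z. p (R e z) - pe e (R e z))"
      by (rule Lp_order_bounded[where C = C]) (use regD(3) Rin in \<open>simp add: abs_minus_commute mult.commute\<close>)
    then have 2: "?T (\<gamma> * \<kappa>) (\<gamma> * \<beta>) (\<lambda>e z. p (R e z) - pe e (R e z))"
      by (rule Lp_order_mono[OF _ zero_le_one e0(2) \<gamma>\<kappa>(1) order_refl]) simp
    have "?T (\<gamma> * \<kappa>) (\<gamma> * \<beta>) (\<lambda>e z. Pm e z - pe e (R e z))"
      using Lp_order_add[OF 1 2 \<gamma>\<kappa>(1)] by simp
    from Lp_order_mult[OF this p\<psi>[of j c] \<gamma>\<kappa>(1) \<theta>(1)] show ?thesis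
      by (rule up) (use \<gamma>\<kappa> \<theta> \<sigma> in auto)
  qed
  \<comment> \<open>near vacuum \<open>Q'\<close> is large, but its bound \<open>e\<close> to the power \<open>\<beta> (\<gamma> - 2)\<close> is affordable\<close>
  have k8: "?T 1 \<sigma> (\<lambda>e z. \<phi> z * (M e j z - R e z * U e j z) * Q' e (R e z) * pd c (R e) z)" for j c
  proof -
    have "?T (0 + (\<kappa> + \<theta>) + 0 + \<kappa>) (0 + (\<beta> + \<alpha>) + \<beta> * (\<gamma> - 2) + (\<beta> - 1)) (\<lambda>e z. \<phi> z * (M e j z - R e z * U e j z) * Q' e (R e z) * pd c (R e) z)"
      using \<theta> by (intro Lp_order_mult t\<phi> c1 tQ' pR) auto
    then show ?thesis by (rule up) (use \<theta> \<sigma> in \<open>auto simp: algebra_simps\<close>)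
  qed
  define Y where "Y z = (\<Sum>i\<in>UNIV. 1 / 2 * (\<rho> z * (u i z)\<^sup>2) * pd (1, 0) \<phi> z
             + (\<Sum>j\<in>UNIV. 1 / 2 * ((u i z)\<^sup>2 * (\<rho> z * u j z)) * pd (0, axis j 1) \<phi> z))
          + P (\<rho> z) * pd (1, 0) \<phi> z
          + (\<Sum>j\<in>UNIV. (p (\<rho> z) + P (\<rho> z)) * u j z * pd (0, axis j 1) \<phi> z)" for z
  have YX: "Y z - X e z = (\<Sum>i\<in>UNIV. 1 / 2 * ((\<rho> z * (u i z)\<^sup>2 - R e z * (U e i z)\<^sup>2) * pd (1, 0) \<phi> z)
        - (M e i z - R e z * U e i z) * pd (1, 0) (\<lambda>z. \<phi> z * U e i z) z
        + (\<Sum>j\<in>UNIV. 1 / 2 * (((u i z)\<^sup>2 * (\<rho> z * u j z) - (U e i z)\<^sup>2 * M e j z) * pd (0, axis j 1) \<phi> z)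
             - (F e i j z - M e j z * U e i z) * pd (0, axis j 1) (\<lambda>z. \<phi> z * U e i z) z))
      + (P (\<rho> z) - (R e z * Q e (R e z) - pe e (R e z))) * pd (1, 0) \<phi> z
      + (\<Sum>j\<in>UNIV. ((p (\<rho> z) + P (\<rho> z)) * u j z - Q e (R e z) * M e j z) * pd (0, axis j 1) \<phi> z
           - (Pm e z - pe e (R e z)) * pd (0, axis j 1) (\<lambda>z. \<phi> z * U e j z) z
           - \<phi> z * (M e j z - R e z * U e j z) * Q' e (R e z) * pd (0, axis j 1) (R e) z)" for e z
    unfolding Y_def X_def
    by (simp add: left_diff_distrib right_diff_distrib sum_subtractf sum.distrib)
  have TW: "?T 1 \<sigma> (\<lambda>e z. Y z - X e z)"
    unfolding YX by (intro Lp_order_add Lp_order_sum Lp_order_diff Lp_order_cmult k1 k2 k3 k4 k5 k6 k7 k8 e0(2)) auto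
  then obtain K where K: "0 \<le> K" "\<And>e. 0 < e \<Longrightarrow> e < e0 \<Longrightarrow> (\<integral>\<^sup>+z. ennreal \<bar>Y z - X e z\<bar> \<partial>strip_measure a b) \<le> ennreal (K * e powr \<sigma>)"
    using Lp_order_integral[OF TW finite_strip_measure] by auto
  have "(\<integral>z. Y z \<partial>cell_measure) = 0"
  proof (cases "integrable cell_measure Y")
    case False
    then show ?thesis by (rule not_integrable_integral_eq)
  next
    case True
    show ?thesis
    proof (rule vanishing_limit[OF e0(1) \<sigma>(1)])
      fix e assume e: "0 < e" "e < e0"
      have i: "integrable cell_measure (\<lambda>z. Y z - X e z)" using True X0[OF e] by auto
      have m: "(\<lambda>z. ennreal \<bar>Y z - X e z\<bar>) \<in> borel_measurable borel"
        using borel_measurable_integrable[OF i] by simp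
      have off: "Y z - X e z = 0" if "fst z \<notin> {a..b}" for z
      proof -
        have "\<phi> z = 0" "pd c \<phi> z = 0" "pd c (\<lambda>z. \<phi> z * U e i z) z = 0" for c i
          using time_supportedD[OF _ that] \<phi>'(3) pd_time_supported[OF \<phi>'(3)]
            pd_time_supported[OF time_supported_mult[OF \<phi>'(3)]] by blast+
        then show ?thesis unfolding Y_def X_def by simp
      qed
      have "(\<integral>z. Y z \<partial>cell_measure) = (\<integral>z. Y z - X e z \<partial>cell_measure)"
        using True X0[OF e] by simp
      moreover have "ennreal (norm (\<integral>z. Y z - X e z \<partial>cell_measure)) \<le> (\<integral>\<^sup>+z. ennreal (norm (Y z - X e z)) \<partial>cell_measure)"
        by (rule integral_norm_bound_ennreal[OF i])
      moreover have "(\<integral>\<^sup>+z. ennreal (norm (Y z - X e z)) \<partial>cell_measure) = (\<integral>\<^sup>+z. ennreal \<bar>Y z - X e z\<bar> \<partial>strip_measure a b)"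
      proof -
        have "(\<integral>\<^sup>+z. ennreal \<bar>Y z - X e z\<bar> \<partial>strip_measure a b) = (\<integral>\<^sup>+z. ennreal \<bar>Y z - X e z\<bar> * indicator ({a..b} \<times> unit_cell) z \<partial>lborel)"
          unfolding strip_measure_def using m strip_borel[of "{a..b}"] by (subst nn_integral_density) (auto simp: mult.commute)
        also have "\<dots> = (\<integral>\<^sup>+z. ennreal \<bar>Y z - X e z\<bar> * indicator (UNIV \<times> unit_cell) z \<partial>lborel)"
          by (intro nn_integral_cong) (use off in \<open>force simp: indicator_def\<close>)
        also have "\<dots> = (\<integral>\<^sup>+z. ennreal \<bar>Y z - X e z\<bar> \<partial>cell_measure)" by (rule nn_integral_cell_measure[OF m, symmetric])
        finally show ?thesis by simp
      qed
      ultimately have "ennreal \<bar>\<integral>z. Y z \<partial>cell_measure\<bar> \<le> ennreal (K * e powr \<sigma>)" using K(2)[OF e] by simp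
      then show "\<bar>\<integral>z. Y z \<partial>cell_measure\<bar> \<le> K * e powr \<sigma>" using K(1) by (simp add: ennreal_le_iff)
    qed
  qed
  then show ?thesis unfolding Y_def .
qed

section \<open>The local energy balance\<close>

text \<open>
Lebesgue measure is complete, so a function that agrees almost everywhere with a Borel function is
measurable, and integrals can be computed from the Borel representative.
\<close>

lemma lebesgue_on_transfer:
  fixes V V' :: "real \<times> (real ^ 'd) \<Rightarrow> 'b::euclidean_space"
  assumes A: "A \<in> sets borel" and ae: "AE z in lborel. z \<in> A \<longrightarrow> V z = V' z" and V'[measurable]: "V' \<in> borel_measurable borel"
  shows "(\<lambda>z. indicator A z *\<^sub>R V z) \<in> borel_measurable lebesgue"
    and "integrable lebesgue (\<lambda>z. indicator A z *\<^sub>R V z) \<longleftrightarrow> integrable lborel (\<lambda>z. indicator A z *\<^sub>R V' z)"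
    and "(\<integral>z. V z \<partial>lebesgue_on A) = (\<integral>z. indicator A z *\<^sub>R V' z \<partial>lborel)"
proof -
  have m': "(\<lambda>z. indicator A z *\<^sub>R V' z) \<in> borel_measurable lborel" using A by measurable
  then have m'': "(\<lambda>z. indicator A z *\<^sub>R V' z) \<in> borel_measurable lebesgue"
    by (rule measurable_completion)
  have ae': "AE z in lebesgue. indicator A z *\<^sub>R V' z = indicator A z *\<^sub>R V z"
    using AE_completion[OF ae] by eventually_elim (auto simp: indicator_def)
  show m: "(\<lambda>z. indicator A z *\<^sub>R V z) \<in> borel_measurable lebesgue"
    by (rule borel_measurable_AE[OF m'' ae'])
  have ae'': "AE z in lebesgue. indicator A z *\<^sub>R V z = indicator A z *\<^sub>R V' z" using ae' by eventually_elim (rule sym)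
  have "integrable lebesgue (\<lambda>z. indicator A z *\<^sub>R V z) \<longleftrightarrow> integrable lebesgue (\<lambda>z. indicator A z *\<^sub>R V' z)"
    by (rule integrable_cong_AE[OF m m'' ae''])
  then show "integrable lebesgue (\<lambda>z. indicator A z *\<^sub>R V z) \<longleftrightarrow> integrable lborel (\<lambda>z. indicator A z *\<^sub>R V' z)"
    using integrable_completion[OF m'] by simp
  have "(\<integral>z. V z \<partial>lebesgue_on A) = (\<integral>z. indicator A z *\<^sub>R V z \<partial>lebesgue)"
    using A by (subst integral_restrict_space) auto
  also have "\<dots> = (\<integral>z. indicator A z *\<^sub>R V' z \<partial>lebesgue)" by (rule integral_cong_AE[OF m m'' ae''])
  also have "\<dots> = (\<integral>z. indicator A z *\<^sub>R V' z \<partial>lborel)" by (rule integral_completion[OF m'])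
  finally show "(\<integral>z. V z \<partial>lebesgue_on A) = (\<integral>z. indicator A z *\<^sub>R V' z \<partial>lborel)" .
qed

lemma integral_slab_cell_cell_measure:
  fixes V V' :: "real \<times> (real ^ 'd) \<Rightarrow> real"
  assumes ae: "AE z in lborel. z \<in> slab_cell T \<longrightarrow> V z = V' z" and V'[measurable]: "V' \<in> borel_measurable borel"
    and off: "\<And>z. fst z \<notin> {0<..<T} \<Longrightarrow> V' z = 0"
  shows "(\<integral>z. V z \<partial>lebesgue_on (slab_cell T)) = (\<integral>z. V' z \<partial>cell_measure)"
proof -
  have S: "(UNIV \<times> unit_cell :: (real \<times> (real ^ 'd)) set) \<in> sets borel" by (rule strip_borel) simp
  have eq: "(cell_measure :: (real \<times> (real ^ 'd)) measure) = density lborel (\<lambda>z. ennreal (indicator (UNIV \<times> unit_cell) z))"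
    by (simp add: cell_measure_def ennreal_indicator)
  have "(\<integral>z. V z \<partial>lebesgue_on (slab_cell T)) = (\<integral>z. indicator (slab_cell T) z *\<^sub>R V' z \<partial>lborel)"
    by (rule lebesgue_on_transfer[OF slab_cell_borel ae V'])
  also have "\<dots> = (\<integral>z. indicator (UNIV \<times> unit_cell) z *\<^sub>R V' z \<partial>lborel)"
  proof (intro Bochner_Integration.integral_cong refl)
    fix z :: "real \<times> (real ^ 'd)"
    show "indicator (slab_cell T) z *\<^sub>R V' z = indicator (UNIV \<times> unit_cell) z *\<^sub>R V' z"
      using off[of z] by (cases z) (auto simp: slab_cell_def indicator_def)
  qed
  also have "\<dots> = (\<integral>z. V' z \<partial>cell_measure)"
    unfolding eq using S by (subst integral_density) auto
  finally show ?thesis .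
qed

text \<open>
The densities and fluxes of the Euler system are at most quadratic in the velocity, which is square
integrable.
\<close>

lemma strip_integrable_dominated:
  fixes f N :: "real \<times> (real ^ 'd) \<Rightarrow> real"
  assumes f: "f \<in> borel_measurable borel" "space_periodic f" "\<And>z. fst z \<notin> {0<..<T} \<Longrightarrow> f z = 0"
    and K: "0 \<le> K" "\<And>z. \<bar>f z\<bar> \<le> K * (1 + (N z)\<^sup>2)" and [measurable]: "N \<in> borel_measurable borel"
    and N: "(\<integral>\<^sup>+z. ennreal ((N z)\<^sup>2) * indicator (slab_cell T) z \<partial>lborel) < \<infinity>"
  shows "strip_integrable f"
  unfolding strip_integrable_def
proof (intro conjI allI f)
  fix a b
  have [measurable]: "f \<in> borel_measurable borel" by (rule f)
  have S: "(slab_cell T :: (real \<times> (real ^ 'd)) set) \<in> sets borel" by (rule slab_cell_borel)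
  have fin: "emeasure lborel (slab_cell T :: (real \<times> (real ^ 'd)) set) < \<infinity>"
    by (rule emeasure_slab_cell)
  have "(\<integral>\<^sup>+z. ennreal (norm (indicator {a..b} (fst z) * f z)) \<partial>cell_measure)
    = (\<integral>\<^sup>+z. ennreal (norm (indicator {a..b} (fst z) * f z)) * indicator (UNIV \<times> unit_cell) z \<partial>lborel)"
    by (rule nn_integral_cell_measure) measurable
  also have "\<dots> \<le> (\<integral>\<^sup>+z. ennreal K * (indicator (slab_cell T) z + ennreal ((N z)\<^sup>2) * indicator (slab_cell T) z) \<partial>lborel)"
  proof (rule nn_integral_mono)
    fix z :: "real \<times> (real ^ 'd)"
    show "ennreal (norm (indicator {a..b} (fst z) * f z)) * indicator (UNIV \<times> unit_cell) z
      \<le> ennreal K * (indicator (slab_cell T) z + ennreal ((N z)\<^sup>2) * indicator (slab_cell T) z)"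
    proof (cases "z \<in> slab_cell T")
      case True
      have "ennreal (norm (indicator {a..b} (fst z) * f z)) \<le> ennreal (K * (1 + (N z)\<^sup>2))"
        using K(2)[of z] K(1) by (intro ennreal_leI) (auto simp: indicator_def)
      also have "\<dots> = ennreal K * (1 + ennreal ((N z)\<^sup>2))" using K(1) by (simp add: ennreal_mult)
      finally show ?thesis using True by (auto simp: indicator_def)
    next
      case False
      then have "indicator (UNIV \<times> unit_cell) z = (0 :: ennreal) \<or> f z = 0"
        using f(3)[of z] by (cases z) (auto simp: slab_cell_def indicator_def)
      then show ?thesis by auto
    qed
  qed
  also have "\<dots> = ennreal K * (emeasure lborel (slab_cell T :: (real \<times> (real ^ 'd)) set) + (\<integral>\<^sup>+z. ennreal ((N z)\<^sup>2) * indicator (slab_cell T) z \<partial>lborel))"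
    using S by (subst nn_integral_cmult) (auto simp: nn_integral_add)
  also have "\<dots> < \<infinity>" using fin N by (simp add: ennreal_mult_less_top ennreal_add_less_top)
  finally show "integrable cell_measure (\<lambda>z. indicator {a..b} (fst z) * f z)"
    unfolding integrable_iff_bounded by simp
qed

lemma set_integrable_strip:
  fixes V V' :: "real \<times> (real ^ 'd) \<Rightarrow> 'b::euclidean_space"
  assumes ab: "0 < a" "b < T" and ae: "AE z in lborel. z \<in> slab T \<longrightarrow> V z = V' z" and V'[measurable]: "V' \<in> borel_measurable borel"
    and G: "Lp_order (strip_measure a b) 1 1 0 (\<lambda>e. G)" and le: "\<And>z. norm (V' z) \<le> K * \<bar>G z\<bar>"
  shows "set_integrable lebesgue ({a..b} \<times> unit_cell) V"
proof -
  let ?A = "{a..b} \<times> unit_cell :: (real \<times> (real ^ 'd)) set"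
  have A: "?A \<in> sets borel" by (rule strip_borel) simp
  have ae': "AE z in lborel. z \<in> ?A \<longrightarrow> V z = V' z"
    using ae by eventually_elim (use ab in \<open>auto simp: slab_def\<close>)
  have "Lp_order (strip_measure a b) 1 1 0 (\<lambda>e z. norm (V' z))"
  proof (rule Lp_order_mono[OF G _ order_refl order_refl order_refl, of "\<bar>K\<bar>"])
    fix e show "AE z in strip_measure a b. \<bar>norm (V' z)\<bar> \<le> \<bar>K\<bar> * \<bar>G z\<bar>"
    proof (rule AE_I2)
      fix z
      have "norm (V' z) \<le> K * \<bar>G z\<bar>" by (rule le)
      also have "\<dots> \<le> \<bar>K\<bar> * \<bar>G z\<bar>" by (intro mult_right_mono) auto
      finally show "\<bar>norm (V' z)\<bar> \<le> \<bar>K\<bar> * \<bar>G z\<bar>" by simp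
    qed
  qed simp
  then obtain C where "\<forall>e. 0 < e \<and> e < 1 \<longrightarrow> (\<integral>\<^sup>+z. ennreal \<bar>norm (V' z)\<bar> \<partial>strip_measure a b) \<le> ennreal (C * e powr 0)"
    using Lp_order_integral[OF _ finite_strip_measure] by (metis order_refl zero_le_one)
  from this[rule_format, of "1 / 2"] have "(\<integral>\<^sup>+z. ennreal (norm (V' z)) \<partial>strip_measure a b) < \<infinity>"
    by (simp add: le_less_trans)
  then have "(\<integral>\<^sup>+z. ennreal (norm (V' z)) * indicator ?A z \<partial>lborel) < \<infinity>"
    unfolding strip_measure_def using A by (subst (asm) nn_integral_density_indicator) auto
  moreover have "ennreal (norm (indicator ?A z *\<^sub>R V' z)) = ennreal (norm (V' z)) * indicator ?A z" for z
    by (auto simp: indicator_def)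
  moreover have "(\<lambda>z. indicator ?A z *\<^sub>R V' z) \<in> borel_measurable lborel" using A by measurable
  ultimately have "integrable lborel (\<lambda>z. indicator ?A z *\<^sub>R V' z)"
    unfolding integrable_iff_bounded by simp
  then show ?thesis
    unfolding set_integrable_def lebesgue_on_transfer(2)[OF A ae' V'] .
qed

lemma balance_transfer:
  fixes w w' :: "real \<times> (real ^ 'd) \<Rightarrow> real" and F :: "real \<times> (real ^ 'd) \<Rightarrow> real ^ 'd" and F' :: "'d \<Rightarrow> real \<times> (real ^ 'd) \<Rightarrow> real"
  assumes w: "AE z in lborel. z \<in> slab T \<longrightarrow> w z = w' z" and F: "AE z in lborel. z \<in> slab T \<longrightarrow> (\<forall>i. F z $ i = F' i z)"
    and [measurable]: "w' \<in> borel_measurable borel" "\<And>i. F' i \<in> borel_measurable borel" and \<phi>: "test_function T \<phi>"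
  shows "(LINT z|lebesgue_on (slab_cell T). w z * dt \<phi> z + F z \<bullet> grad \<phi> z)
    = (\<integral>z. w' z * pd (1, 0) \<phi> z + (\<Sum>i\<in>UNIV. F' i z * pd (0, axis i 1) \<phi> z) \<partial>cell_measure)"
proof (rule integral_slab_cell_cell_measure)
  have \<phi>1: "Ck (Suc 0) \<phi>" using \<phi> smooth_C1 unfolding test_function_def by blast
  have [measurable]: "pd c \<phi> \<in> borel_measurable borel" for c
    by (rule borel_measurable_continuous_onI[OF pd_continuous[OF \<phi>1]])
  show "AE z in lborel. z \<in> slab_cell T \<longrightarrow> w z * dt \<phi> z + F z \<bullet> grad \<phi> z = w' z * pd (1, 0) \<phi> z + (\<Sum>i\<in>UNIV. F' i z * pd (0, axis i 1) \<phi> z)"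
    using w F by eventually_elim (auto simp: slab_cell_def slab_def dt_def grad_def inner_vec_def)
  show "(\<lambda>z. w' z * pd (1, 0) \<phi> z + (\<Sum>i\<in>UNIV. F' i z * pd (0, axis i 1) \<phi> z)) \<in> borel_measurable borel"
    by measurable
  fix z :: "real \<times> (real ^ 'd)" assume z: "fst z \<notin> {0<..<T}"
  obtain a b where ab: "0 < a" "b < T" "time_supported a b \<phi>"
    using \<phi> unfolding test_function_def time_supported_def by blast
  have "pd c \<phi> z = 0" for c
    by (rule time_supportedD[OF pd_time_supported[OF ab(3)]]) (use z ab in auto)
  then show "w' z * pd (1, 0) \<phi> z + (\<Sum>i\<in>UNIV. F' i z * pd (0, axis i 1) \<phi> z) = 0" by simp
qed

lemma reciprocal_bounds:
  assumes r: "2 \<le> r" and q: "2 \<le> q" and 1: "1 / r + 2 / q \<le> 1" and 2: "2 / r + 1 / q \<le> 1"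
  shows "0 \<le> reciprocal r" "0 \<le> reciprocal q"
    "2 * reciprocal r + reciprocal q \<le> 1" "reciprocal r + 2 * reciprocal q \<le> 1"
proof -
  show n: "0 \<le> reciprocal r" "0 \<le> reciprocal q" by (simp_all add: reciprocal_def)
  have e: "1 / x = ennreal (reciprocal x)" "2 / x = ennreal (2 * reciprocal x)" if x: "2 \<le> x" for x
  proof -
    have fin: "1 / x < \<infinity>"
    proof (cases "x = \<infinity>")
      case False
      then obtain y where "x = ennreal y" "0 < y" using exponent_ge_2[OF x] by (cases x) auto
      then have "1 / x = ennreal (1 / y)" using divide_ennreal[of 1 y] by simp
      then show ?thesis by simp
    qed simp
    then show 1: "1 / x = ennreal (reciprocal x)" by (simp add: reciprocal_def)
    have "2 / x = 2 * (1 / x)" by (simp add: divide_ennreal_def)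
    then show "2 / x = ennreal (2 * reciprocal x)" unfolding 1 by (simp add: ennreal_mult reciprocal_def)
  qed
  show "2 * reciprocal r + reciprocal q \<le> 1"
    using 2 n unfolding e[OF r] e[OF q] by (simp add: ennreal_plus[symmetric] ennreal_1[symmetric] del: ennreal_plus ennreal_1)
  show "reciprocal r + 2 * reciprocal q \<le> 1"
    using 1 n unfolding e[OF r] e[OF q] by (simp add: ennreal_plus[symmetric] ennreal_1[symmetric] del: ennreal_plus ennreal_1)
qed

text \<open>
The bounds on the density hold only almost everywhere, so that \<open>lo \<le> hi\<close> has to be read off from a
set of positive measure.
\<close>

lemma slab_cell_not_null:
  assumes "0 < T" "AE z in lborel. z \<in> (slab_cell T :: (real \<times> (real ^ 'd)) set) \<longrightarrow> P"
  shows P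
proof (rule ccontr)
  assume "\<not> P"
  then have ae: "AE z in lborel. z \<notin> (slab_cell T :: (real \<times> (real ^ 'd)) set)" using assms(2) by simp
  let ?B = "{0<..<T} \<times> box (0 :: real ^ 'd) 1"
  have sub: "?B \<subseteq> slab_cell T" by (auto simp: slab_cell_def unit_cell_def mem_box_cart less_imp_le)
  have op: "open ?B" by (intro open_Times) auto
  have "(T / 2, (\<chi> i. 1 / 2) :: real ^ 'd) \<in> ?B" using assms(1) by (auto simp: mem_box_cart)
  then have "?B \<noteq> {}" by blast
  then have "\<not> negligible ?B" by (rule open_not_negligible[OF op])
  moreover have "?B \<in> null_sets lebesgue"
  proof -
    have "AE z in lborel. z \<notin> ?B" using ae by eventually_elim (use sub in blast)
    then have "?B \<in> null_sets lborel" using op by (subst (asm) AE_iff_null_sets[symmetric]) auto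
    then show ?thesis by (rule null_sets_completionI)
  qed
  ultimately show False by (simp add: negligible_iff_null_sets)
qed

lemma increment_order_component:
  assumes "Lp_order (strip_measure a b \<Otimes>\<^sub>M ball_measure) e0 \<theta> s (\<lambda>e p. norm (w (fst p - e *\<^sub>R snd p) - w (fst p)))" "e0 \<le> 1"
    and "\<And>x y. \<bar>f x - f y\<bar> \<le> norm (w x - w y)"
  shows "increment_order a b e0 \<theta> s f"
  unfolding increment_order_def
  by (rule Lp_order_mono[OF assms(1) zero_le_one assms(2) order_refl order_refl]) (simp add: assms(3))


lemma lipschitz_compose_measurable:
  fixes f :: "real \<Rightarrow> real"
  assumes "lo \<le> hi" and L: "\<And>s t. s \<in> {lo..hi} \<Longrightarrow> t \<in> {lo..hi} \<Longrightarrow> \<bar>f s - f t\<bar> \<le> C * \<bar>s - t\<bar>"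
    and m: "\<rho> \<in> borel_measurable M" and r: "\<And>z. \<rho> z \<in> {lo..hi}"
  shows "(\<lambda>z. f (\<rho> z)) \<in> borel_measurable M"
proof -
  have "continuous_on {lo..hi} f"
    unfolding continuous_on_iff
  proof (intro ballI allI impI)
    fix s e :: real assume s: "s \<in> {lo..hi}" and e: "0 < e"
    define d where "d = e / (\<bar>C\<bar> + 1)"
    have d: "0 < d" "\<bar>C\<bar> * d < e" using e by (auto simp: d_def field_simps)
    show "\<exists>d>0. \<forall>t\<in>{lo..hi}. dist t s < d \<longrightarrow> dist (f t) (f s) < e"
    proof (intro exI[of _ d] conjI ballI impI d)
      fix t assume t: "t \<in> {lo..hi}" "dist t s < d"
      have "\<bar>f t - f s\<bar> \<le> C * \<bar>t - s\<bar>" by (rule L[OF t(1) s])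
      also have "\<dots> \<le> \<bar>C\<bar> * \<bar>t - s\<bar>" by (intro mult_right_mono) auto
      also have "\<dots> \<le> \<bar>C\<bar> * d" using t(2) by (intro mult_left_mono) (auto simp: dist_real_def)
      finally show "dist (f t) (f s) < e" using d by (simp add: dist_real_def)
    qed
  qed
  then have "continuous_on UNIV (\<lambda>s. f (max lo (min hi s)))"
    by (rule continuous_on_compose2) (use assms(1) in \<open>auto intro!: continuous_intros\<close>)
  then have "(\<lambda>s. f (max lo (min hi s))) \<in> borel_measurable borel" by (rule borel_measurable_continuous_onI)
  from measurable_compose[OF m this] have "(\<lambda>z. f (max lo (min hi (\<rho> z)))) \<in> borel_measurable M" .
  moreover have "max lo (min hi (\<rho> z)) = \<rho> z" for z using r[of z] by auto
  ultimately show ?thesis by simp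
qed

theorem corollary4p10:
  fixes T \<alpha> \<beta> \<gamma> \<delta> \<rho>lo \<rho>hi :: real
    and r q :: ennreal
    and \<rho> \<eta> :: "real \<times> (real ^ 'd) \<Rightarrow> real"
    and u :: "real \<times> (real ^ 'd) \<Rightarrow> real ^ 'd"
    and p :: "real \<Rightarrow> real"
  assumes "0 < T"
    and "1 < \<gamma>" and "\<gamma> < 2"
    and "space_periodic \<rho>" and "space_periodic u"
    and "euler_solution T p \<rho> u"
    and "u \<in> besov T \<alpha> r"
    and "\<rho> \<in> besov T \<beta> q"
    and "(\<lambda>z. \<rho> z *\<^sub>R u z) \<in> besov T \<beta> q"
    and "0 \<le> \<rho>lo"
    and "AE z in lebesgue_on (slab_cell T). \<rho>lo \<le> \<rho> z \<and> \<rho> z \<le> \<rho>hi"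
    and "0 \<le> \<alpha>" and "\<alpha> \<le> 1" and "0 \<le> \<beta>" and "\<beta> \<le> 1"
    and "1 / r + 2 / q \<le> 1" and "2 / r + 1 / q \<le> 1"
    and "2 \<le> r" and "2 \<le> q"
    and "\<alpha> + \<gamma> * \<beta> > 1" and "2 * \<alpha> + \<beta> > 1"
    and "mollifier \<eta>"
    and "0 < \<delta>" and "QNS (near_vacuum \<eta> T \<beta> \<delta> \<rho>) \<rho>"
    and "C1_holder (\<gamma> - 1) {\<rho>lo..\<rho>hi} p"
    and "\<rho>lo = 0 \<Longrightarrow> (p has_real_derivative 0) (at_right 0)"
    and "potential_defined \<rho>lo \<rho>hi p"
  shows "weak_balance T
           (\<lambda>z. 1 / 2 * \<rho> z * (norm (u z))\<^sup>2 + pressure_potential p (\<rho> z))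
           (\<lambda>z. (1 / 2 * \<rho> z * (norm (u z))\<^sup>2 + p (\<rho> z) + pressure_potential p (\<rho> z)) *\<^sub>R u z)"
proof -
  note T = assms(1) and \<gamma> = assms(2,3) and per = assms(4,5) and euler = assms(6)
    and bu = assms(7) and b\<rho> = assms(8) and bm = assms(9) and lo = assms(10) and bounds = assms(11)
    and ab = assms(12-15) and r = assms(18) and q = assms(19) and ex = assms(20,21) and \<eta> = assms(22)
  have \<alpha>0: "0 < \<alpha>" using ab ex(2) by linarith
  have \<beta>0: "0 < \<beta>"
  proof -
    have "0 < \<gamma> * \<beta>" using ab ex(1) by linarith
    then show ?thesis using \<gamma> by (simp add: zero_less_mult_iff)
  qed
  define \<theta> \<kappa> where "\<theta> = reciprocal r" and "\<kappa> = reciprocal q"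
  have \<theta>: "0 \<le> \<theta>" "0 \<le> \<kappa>" "2 * \<theta> + \<kappa> \<le> 1" "\<theta> + 2 * \<kappa> \<le> 1"
    unfolding \<theta>_def \<kappa>_def by (rule reciprocal_bounds[OF r q assms(16,17)])+
  have bcell: "AE z in lborel. z \<in> slab_cell T \<longrightarrow> \<rho>lo \<le> \<rho> z \<and> \<rho> z \<le> \<rho>hi"
    by (rule AE_lebesgue_onD[OF bounds]) (use slab_cell_borel[of T] in simp)
  have lohi: "\<rho>lo \<le> \<rho>hi"
  proof (rule slab_cell_not_null[OF T])
    show "AE z in lborel. z \<in> (slab_cell T :: (real \<times> (real ^ 'd)) set) \<longrightarrow> \<rho>lo \<le> \<rho>hi"
      using bcell by eventually_elim auto
  qed
  have bslab: "AE z in lborel. z \<in> slab T \<longrightarrow> \<rho>lo \<le> \<rho> z \<and> \<rho> z \<le> \<rho>hi"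
    by (rule AE_slab_of_cell[OF bcell]) (rule space_periodicI, simp only: space_periodicD[OF per(1)])
  obtain \<rho>1 where \<rho>1: "\<rho>1 \<in> borel_measurable borel" "space_periodic \<rho>1" "AE z in lborel. z \<in> slab T \<longrightarrow> \<rho> z = \<rho>1 z"
    by (rule borel_version[OF per(1), of T]) (use b\<rho> in \<open>auto simp: besov_def\<close>)
  define R where "R z = max \<rho>lo (min \<rho>hi (\<rho>1 z))" for z
  have Rm[measurable]: "R \<in> borel_measurable borel" unfolding R_def[abs_def] using \<rho>1(1) by measurable
  have Rp: "space_periodic R" by (rule space_periodicI) (simp only: R_def space_periodicD[OF \<rho>1(2)])
  have Rin: "R z \<in> {\<rho>lo..\<rho>hi}" for z using lohi by (auto simp: R_def)
  have R\<rho>: "AE z in lborel. z \<in> slab T \<longrightarrow> \<rho> z = R z"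
    using \<rho>1(3) bslab by eventually_elim (auto simp: R_def)
  have um: "(\<lambda>z. u z $ i) \<in> borel_measurable (lebesgue_on (slab_cell T))" for i
  proof (rule measurable_compose[where f = u and g = "\<lambda>v. v $ i" and N = borel])
    show "u \<in> borel_measurable (lebesgue_on (slab_cell T))" using bu by (simp add: besov_def)
    show "(\<lambda>v :: real ^ 'd. v $ i) \<in> borel_measurable borel" by simp
  qed
  have "\<exists>v. v \<in> borel_measurable borel \<and> space_periodic v \<and> (\<forall>z. fst z \<notin> {0<..<T} \<longrightarrow> v z = 0) \<and>
    (AE z in lborel. z \<in> slab T \<longrightarrow> u z $ i = v z)" for i
  proof -
    have "space_periodic (\<lambda>z. u z $ i)" by (rule space_periodicI) (simp only: space_periodicD[OF per(2)])
    show ?thesis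
      by (rule borel_version[OF \<open>space_periodic (\<lambda>z. u z $ i)\<close> um]) (intro exI conjI allI impI; assumption)
  qed
  then obtain U where U: "\<And>i. U i \<in> borel_measurable borel" "\<And>i. space_periodic (U i)"
    "\<And>i z. fst z \<notin> {0<..<T} \<Longrightarrow> U i z = 0" "\<And>i. AE z in lborel. z \<in> slab T \<longrightarrow> u z $ i = U i z"
    by (metis (no_types))
  have Um[measurable]: "U i \<in> borel_measurable borel" for i by (rule U)
  define V where "V z = (\<chi> i. U i z)" for z
  have Vm[measurable]: "V \<in> borel_measurable borel"
  proof (rule borel_measurable_euclidean_space[THEN iffD2], rule ballI)
    fix b :: "real ^ 'd" assume "b \<in> Basis"
    then obtain i where b: "b = axis i 1" by (auto simp: Basis_vec_def)
    have "(\<lambda>z. V z \<bullet> b) = U i" unfolding b by (auto simp: V_def inner_axis)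
    then show "(\<lambda>z. V z \<bullet> b) \<in> borel_measurable borel" by simp
  qed
  have Uu: "AE z in lborel. \<forall>i. z \<in> slab T \<longrightarrow> u z $ i = U i z"
    by (subst AE_all_countable) (use U(4) in blast)
  have Vu: "AE z in lborel. z \<in> slab T \<longrightarrow> u z = V z"
    using Uu by eventually_elim (auto simp: V_def vec_eq_iff)
  have Wu: "AE z in lborel. z \<in> slab T \<longrightarrow> \<rho> z *\<^sub>R u z = R z *\<^sub>R V z"
    using Vu R\<rho> by eventually_elim auto
  have UV: "\<bar>U i z\<bar> \<le> norm (V z)" for i z using component_le_norm_cart[of "V z" i] by (simp add: V_def)
  have normV: "(norm (V z))\<^sup>2 = (\<Sum>i\<in>UNIV. (U i z)\<^sup>2)" for z
    unfolding power2_norm_eq_inner inner_vec_def V_def by (simp add: power2_eq_square)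
  have absR: "\<bar>R z\<bar> \<le> \<rho>hi" for z using Rin[of z] lo by auto
  have hi0: "0 \<le> \<rho>hi" using lo lohi by simp
  define P where "P = pressure_potential p"
  obtain p' C h0 where C: "0 \<le> C" and h0: "0 < h0"
    and taylor: "\<And>s t. s \<in> {\<rho>lo..\<rho>hi} \<Longrightarrow> t \<in> {\<rho>lo..\<rho>hi} \<Longrightarrow> \<bar>p s - p t - p' t * (s - t)\<bar> \<le> C * \<bar>s - t\<bar> powr \<gamma>"
    and pL: "\<And>s t. s \<in> {\<rho>lo..\<rho>hi} \<Longrightarrow> t \<in> {\<rho>lo..\<rho>hi} \<Longrightarrow> \<bar>p s - p t\<bar> \<le> C * \<bar>s - t\<bar>"
    and PL: "\<And>s t. s \<in> {\<rho>lo..\<rho>hi} \<Longrightarrow> t \<in> {\<rho>lo..\<rho>hi} \<Longrightarrow> \<bar>P s - P t\<bar> \<le> C * \<bar>s - t\<bar>"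
    and reg: "\<And>h. 0 < h \<Longrightarrow> h < h0 \<Longrightarrow> \<exists>Q Q' pe. regularised_potential \<rho>lo \<rho>hi p P \<gamma> C h Q Q' pe"
    unfolding P_def
    by (rule pressure_approximation[OF lo lohi \<gamma> assms(25,26,27)]) (assumption | blast)+
  have pR[measurable]: "(\<lambda>z. p (R z)) \<in> borel_measurable borel" by (rule lipschitz_compose_measurable[OF lohi pL Rm Rin])
  have PR[measurable]: "(\<lambda>z. P (R z)) \<in> borel_measurable borel" by (rule lipschitz_compose_measurable[OF lohi PL Rm Rin])
  define K where "K = \<bar>p \<rho>lo\<bar> + \<bar>P \<rho>lo\<bar> + C * (\<rho>hi - \<rho>lo)"
  have pK: "\<bar>p (R z)\<bar> \<le> K" "\<bar>P (R z)\<bar> \<le> K" for z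
  proof -
    have l: "\<rho>lo \<in> {\<rho>lo..\<rho>hi}" using lohi by simp
    have "C * \<bar>R z - \<rho>lo\<bar> \<le> C * (\<rho>hi - \<rho>lo)" using C Rin[of z] by (intro mult_left_mono) auto
    then show "\<bar>p (R z)\<bar> \<le> K" "\<bar>P (R z)\<bar> \<le> K"
      using pL[OF Rin[of z] l] PL[OF Rin[of z] l] by (auto simp: K_def)
  qed
  have K0: "0 \<le> K" using pK(1)[of undefined] by linarith
  have sq: "(\<integral>\<^sup>+z. ennreal ((norm (V z))\<^sup>2) * indicator (slab_cell T) z \<partial>lborel) < \<infinity>"
    by (rule besov_square_integrable[OF bu r Vm Vu])
  have nVm[measurable]: "(\<lambda>z. norm (V z)) \<in> borel_measurable borel" by measurable
  have x2: "x \<le> 1 + x\<^sup>2" for x :: real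
    using zero_le_power2[of "x - 1"] by (simp add: power2_eq_square algebra_simps) (smt (verit) zero_le_square)
  have sU: "strip_integrable (U i)" for i
  proof (rule strip_integrable_dominated[where K = 1, OF U(1,2,3) _ _ nVm sq])
    show "\<bar>U i z\<bar> \<le> 1 * (1 + (norm (V z))\<^sup>2)" for z using UV[of i z] x2[of "norm (V z)"] by simp
  qed auto
  have perM: "space_periodic (\<lambda>z. R z * U i z)" for i
    by (rule space_periodicI) (simp only: space_periodicD[OF Rp] space_periodicD[OF U(2)])
  have sM: "strip_integrable (\<lambda>z. R z * U i z)" for i
  proof (rule strip_integrable_dominated[where T = T and K = \<rho>hi, OF _ perM _ hi0 _ nVm sq])
    show "\<bar>R z * U i z\<bar> \<le> \<rho>hi * (1 + (norm (V z))\<^sup>2)" for z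
      unfolding abs_mult using absR[of z] UV[of i z] x2[of "norm (V z)"] hi0 by (intro mult_mono) auto
  qed (auto simp: U(3))
  have sMU: "strip_integrable (\<lambda>z. R z * U j z * U i z)" for i j
  proof (rule strip_integrable_dominated[where T = T and K = \<rho>hi, OF _ _ _ hi0 _ nVm sq])
    show "space_periodic (\<lambda>z. R z * U j z * U i z)"
      by (rule space_periodicI) (simp only: space_periodicD[OF Rp] space_periodicD[OF U(2)])
    show "\<bar>R z * U j z * U i z\<bar> \<le> \<rho>hi * (1 + (norm (V z))\<^sup>2)" for z
    proof -
      have "\<bar>R z\<bar> * (\<bar>U j z\<bar> * \<bar>U i z\<bar>) \<le> \<rho>hi * (norm (V z) * norm (V z))"
        using absR[of z] UV[of i z] UV[of j z] hi0 by (intro mult_mono) auto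
      also have "\<dots> \<le> \<rho>hi * (1 + (norm (V z))\<^sup>2)" using hi0 by (intro mult_left_mono) (auto simp: power2_eq_square)
      finally show ?thesis by (simp add: abs_mult mult.assoc)
    qed
  qed (auto simp: U(3))
  have spR: "strip_integrable (\<lambda>z. p (R z))"
  proof (rule strip_integrable_bounded[OF pR _ pK(1)])
    show "space_periodic (\<lambda>z. p (R z))" by (rule space_periodicI) (simp only: space_periodicD[OF Rp])
  qed
  have mass: "balance T R (\<lambda>j z. R z * U j z)"
    unfolding balance_def
  proof (intro allI impI)
    fix \<phi> :: "real \<times> (real ^ 'd) \<Rightarrow> real" assume \<phi>: "test_function T \<phi>"
    have "(LINT z|lebesgue_on (slab_cell T). \<rho> z * dt \<phi> z + (\<rho> z *\<^sub>R u z) \<bullet> grad \<phi> z) = 0"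
      using euler \<phi> unfolding euler_solution_def weak_balance_def by blast
    moreover have "AE z in lborel. z \<in> slab T \<longrightarrow> (\<forall>j. (\<rho> z *\<^sub>R u z) $ j = R z * U j z)"
      using R\<rho> Uu by eventually_elim auto
    ultimately show "(\<integral>z. R z * pd (1, 0) \<phi> z + (\<Sum>j\<in>UNIV. R z * U j z * pd (0, axis j 1) \<phi> z) \<partial>cell_measure) = 0"
      using balance_transfer[OF R\<rho> _ Rm _ \<phi>, of "\<lambda>z. \<rho> z *\<^sub>R u z" "\<lambda>j z. R z * U j z"] by simp
  qed
  have mom: "balance T (\<lambda>z. R z * U i z) (\<lambda>j z. R z * U j z * U i z + (if i = j then p (R z) else 0))" for i
    unfolding balance_def
  proof (intro allI impI)
    fix \<phi> :: "real \<times> (real ^ 'd) \<Rightarrow> real" assume \<phi>: "test_function T \<phi>"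
    let ?F = "\<lambda>z. (\<rho> z * u z $ i) *\<^sub>R u z + p (\<rho> z) *\<^sub>R axis i 1"
    have 0: "(LINT z|lebesgue_on (slab_cell T). (\<rho> z * u z $ i) * dt \<phi> z + ?F z \<bullet> grad \<phi> z) = 0"
      using euler \<phi> unfolding euler_solution_def weak_balance_def by blast
    have 1: "AE z in lborel. z \<in> slab T \<longrightarrow> \<rho> z * u z $ i = R z * U i z"
      using R\<rho> Uu by eventually_elim auto
    have 2: "AE z in lborel. z \<in> slab T \<longrightarrow> (\<forall>j. ?F z $ j = R z * U j z * U i z + (if i = j then p (R z) else 0))"
      using R\<rho> Uu by eventually_elim (auto simp: axis_def)
    have 3: "(\<lambda>z. R z * U j z * U i z + (if i = j then p (R z) else 0)) \<in> borel_measurable borel" for j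
      by (cases "i = j") auto
    show "(\<integral>z. R z * U i z * pd (1, 0) \<phi> z + (\<Sum>j\<in>UNIV. (R z * U j z * U i z + (if i = j then p (R z) else 0)) * pd (0, axis j 1) \<phi> z) \<partial>cell_measure) = 0"
      using balance_transfer[OF 1 2 _ 3 \<phi>] 0 by simp
  qed
  have tV: "Lp_order (strip_measure a b) e0 \<theta> 0 (\<lambda>e z. norm (V z))" and tW: "Lp_order (strip_measure a b) e0 \<kappa> 0 (\<lambda>e z. norm (R z *\<^sub>R V z))"
    if "0 < a" "b < T" for a b e0 :: real
    unfolding \<theta>_def \<kappa>_def by (rule besov_Lp_order_norm[OF bu r Vm Vu that], rule besov_Lp_order_norm[OF bm q _ Wu that], measurable)
  show ?thesis
    unfolding weak_balance_def
  proof (intro conjI allI impI)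
    have E: "AE z in lborel. z \<in> slab T \<longrightarrow> 1 / 2 * \<rho> z * (norm (u z))\<^sup>2 + pressure_potential p (\<rho> z)
        = 1 / 2 * R z * (norm (V z))\<^sup>2 + P (R z)"
      using R\<rho> Vu by eventually_elim (auto simp: P_def)
    have G: "AE z in lborel. z \<in> slab T \<longrightarrow> (1 / 2 * \<rho> z * (norm (u z))\<^sup>2 + p (\<rho> z) + pressure_potential p (\<rho> z)) *\<^sub>R u z
        = (1 / 2 * R z * (norm (V z))\<^sup>2 + p (R z) + P (R z)) *\<^sub>R V z"
      using R\<rho> Vu by eventually_elim (auto simp: P_def)
    show "locally_integrable T (\<lambda>z. 1 / 2 * \<rho> z * (norm (u z))\<^sup>2 + pressure_potential p (\<rho> z))"
      unfolding locally_integrable_def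
    proof (intro allI impI, elim conjE)
      fix a b :: real assume ab': "0 < a" "b < T"
      have "Lp_order (strip_measure a b) 1 (\<theta> + \<theta>) (0 + 0) (\<lambda>e z. norm (V z) * norm (V z))"
        using \<theta> by (intro Lp_order_mult tV ab') auto
      then have a1: "Lp_order (strip_measure a b) 1 1 0 (\<lambda>e z. norm (V z) * norm (V z))"
        by (rule Lp_order_mono[OF _ zero_le_one]) (use \<theta> in auto)
      have a2: "Lp_order (strip_measure a b) 1 1 0 (\<lambda>e z. 1)"
        by (rule Lp_order_mono[OF Lp_order_bounded[where C = 1 and s = 0 and D = "\<lambda>e z. 1"] zero_le_one]) auto
      show "set_integrable lebesgue ({a..b} \<times> unit_cell) (\<lambda>z. 1 / 2 * \<rho> z * (norm (u z))\<^sup>2 + pressure_potential p (\<rho> z))"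
      proof (rule set_integrable_strip[OF ab' E _ Lp_order_add[OF a1 a2 zero_le_one]])
        fix z
        have "\<bar>1 / 2 * R z * (norm (V z))\<^sup>2\<bar> \<le> \<rho>hi * (norm (V z))\<^sup>2"
          unfolding abs_mult using absR[of z] hi0 by (intro mult_mono) auto
        then have "\<bar>1 / 2 * R z * (norm (V z))\<^sup>2 + P (R z)\<bar> \<le> \<rho>hi * (norm (V z))\<^sup>2 + K" using pK(2)[of z] by linarith
        also have "\<dots> \<le> (\<rho>hi + K) * (norm (V z))\<^sup>2 + (\<rho>hi + K)"
          using hi0 K0 by (intro add_mono mult_right_mono) auto
        finally show "norm (1 / 2 * R z * (norm (V z))\<^sup>2 + P (R z)) \<le> (\<rho>hi + K) * \<bar>norm (V z) * norm (V z) + 1\<bar>"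
          by (simp add: power2_eq_square distrib_left)
      qed measurable
    qed
    show "locally_integrable T (\<lambda>z. (1 / 2 * \<rho> z * (norm (u z))\<^sup>2 + p (\<rho> z) + pressure_potential p (\<rho> z)) *\<^sub>R u z)"
      unfolding locally_integrable_def
    proof (intro allI impI, elim conjE)
      fix a b :: real assume ab': "0 < a" "b < T"
      have "Lp_order (strip_measure a b) 1 (\<theta> + \<theta> + \<kappa>) (0 + 0 + 0) (\<lambda>e z. norm (V z) * norm (V z) * norm (R z *\<^sub>R V z))"
        using \<theta> by (intro Lp_order_mult tV tW ab') auto
      then have a1: "Lp_order (strip_measure a b) 1 1 0 (\<lambda>e z. norm (V z) * norm (V z) * norm (R z *\<^sub>R V z))"
        by (rule Lp_order_mono[OF _ zero_le_one]) (use \<theta> in auto)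
      have a2: "Lp_order (strip_measure a b) 1 1 0 (\<lambda>e z. norm (V z))"
        by (rule Lp_order_mono[OF tV[OF ab'] zero_le_one]) (use \<theta> in auto)
      show "set_integrable lebesgue ({a..b} \<times> unit_cell) (\<lambda>z. (1 / 2 * \<rho> z * (norm (u z))\<^sup>2 + p (\<rho> z) + pressure_potential p (\<rho> z)) *\<^sub>R u z)"
      proof (rule set_integrable_strip[OF ab' G _ Lp_order_add[OF a1 a2 zero_le_one]])
        fix z
        let ?n = "norm (V z)"
        have "norm ((1 / 2 * R z * ?n\<^sup>2 + p (R z) + P (R z)) *\<^sub>R V z) = \<bar>1 / 2 * R z * ?n\<^sup>2 + p (R z) + P (R z)\<bar> * ?n" by simp
        also have "\<dots> \<le> (\<bar>R z\<bar> * ?n\<^sup>2 + 2 * K) * ?n"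
        proof (intro mult_right_mono)
          have "\<bar>1 / 2 * R z * ?n\<^sup>2\<bar> = 1 / 2 * (\<bar>R z\<bar> * ?n\<^sup>2)" by (simp add: abs_mult)
          moreover have "0 \<le> \<bar>R z\<bar> * ?n\<^sup>2" by simp
          ultimately show "\<bar>1 / 2 * R z * ?n\<^sup>2 + p (R z) + P (R z)\<bar> \<le> \<bar>R z\<bar> * ?n\<^sup>2 + 2 * K"
            using pK[of z] by linarith
        qed simp
        also have "\<dots> = ?n * ?n * (\<bar>R z\<bar> * ?n) + 2 * K * ?n" by (simp add: algebra_simps power2_eq_square)
        also have "\<dots> \<le> (1 + 2 * K) * (?n * ?n * (\<bar>R z\<bar> * ?n)) + (1 + 2 * K) * ?n"
          using K0 by (intro add_mono mult_right_mono mult_left_le_one_le) (auto simp: distrib_right)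
        finally show "norm ((1 / 2 * R z * ?n\<^sup>2 + p (R z) + P (R z)) *\<^sub>R V z) \<le> (1 + 2 * K) * \<bar>?n * ?n * norm (R z *\<^sub>R V z) + ?n\<bar>"
          by (simp add: distrib_left)
      qed measurable
    qed
    fix \<phi> :: "real \<times> (real ^ 'd) \<Rightarrow> real" assume \<phi>: "test_function T \<phi>"
    obtain a b where ab': "0 < a" "b < T" and supp: "time_supported a b \<phi>"
      using \<phi> unfolding test_function_def time_supported_def by blast
    have testable: "testable a b \<phi>"
      using \<phi> supp smooth_C1 unfolding testable_def test_function_def by blast
    \<comment> \<open>shifts by less than \<open>e0\<close> keep the support of \<open>\<phi>\<close> in \<open>(0, T)\<close>, and \<open>e0\<^sup>\<beta> \<le> h0\<close> admits the
    regularisation scale \<open>h = e\<^sup>\<beta>\<close>\<close>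
    define e0 where "e0 = min (min 1 (h0 powr (1 / \<beta>))) (min (a / 2) ((T - b) / 2))"
    have e0: "0 < e0" "e0 \<le> 1" "0 < a - e0" "b + e0 < T"
      using ab' h0 by (auto simp: e0_def min_def field_simps)
    have e0h: "e0 powr \<beta> \<le> h0"
    proof -
      have "e0 \<le> h0 powr (1 / \<beta>)" unfolding e0_def by (rule order_trans[OF min.cobounded1 min.cobounded2])
      then have "e0 powr \<beta> \<le> (h0 powr (1 / \<beta>)) powr \<beta>" using e0(1) \<beta>0 by (intro powr_mono2) auto
      then show ?thesis using \<beta>0 h0 by (simp add: powr_powr)
    qed
    have iV: "Lp_order (strip_measure a b \<Otimes>\<^sub>M ball_measure) e0 \<theta> \<alpha> (\<lambda>e p. norm (V (fst p - e *\<^sub>R snd p) - V (fst p)))"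
      unfolding \<theta>_def by (rule besov_Lp_order_increments[OF bu r ab(1) Vm Vu e0(3,4)])
    have iW: "Lp_order (strip_measure a b \<Otimes>\<^sub>M ball_measure) e0 \<kappa> \<beta> (\<lambda>e p. norm (R (fst p - e *\<^sub>R snd p) *\<^sub>R V (fst p - e *\<^sub>R snd p) - R (fst p) *\<^sub>R V (fst p)))"
      unfolding \<kappa>_def by (rule besov_Lp_order_increments[OF bm q ab(3) _ Wu e0(3,4)]) measurable
    have iR: "Lp_order (strip_measure a b \<Otimes>\<^sub>M ball_measure) e0 \<kappa> \<beta> (\<lambda>e p. norm (R (fst p - e *\<^sub>R snd p) - R (fst p)))"
      unfolding \<kappa>_def by (rule besov_Lp_order_increments[OF b\<rho> q ab(3) Rm R\<rho> e0(3,4)])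
    have iu: "increment_order a b e0 \<theta> \<alpha> (U i)" for i
      by (rule increment_order_component[OF iV e0(2)])
        (use component_le_norm_cart[of "V _ - V _" i] in \<open>simp add: V_def\<close>)
    have im: "increment_order a b e0 \<kappa> \<beta> (\<lambda>z. R z * U i z)" for i
      by (rule increment_order_component[where w = "\<lambda>z. R z *\<^sub>R V z", OF iW e0(2)])
        (use component_le_norm_cart[of "R _ *\<^sub>R V _ - R _ *\<^sub>R V _" i] in \<open>simp add: V_def\<close>)
    have ir: "increment_order a b e0 \<kappa> \<beta> R" by (rule increment_order_component[OF iR e0(2)]) simp
    have tu: "Lp_order (strip_measure a b) e0 \<theta> 0 (\<lambda>e. U i)" for i
      by (rule Lp_order_mono[OF tV[OF ab'] zero_le_one e0(2) order_refl order_refl]) (simp add: UV)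
    have tm: "Lp_order (strip_measure a b) e0 \<kappa> 0 (\<lambda>e z. R z * U i z)" for i
      by (rule Lp_order_mono[OF tW[OF ab'] zero_le_one e0(2) order_refl order_refl]) (simp add: UV abs_mult mult_left_mono)
    have main: "(\<integral>z. (\<Sum>i\<in>UNIV. 1 / 2 * (R z * (U i z)\<^sup>2) * pd (1, 0) \<phi> z
             + (\<Sum>j\<in>UNIV. 1 / 2 * ((U i z)\<^sup>2 * (R z * U j z)) * pd (0, axis j 1) \<phi> z))
          + P (R z) * pd (1, 0) \<phi> z
          + (\<Sum>j\<in>UNIV. (p (R z) + P (R z)) * U j z * pd (0, axis j 1) \<phi> z) \<partial>cell_measure) = 0"
      by (rule borel_energy_balance[OF \<eta> e0 lo Rin Rm Rp sU sM sMU spR mass mom iu ir im tu tm \<theta>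
            \<alpha>0 ab(2) \<beta>0 ab(4) \<gamma> ex C e0h taylor reg testable])
    have GF: "AE z in lborel. z \<in> slab T \<longrightarrow> (\<forall>j. ((1 / 2 * \<rho> z * (norm (u z))\<^sup>2 + p (\<rho> z) + pressure_potential p (\<rho> z)) *\<^sub>R u z) $ j
        = (1 / 2 * R z * (norm (V z))\<^sup>2 + p (R z) + P (R z)) * U j z)"
      using G by eventually_elim (auto simp: V_def)
    have pt: "(1 / 2 * R z * (norm (V z))\<^sup>2 + P (R z)) * pd (1, 0) \<phi> z
        + (\<Sum>j\<in>UNIV. (1 / 2 * R z * (norm (V z))\<^sup>2 + p (R z) + P (R z)) * U j z * pd (0, axis j 1) \<phi> z)
      = (\<Sum>i\<in>UNIV. 1 / 2 * (R z * (U i z)\<^sup>2) * pd (1, 0) \<phi> z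
             + (\<Sum>j\<in>UNIV. 1 / 2 * ((U i z)\<^sup>2 * (R z * U j z)) * pd (0, axis j 1) \<phi> z))
          + P (R z) * pd (1, 0) \<phi> z
          + (\<Sum>j\<in>UNIV. (p (R z) + P (R z)) * U j z * pd (0, axis j 1) \<phi> z)" for z
    proof -
      have a: "(\<Sum>i\<in>UNIV. 1 / 2 * (R z * (U i z)\<^sup>2) * pd (1, 0) \<phi> z) = 1 / 2 * R z * (norm (V z))\<^sup>2 * pd (1, 0) \<phi> z"
        unfolding normV sum_distrib_left sum_distrib_right by (intro sum.cong refl) (simp add: mult_ac)
      have "(\<Sum>i\<in>UNIV. \<Sum>j\<in>UNIV. 1 / 2 * ((U i z)\<^sup>2 * (R z * U j z)) * pd (0, axis j 1) \<phi> z)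
        = (\<Sum>j\<in>UNIV. \<Sum>i\<in>UNIV. 1 / 2 * ((U i z)\<^sup>2 * (R z * U j z)) * pd (0, axis j 1) \<phi> z)" by (rule sum.swap)
      also have "\<dots> = (\<Sum>j\<in>UNIV. 1 / 2 * R z * (norm (V z))\<^sup>2 * U j z * pd (0, axis j 1) \<phi> z)"
        unfolding normV sum_distrib_left sum_distrib_right by (intro sum.cong refl) (simp add: mult_ac)
      finally have b: "(\<Sum>i\<in>UNIV. \<Sum>j\<in>UNIV. 1 / 2 * ((U i z)\<^sup>2 * (R z * U j z)) * pd (0, axis j 1) \<phi> z)
        = (\<Sum>j\<in>UNIV. 1 / 2 * R z * (norm (V z))\<^sup>2 * U j z * pd (0, axis j 1) \<phi> z)" .
      show ?thesis
        unfolding sum.distrib a b by (simp only: distrib_right sum.distrib add_ac)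
    qed
    show "(LINT z|lebesgue_on (slab_cell T). (1 / 2 * \<rho> z * (norm (u z))\<^sup>2 + pressure_potential p (\<rho> z)) * dt \<phi> z
      + ((1 / 2 * \<rho> z * (norm (u z))\<^sup>2 + p (\<rho> z) + pressure_potential p (\<rho> z)) *\<^sub>R u z) \<bullet> grad \<phi> z) = 0"
      by (subst balance_transfer[OF E GF _ _ \<phi>]) (measurable, simp only: pt main)
  qed
qed

end
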